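(* Let $\tau\in(2,3)$ and let $(\boldsymbol{d}_n)_{n\ge1}$ be degree sequences, $\boldsymbol d_n$ on $n$ vertices, satisfying Assumption 1 (stated in the context) with exponent $\tau$ and with constant $C$ in part (ii). Let $G_n$ be a uniformly random graph in $\mathcal{G}(\boldsymbol{d}_n)$, let $\mu=\mathbb{E}[D]$, and let $T(G_n)$ be the number of triangles in $G_n$. Then, as $n\to\infty$, $$\frac{T(G_n)}{n^{\frac32(3-\tau)}}\ \stackrel{\mathbb{P}}{\longrightarrow}\ \frac16\,(C(\tau-1))^3\mu^{-\frac32(\tau-1)}\int_0^\infty\int_0^\infty\int_0^\infty\frac{(xyz)^{2-\tau}}{(1+xy)(1+yz)(1+xz)}\,\mathrm{d}x\,\mathrm{d}y\,\mathrm{d}z,$$ and the right-hand side is finite.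
   Context: For each $n$, $\boldsymbol d_n=(d_1,\dots,d_n)$ is a sequence of $n$ positive integers (depending on $n$) with even sum that is realizable, i.e. there is at least one simple graph on vertex set $[n]=\{1,\dots,n\}$ in which vertex $i$ has degree $d_i$ for all $i$. $\mathcal G(\boldsymbol d_n)$ is the set of all such simple graphs. Put $d_{\max}=\max_i d_i$ and $F_n(j)=\frac1n\sum_{i\in[n]}\mathbf 1\{d_i\le j\}$. Assumption 1 (with exponent $\tau\in(2,3)$): (i) there is a constant $K>0$ such that for every $n\ge1$ and every $0\le j\le d_{\max}$, $1-F_n(j)\le Kj^{1-\tau}$ (the right side is $+\infty$ for $j=0$); (ii) there is a constant $C>0$ such that, for all integers $1\le j=O(\sqrt n)$, $1-F_n(j)=Cj^{1-\tau}(1+o(1))$ as $n\to\infty$; i.e. for every constant $b>0$, $\sup_{1\le j\le b\sqrt n}\left|\frac{1-F_n(j)}{Cj^{1-\tau}}-1\right|\to0$. $D$ denotes the positive-integer-valued random variable with $\mathbb P(D>j)=Cj^{1-\tau}$ for integers $j\ge1$. $\stackrel{\mathbb P}{\longrightarrow}$ denotes convergence in probability. *)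

theory Defs
  imports "HOL-Probability.Probability"
begin

text \<open>A simple graph on the vertex set \<open>{1..n}\<close> is represented by its edge set, a set of
  two-element subsets of \<open>{1..n}\<close>.\<close>

definition simple_graphs :: "nat \<Rightarrow> nat set set set" where
  "simple_graphs n = {E. E \<subseteq> {e. e \<subseteq> {1..n} \<and> card e = 2}}"

definition degree :: "nat set set \<Rightarrow> nat \<Rightarrow> nat" where
  "degree E v = card {e \<in> E. v \<in> e}"

definition graphs_with_degrees :: "nat \<Rightarrow> (nat \<Rightarrow> nat) \<Rightarrow> nat set set set" where
  "graphs_with_degrees n d = {E \<in> simple_graphs n. \<forall>i\<in>{1..n}. degree E i = d i}"

definition triangles :: "nat set set \<Rightarrow> nat set set" where
  "triangles E = {t. card t = 3 \<and> (\<forall>u\<in>t. \<forall>v\<in>t. u \<noteq> v \<longrightarrow> {u, v} \<in> E)}"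

definition degree_sequence :: "nat \<Rightarrow> (nat \<Rightarrow> nat) \<Rightarrow> bool" where
  "degree_sequence n d \<longleftrightarrow>
     (\<forall>i\<in>{1..n}. 0 < d i) \<and> even (\<Sum>i\<in>{1..n}. d i) \<and> graphs_with_degrees n d \<noteq> {}"

definition max_degree :: "nat \<Rightarrow> (nat \<Rightarrow> nat) \<Rightarrow> nat" where
  "max_degree n d = Max (d ` {1..n})"

definition degree_cdf :: "nat \<Rightarrow> (nat \<Rightarrow> nat) \<Rightarrow> nat \<Rightarrow> real" where
  "degree_cdf n d j = 1 / real n * (\<Sum>i\<in>{1..n}. of_bool (d i \<le> j))"

text \<open>In the following, \<open>d n\<close> is the degree sequence on \<open>n\<close> vertices. All conditions are
  imposed for \<open>n \<ge> 2\<close> only: on a single vertex no positive degree is realizable, so that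
  including \<open>n = 1\<close> would make the hypotheses contradictory.

  In the tail bound the case \<open>j = 0\<close>, where \<open>j\<^sup>1\<^sup>-\<^sup>\<tau>\<close> is to be read as \<open>\<infinity>\<close>, is left out because
  \<open>0 powr a = 0\<close> in the library. In the uniform tail asymptotics, the index set of the supremum
  is finite, and it is nonempty as soon as \<open>b * sqrt n \<ge> 1\<close>.\<close>

definition degree_sequences :: "(nat \<Rightarrow> nat \<Rightarrow> nat) \<Rightarrow> bool" where
  "degree_sequences d \<longleftrightarrow> (\<forall>n\<ge>2. degree_sequence n (d n))"

definition power_law_tail_bound :: "real \<Rightarrow> (nat \<Rightarrow> nat \<Rightarrow> nat) \<Rightarrow> bool" where
  "power_law_tail_bound \<tau> d \<longleftrightarrow>
     (\<exists>K>0. \<forall>n\<ge>2. \<forall>j\<in>{1..max_degree n (d n)}.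
        1 - degree_cdf n (d n) j \<le> K * real j powr (1 - \<tau>))"

definition power_law_tail_asymp :: "real \<Rightarrow> real \<Rightarrow> (nat \<Rightarrow> nat \<Rightarrow> nat) \<Rightarrow> bool" where
  "power_law_tail_asymp \<tau> C d \<longleftrightarrow>
     (\<forall>b>0. (\<lambda>n. SUP j\<in>{j::nat. 1 \<le> j \<and> real j \<le> b * sqrt (real n)}.
                \<bar>(1 - degree_cdf n (d n) j) / (C * real j powr (1 - \<tau>)) - 1\<bar>)
            \<longlonglongrightarrow> 0)"

definition power_law :: "real \<Rightarrow> real \<Rightarrow> nat pmf \<Rightarrow> bool" where
  "power_law \<tau> C D \<longleftrightarrow>
     (\<forall>k\<in>set_pmf D. 0 < k) \<and>
     (\<forall>j\<ge>1. measure_pmf.prob D {k. j < k} = C * real j powr (1 - \<tau>))"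

text \<open>The mean of such a \<open>D\<close> is a genuine finite expectation, not the default value of the
  Bochner integral of a non-integrable function.\<close>

lemma power_law_integrable:
  assumes "2 < \<tau>" and "power_law \<tau> C D"
  shows "integrable (measure_pmf D) real"
proof -
  have tail: "measure_pmf.prob D {k. j < k} \<le> (if j = 0 then 1 else C * real j powr (1 - \<tau>))" for j
    using assms(2) by (auto simp: power_law_def)
  have "summable (\<lambda>j. real j powr (1 - \<tau>))"
    using assms(1) by (subst summable_real_powr_iff) auto
  then have "summable (\<lambda>j. C * real (Suc j) powr (1 - \<tau>))"
    by (intro summable_mult) (subst summable_Suc_iff)
  moreover have "measure_pmf.prob D {k. Suc j < k} = C * real (Suc j) powr (1 - \<tau>)" for j
    using assms(2) by (auto simp: power_law_def)
  ultimately have "summable (\<lambda>j. measure_pmf.prob D {k. Suc j < k})"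
    by simp
  then have s: "summable (\<lambda>j. measure_pmf.prob D {k. j < k})"
    using summable_Suc_iff[of "\<lambda>j. measure_pmf.prob D {k. j < k}"] by blast
  have "(\<integral>\<^sup>+k. of_nat k \<partial>measure_pmf D)
      = (\<integral>\<^sup>+k. (\<Sum>j. indicator {k. j < k} k) \<partial>measure_pmf D)"
  proof (intro nn_integral_cong)
    fix k :: nat
    have "(\<Sum>j. indicator {k. j < k} k :: ennreal) = (\<Sum>j\<in>{..<k}. indicator {k. j < k} k)"
      by (rule suminf_finite) auto
    also have "\<dots> = (\<Sum>j\<in>{..<k}. 1)"
      by (intro sum.cong) auto
    finally show "of_nat k = (\<Sum>j. indicator {k. j < k} k :: ennreal)"
      by simp
  qed
  also have "\<dots> = (\<Sum>j. \<integral>\<^sup>+k. indicator {k. j < k} k \<partial>measure_pmf D)"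
    by (rule nn_integral_suminf) simp
  also have "\<dots> = (\<Sum>j. ennreal (measure_pmf.prob D {k. j < k}))"
    by (simp add: measure_pmf.emeasure_eq_measure)
  also have "\<dots> < \<infinity>"
    using s by (simp add: suminf_ennreal2)
  finally show ?thesis
    by (intro integrableI_bounded) (auto simp: ennreal_of_nat_eq_real_of_nat)
qed

definition tendsto_in_prob ::
    "(nat \<Rightarrow> 'a measure) \<Rightarrow> (nat \<Rightarrow> 'a \<Rightarrow> real) \<Rightarrow> real \<Rightarrow> bool" where
  "tendsto_in_prob M X c \<longleftrightarrow>
     (\<forall>\<epsilon>>0. (\<lambda>n. measure (M n) {\<omega> \<in> space (M n). \<epsilon> < \<bar>X n \<omega> - c\<bar>}) \<longlonglongrightarrow> 0)"

text \<open>The triple integral is taken in \<open>[0,\<infinity>]\<close>, so that its finiteness is a meaningful claim.\<close>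

definition triangle_integral :: "real \<Rightarrow> ennreal" where
  "triangle_integral \<tau> =
     (\<integral>\<^sup>+x\<in>{0<..}. (\<integral>\<^sup>+y\<in>{0<..}. (\<integral>\<^sup>+z\<in>{0<..}.
        ennreal ((x * y * z) powr (2 - \<tau>) / ((1 + x * y) * (1 + y * z) * (1 + x * z)))
      \<partial>lborel) \<partial>lborel) \<partial>lborel)"

end

theory Submission
  imports Defs
begin

text \<open>The triangles that count are spanned by the vertices of degree of order \<open>sqrt n\<close>. They are found among the
\<^emph>\<open>hubs\<close>, the vertices whose degree exceeds a threshold of slightly smaller order.
The number of vertices of degree of order \<open>sqrt n\<close> is of order \<open>N = n powr ((3 - \<tau>) / 2)\<close>. Even if boundedly many edges are
prescribed, two hubs \<open>u\<close>, \<open>v\<close> are adjacent with probability close to \<open>x / (1 + x)\<close>, where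
\<open>x = d u * d v / L\<close> is the odds and \<open>L\<close>, which is close to \<open>\<mu> * n\<close>, is the total degree. The number of ordered
triangles is therefore close to the sum, over all triples of vertices, of the product of these three
probabilities, and this sum divided by \<open>N ^ 3\<close> is a Riemann sum of the triple integral.

\<^emph>\<open>Edge probabilities.\<close> They are found by switching: the pair of edges \<open>uv, xy\<close> is replaced by \<open>ux, vy\<close>, which
preserves all degrees. For an edge \<open>uv\<close> of the graph, almost all of the \<open>L\<close> ordered edges \<open>(x, y)\<close> can be used, because
a closed neighbourhood carries only \<open>o(n)\<close> of the total degree; conversely a graph without \<open>uv\<close> is
reached from at most \<open>d u * d v\<close> pairs. This gives an upper bound for every pair of vertices
(\<open>edge_prob_upper\<close>). In the reverse switching the obstruction to using \<open>(x, y)\<close> is mainly that \<open>xy\<close> is an edge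
already. The upper bound, applied to the path \<open>u, x, y, v\<close>, shows that the expected number of such
pairs is \<open>o(d u * d v)\<close>, so that a matching lower bound holds (\<open>edge_prob_lower\<close>).

\<^emph>\<open>Moments.\<close> Chaining the edge bounds yields an upper bound for the mean of the number of all ordered
triangles, and for the triangles spanned by hubs a lower bound for the mean and an upper bound for
the second moment (\<open>first_moment_upper\<close>, \<open>first_moment_lower\<close>, \<open>second_moment_upper\<close>). After
scaling, the three bounds converge to \<open>c\<close>, \<open>c\<close> and \<open>c\<^sup>2\<close>. Hence the count on hubs concentrates at \<open>c\<close> by
Chebyshev's inequality, and the difference of the two counts is negligible by Markov's inequality
(\<open>truncated_chebyshev\<close>).

\<^emph>\<open>The Riemann sum.\<close> The degrees are coupled to the measure with density proportional to \<open>x powr (- \<tau>)\<close> on \<open>{0<..}\<close>: there are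
monotone functions \<open>quantile n\<close> whose push-forward of this measure is, away from \<open>0\<close>, the counting measure of the degrees
divided by \<open>N\<close> (\<open>nn_integral_quantile\<close>). The tail asymptotics make \<open>quantile n x / sqrt n\<close> converge to a
multiple of \<open>x\<close>, and the tail bound makes it at most a constant times \<open>x\<close>. As the product of the three edge
probabilities is increasing in each degree, dominated convergence applies
(\<open>weight_sum_tendsto\<close>), provided that the triple integral is finite. It is, because its integrand is bounded by
a product of three integrable functions of one variable (\<open>triangle_integrand_le_majorant\<close>).\<close>

section \<open>Switchings on graphs with given degrees\<close>

definition prob_of_odds :: "real \<Rightarrow> real" where
  "prob_of_odds t = t / (1 + t)"

definition neighbours :: "nat set set \<Rightarrow> nat \<Rightarrow> nat set" where
  "neighbours G u = {x. {u, x} \<in> G}"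

definition extensions :: "nat \<Rightarrow> (nat \<Rightarrow> nat) \<Rightarrow> nat set set \<Rightarrow> nat set set set" where
  "extensions n d J = {G \<in> graphs_with_degrees n d. J \<subseteq> G}"

text \<open>The edges \<open>ab\<close> and \<open>ce\<close> are replaced by \<open>ac\<close> and \<open>be\<close>, so that each of the four vertices loses and gains
one edge.\<close>

definition switch :: "nat \<Rightarrow> nat \<Rightarrow> nat \<Rightarrow> nat \<Rightarrow> nat set set \<Rightarrow> nat set set" where
  "switch a b c e G = G - {{a, b}, {c, e}} \<union> {{a, c}, {b, e}}"

definition total_degree :: "nat \<Rightarrow> (nat \<Rightarrow> nat) \<Rightarrow> nat" where
  "total_degree n d = (\<Sum>i\<in>{1..n}. d i)"

text \<open>A closed neighbourhood has at most \<open>max_degree n d + 1\<close> vertices, so this bounds the degree sum of every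
closed neighbourhood in every realization.\<close>

definition top_degree_sum :: "nat \<Rightarrow> (nat \<Rightarrow> nat) \<Rightarrow> nat" where
  "top_degree_sum n d = Max ((\<lambda>W. \<Sum>i\<in>W. d i) ` {W. W \<subseteq> {1..n} \<and> card W \<le> max_degree n d + 1})"

text \<open>A lower bound for the number of ordered edges \<open>(x, y)\<close> with which a given edge \<open>uv\<close> can be switched away: the
closed neighbourhoods of \<open>u\<close> and \<open>v\<close> each exclude at most \<open>top_degree_sum n d\<close> choices, and up to six prescribed edges
exclude two choices each.\<close>

definition switch_volume :: "nat \<Rightarrow> (nat \<Rightarrow> nat) \<Rightarrow> real" where
  "switch_volume n d = real (total_degree n d) - 2 * real (top_degree_sum n d) - 12"

lemma edge_of_graph:
  assumes "G \<in> graphs_with_degrees n d" "{a, b} \<in> G"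
  shows "a \<noteq> b" "a \<in> {1..n}" "b \<in> {1..n}"
proof -
  from assms have "{a, b} \<subseteq> {1..n}" "card {a, b} = 2"
    by (auto simp: graphs_with_degrees_def simple_graphs_def)
  then show "a \<noteq> b" "a \<in> {1..n}" "b \<in> {1..n}" by auto
qed

lemma graph_edge_cases:
  assumes "G \<in> graphs_with_degrees n d" "e \<in> G"
  obtains a b where "e = {a, b}" "a \<noteq> b" "a \<in> {1..n}" "b \<in> {1..n}"
proof -
  from assms have "e \<subseteq> {1..n}" "card e = 2"
    by (auto simp: graphs_with_degrees_def simple_graphs_def)
  then show ?thesis using that by (metis card_2_iff insert_subset)
qed

lemma graph_subset_Pow: "G \<in> graphs_with_degrees n d \<Longrightarrow> G \<subseteq> Pow {1..n}"
  by (auto simp: graphs_with_degrees_def simple_graphs_def)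

lemma finite_graph: "G \<in> graphs_with_degrees n d \<Longrightarrow> finite G"
  using graph_subset_Pow finite_subset by (metis finite_Pow_iff finite_atLeastAtMost)

lemma finite_graphs_with_degrees: "finite (graphs_with_degrees n d)"
  by (rule finite_subset[of _ "Pow (Pow {1..n})"]) (use graph_subset_Pow in \<open>blast, simp\<close>)

lemma finite_extensions [simp]: "finite (extensions n d J)"
  by (simp add: extensions_def finite_graphs_with_degrees)

lemma extensions_empty [simp]: "extensions n d {} = graphs_with_degrees n d"
  by (simp add: extensions_def)

lemma neighbours_subset:
  "G \<in> graphs_with_degrees n d \<Longrightarrow> neighbours G u \<subseteq> {1..n}"
  unfolding neighbours_def using edge_of_graph(3) by blast

lemma finite_neighbours: "G \<in> graphs_with_degrees n d \<Longrightarrow> finite (neighbours G u)"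
  by (meson neighbours_subset finite_subset finite_atLeastAtMost)

text \<open>In a simple graph the edges at \<open>u\<close> correspond to their other endpoints.\<close>

lemma card_neighbours:
  assumes G: "G \<in> graphs_with_degrees n d" and u: "u \<in> {1..n}"
  shows "card (neighbours G u) = d u"
proof -
  have "bij_betw (\<lambda>x. {u, x}) (neighbours G u) {e \<in> G. u \<in> e}"
    unfolding bij_betw_def neighbours_def
  proof
    show "inj_on (\<lambda>x. {u, x}) {x. {u, x} \<in> G}"
      by (auto simp: inj_on_def doubleton_eq_iff)
    show "(\<lambda>x. {u, x}) ` {x. {u, x} \<in> G} = {e \<in> G. u \<in> e}"
    proof
      show "{e \<in> G. u \<in> e} \<subseteq> (\<lambda>x. {u, x}) ` {x. {u, x} \<in> G}"
      proof
        fix e assume e: "e \<in> {e \<in> G. u \<in> e}"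
        then obtain a b where "e = {a, b}" using G graph_edge_cases by (metis mem_Collect_eq)
        with e show "e \<in> (\<lambda>x. {u, x}) ` {x. {u, x} \<in> G}" by (auto simp: insert_commute)
      qed
    qed auto
  qed
  then have "card (neighbours G u) = degree G u"
    unfolding degree_def by (rule bij_betw_same_card)
  then show ?thesis using G u by (simp add: graphs_with_degrees_def)
qed

lemma card_arcs_from:
  assumes G: "G \<in> graphs_with_degrees n d" and W: "W \<subseteq> {1..n}"
  shows "card {(x, y). x \<in> W \<and> {x, y} \<in> G} = (\<Sum>x\<in>W. d x)"
    and "finite {(x, y). x \<in> W \<and> {x, y} \<in> G}"
proof -
  have eq: "{(x, y). x \<in> W \<and> {x, y} \<in> G} = Sigma W (neighbours G)"
    by (auto simp: neighbours_def)
  have fW: "finite W" using W finite_subset by blast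
  show "finite {(x, y). x \<in> W \<and> {x, y} \<in> G}"
    unfolding eq using fW finite_neighbours[OF G] by blast
  show "card {(x, y). x \<in> W \<and> {x, y} \<in> G} = (\<Sum>x\<in>W. d x)"
    unfolding eq using fW finite_neighbours[OF G] W
    by (subst card_SigmaI) (auto intro!: sum.cong card_neighbours[OF G])
qed

lemma card_arcs_le:
  fixes J :: "'a set set"
  assumes "finite J"
  shows "card {(x, y). {x, y} \<in> J} \<le> 2 * card J" "finite {(x, y). {x, y} \<in> J}"
proof -
  have *: "finite {(x, y). {x, y} = e} \<and> card {(x, y). {x, y} = e} \<le> 2" for e :: "'a set"
  proof (cases "\<exists>a b. e = {a, b}")
    case True
    then obtain a b where "e = {a, b}" by auto
    then have sub: "{(x, y). {x, y} = e} \<subseteq> {(a, b), (b, a)}" by (auto simp: doubleton_eq_iff)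
    have "card {(a, b), (b, a)} \<le> 2" by (cases "a = b") simp_all
    moreover have "card {(x, y). {x, y} = e} \<le> card {(a, b), (b, a)}" by (rule card_mono[OF _ sub]) simp
    ultimately show ?thesis using finite_subset[OF sub] by simp
  next
    case False
    then have "{(x, y). {x, y} = e} = {}" by auto
    then show ?thesis by simp
  qed
  have eq: "{(x, y). {x, y} \<in> J} = (\<Union>e\<in>J. {(x, y). {x, y} = e})" by auto
  show "finite {(x, y). {x, y} \<in> J}" unfolding eq using assms * by blast
  have "card {(x, y). {x, y} \<in> J} \<le> (\<Sum>e\<in>J. card {(x, y). {x, y} = e})"
    unfolding eq using assms by (rule card_UN_le)
  also have "\<dots> \<le> (\<Sum>e\<in>J. 2)" using * by (intro sum_mono) auto
  finally show "card {(x, y). {x, y} \<in> J} \<le> 2 * card J" by simp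
qed

text \<open>Both the removed and the added pair of edges cover each of the four distinct vertices exactly once.\<close>

lemma switch_mem:
  assumes G: "G \<in> graphs_with_degrees n d"
    and ne: "a \<noteq> b" "a \<noteq> c" "a \<noteq> e" "b \<noteq> c" "b \<noteq> e" "c \<noteq> e"
    and in_G: "{a, b} \<in> G" "{c, e} \<in> G" and notin: "{a, c} \<notin> G" "{b, e} \<notin> G"
  shows "switch a b c e G \<in> graphs_with_degrees n d"
proof -
  let ?G = "switch a b c e G"
  have fin: "finite G" by (rule finite_graph[OF G])
  note V = edge_of_graph[OF G in_G(1)] edge_of_graph[OF G in_G(2)]
  have "?G \<in> simple_graphs n"
    using G V ne unfolding switch_def graphs_with_degrees_def simple_graphs_def by auto
  moreover have "degree ?G w = degree G w" for w
  proof -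
    have deg: "degree E w = (\<Sum>f\<in>E. (if w \<in> f then 1 else 0))" if "finite E" for E :: "nat set set"
      using that by (simp add: degree_def sum.If_cases Int_def)
    \<comment> \<open>Two different edges are removed and two are added, so that both sums below have two terms.\<close>
    have ne1: "{a, b} \<noteq> {c, e}" "{a, c} \<noteq> {b, e}" using ne by (auto simp: doubleton_eq_iff)
    have G_eq: "G = (G - {{a, b}, {c, e}}) \<union> {{a, b}, {c, e}}" using in_G by auto
    have "degree G w = (\<Sum>f\<in>G - {{a, b}, {c, e}}. (if w \<in> f then 1 else 0)) + (\<Sum>f\<in>{{a, b}, {c, e}}. (if w \<in> f then 1 else 0))"
      unfolding deg[OF fin] using fin in_G by (metis (no_types, lifting) add.commute empty_subsetI insert_subset sum.subset_diff)
    moreover have "degree ?G w = (\<Sum>f\<in>G - {{a, b}, {c, e}}. (if w \<in> f then 1 else 0)) + (\<Sum>f\<in>{{a, c}, {b, e}}. (if w \<in> f then 1 else 0))"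
      unfolding switch_def using fin notin by (subst deg) (simp, intro sum.union_disjoint, auto)
    moreover have "(\<Sum>f\<in>{{a, b}, {c, e}}. (if w \<in> f then 1 else 0)) = (\<Sum>f\<in>{{a, c}, {b, e}}. (if w \<in> f then 1 else 0) :: nat)"
      using ne ne1 by simp
    ultimately show ?thesis by simp
  qed
  ultimately show ?thesis using G by (auto simp: graphs_with_degrees_def)
qed

lemma switch_switch:
  assumes "{a, b} \<in> G" "{c, e} \<in> G" "{a, c} \<notin> G" "{b, e} \<notin> G"
  shows "switch a c b e (switch a b c e G) = G"
  using assms unfolding switch_def by auto

lemma sum_le_top_degree_sum:
  assumes "W \<subseteq> {1..n}" "card W \<le> max_degree n d + 1"
  shows "(\<Sum>i\<in>W. d i) \<le> top_degree_sum n d"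
  unfolding top_degree_sum_def
  by (rule Max_ge) (use assms in \<open>auto intro!: finite_imageI finite_subset[of _ "Pow {1..n}"]\<close>)

lemma degree_le_max_degree: "i \<in> {1..n} \<Longrightarrow> d i \<le> max_degree n d"
  unfolding max_degree_def by (rule Max_ge) auto

lemma sum_closed_neighbourhood_le:
  assumes G: "G \<in> graphs_with_degrees n d" and u: "u \<in> {1..n}"
  shows "(\<Sum>x\<in>insert u (neighbours G u). d x) \<le> top_degree_sum n d"
proof (rule sum_le_top_degree_sum)
  show "insert u (neighbours G u) \<subseteq> {1..n}" using u neighbours_subset[OF G] by auto
  have "card (insert u (neighbours G u)) \<le> card (neighbours G u) + 1"
    by (simp add: card_insert_if finite_neighbours[OF G])
  also have "\<dots> \<le> max_degree n d + 1" using card_neighbours[OF G u] degree_le_max_degree[OF u, of d] by simp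
  finally show "card (insert u (neighbours G u)) \<le> max_degree n d + 1" .
qed

text \<open>Double counting of the switchings from graphs that contain \<open>uv\<close> to graphs that do not. A switching is determined by
its result together with \<open>(x, y)\<close>, because it can be undone, and \<open>x\<close> and \<open>y\<close> are then neighbours of \<open>u\<close> and
\<open>v\<close>.\<close>

lemma switching_upper:
  assumes u: "u \<in> {1..n}" and v: "v \<in> {1..n}" and uv: "u \<noteq> v" "{u, v} \<notin> J" and J: "finite J"
  shows "real (card (extensions n d (insert {u, v} J))) *
           (real (total_degree n d) - 2 * real (card J) - 2 * real (top_degree_sum n d))
         \<le> real (card {G \<in> extensions n d J. {u, v} \<notin> G}) * (real (d u) * real (d v))"
proof -
  let ?S1 = "extensions n d (insert {u, v} J)" and ?S0 = "{G \<in> extensions n d J. {u, v} \<notin> G}"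
  define valid where "valid G = {(x, y). {x, y} \<in> G \<and> {x, y} \<notin> J \<and>
     x \<notin> insert u (neighbours G u) \<and> y \<notin> insert v (neighbours G v)}" for G
  define sources where "sources G = neighbours G u \<times> neighbours G v" for G
  have valid_ge: "real (total_degree n d) - 2 * real (card J) - 2 * real (top_degree_sum n d) \<le> real (card (valid G))"
    and fin_valid: "finite (valid G)" if "G \<in> ?S1" for G
  proof -
    have G: "G \<in> graphs_with_degrees n d" using that by (simp add: extensions_def)
    let ?all = "{(x, y). x \<in> {1..n} \<and> {x, y} \<in> G}"
    let ?A = "{(x, y). {x, y} \<in> J}"
    let ?B = "{(x, y). x \<in> insert u (neighbours G u) \<and> {x, y} \<in> G}"
    let ?C = "{(x, y). x \<in> insert v (neighbours G v) \<and> {x, y} \<in> G}"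
    have Nu: "insert u (neighbours G u) \<subseteq> {1..n}" and Nv: "insert v (neighbours G v) \<subseteq> {1..n}"
      using u v neighbours_subset[OF G] by auto
    note finB = card_arcs_from(2)[OF G Nu] and finC = card_arcs_from(2)[OF G Nv]
    have finA: "finite ?A" by (rule card_arcs_le(2)[OF J])
    have finall: "finite ?all" using card_arcs_from(2)[OF G, of "{1..n}"] by simp
    show fin: "finite (valid G)"
      by (rule finite_subset[OF _ finall]) (use edge_of_graph[OF G] in \<open>auto simp: valid_def\<close>)
    have finC': "finite (prod.swap ` ?C)" using finC by blast
    \<comment> \<open>An ordered edge is excluded if it is prescribed, if \<open>x\<close> is \<open>u\<close> or one of its neighbours, or if \<open>y\<close> is \<open>v\<close> or one of its neighbours.\<close>
    have sub: "?all \<subseteq> valid G \<union> ?A \<union> ?B \<union> prod.swap ` ?C"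
      by (force simp: valid_def image_iff insert_commute)
    have "total_degree n d = card ?all"
      using card_arcs_from(1)[OF G, of "{1..n}"] by (simp add: total_degree_def)
    also have "\<dots> \<le> card (valid G \<union> ?A \<union> ?B \<union> prod.swap ` ?C)"
      using fin finA finB finC' by (intro card_mono sub) blast
    also have "\<dots> \<le> card (valid G) + card ?A + card ?B + card (prod.swap ` ?C)"
      using card_Un_le[of "valid G \<union> ?A \<union> ?B" "prod.swap ` ?C"] card_Un_le[of "valid G \<union> ?A" ?B]
        card_Un_le[of "valid G" ?A] by linarith
    also have "card (prod.swap ` ?C) \<le> card ?C" by (rule card_image_le[OF finC])
    also have "card ?C \<le> top_degree_sum n d"
      using card_arcs_from(1)[OF G Nv] sum_closed_neighbourhood_le[OF G v] by simp
    also have "card ?B \<le> top_degree_sum n d"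
      using card_arcs_from(1)[OF G Nu] sum_closed_neighbourhood_le[OF G u] by simp
    also have "card ?A \<le> 2 * card J" by (rule card_arcs_le(1)[OF J])
    finally have "total_degree n d \<le> card (valid G) + 2 * card J + top_degree_sum n d + top_degree_sum n d"
      by simp
    then show "real (total_degree n d) - 2 * real (card J) - 2 * real (top_degree_sum n d) \<le> real (card (valid G))"
      by linarith
  qed
  have fin_sources: "finite (sources G)" and card_sources: "card (sources G) = d u * d v" if "G \<in> ?S0" for G
  proof -
    have G: "G \<in> graphs_with_degrees n d" using that by (simp add: extensions_def)
    show "finite (sources G)" "card (sources G) = d u * d v"
      using finite_neighbours[OF G] card_neighbours[OF G] u v by (auto simp: sources_def card_cartesian_product)
  qed
  define move where "move = (\<lambda>(G, x, y). (switch u v x y G, x, y))"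
  have valid_props: "G \<in> graphs_with_degrees n d" "{u, v} \<in> G" "{x, y} \<in> G" "{u, x} \<notin> G" "{v, y} \<notin> G"
      "u \<noteq> v" "u \<noteq> x" "u \<noteq> y" "v \<noteq> x" "v \<noteq> y" "x \<noteq> y" "{x, y} \<notin> J" "J \<subseteq> G"
    if "G \<in> ?S1" "(x, y) \<in> valid G" for G x y
  proof -
    show G: "G \<in> graphs_with_degrees n d" using that by (simp add: extensions_def)
    show "{u, v} \<in> G" "{x, y} \<in> G" "{u, x} \<notin> G" "{v, y} \<notin> G" "u \<noteq> v" "u \<noteq> x" "u \<noteq> y" "v \<noteq> x" "v \<noteq> y"
      "{x, y} \<notin> J" "J \<subseteq> G"
      using that uv by (auto simp: valid_def extensions_def neighbours_def insert_commute)
    then show "x \<noteq> y" using edge_of_graph[OF G] by blast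
  qed
  have inj: "inj_on move (Sigma ?S1 valid)"
  proof (rule inj_onI)
    fix p p' assume "p \<in> Sigma ?S1 valid" "p' \<in> Sigma ?S1 valid" and eq': "move p = move p'"
    then obtain G x y G' x' y' where pp: "p = (G, x, y)" "p' = (G', x', y')"
      and *: "G \<in> ?S1" "(x, y) \<in> valid G" "G' \<in> ?S1" "(x', y') \<in> valid G'"
      by (metis (no_types, lifting) SigmaE surj_pair)
    have eq: "move (G, x, y) = move (G', x', y')" using eq' pp by simp
    from eq have xy: "x' = x" "y' = y" and sw: "switch u v x y G = switch u v x y G'"
      by (auto simp: move_def)
    have "G = switch u x v y (switch u v x y G)"
      using valid_props[OF *(1,2)] by (intro switch_switch[symmetric])
    also have "\<dots> = switch u x v y (switch u v x y G')" by (simp add: sw)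
    also have "\<dots> = G'" using valid_props[OF *(3,4)[unfolded xy]] by (intro switch_switch)
    finally show "p = p'" using xy pp by simp
  qed
  have image: "move ` Sigma ?S1 valid \<subseteq> Sigma ?S0 sources"
  proof (rule image_subsetI)
    fix p assume "p \<in> Sigma ?S1 valid"
    then obtain G x y where pp: "p = (G, x, y)" and *: "G \<in> ?S1" "(x, y) \<in> valid G"
      by (metis (no_types, lifting) SigmaE surj_pair)
    note p = valid_props[OF *]
    have "switch u v x y G \<in> graphs_with_degrees n d"
      using p by (intro switch_mem) auto
    moreover have "J \<subseteq> switch u v x y G" using p uv by (auto simp: switch_def)
    moreover have "{u, v} \<notin> switch u v x y G" using p by (auto simp: switch_def doubleton_eq_iff)
    moreover have "{u, x} \<in> switch u v x y G" "{v, y} \<in> switch u v x y G" by (auto simp: switch_def)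
    ultimately show "move p \<in> Sigma ?S0 sources"
      by (auto simp: pp move_def sources_def neighbours_def extensions_def)
  qed
  have "real (card ?S1) * (real (total_degree n d) - 2 * real (card J) - 2 * real (top_degree_sum n d))
      \<le> (\<Sum>G\<in>?S1. real (card (valid G)))"
    using valid_ge by (intro sum_bounded_below) auto
  also have "\<dots> = real (card (Sigma ?S1 valid))"
    using fin_valid by (subst card_SigmaI) auto
  also have "\<dots> \<le> real (card (Sigma ?S0 sources))"
    using fin_sources by (intro of_nat_mono card_inj_on_le[OF inj image] finite_SigmaI) auto
  also have "\<dots> = real (card ?S0) * (real (d u) * real (d v))"
    using fin_sources card_sources by (subst card_SigmaI) auto
  finally show ?thesis .
qed

lemma card_extensions_insert:
  "card (extensions n d J) = card (extensions n d (insert e J)) + card {G \<in> extensions n d J. e \<notin> G}"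
proof -
  have "extensions n d J = extensions n d (insert e J) \<union> {G \<in> extensions n d J. e \<notin> G}"
    by (auto simp: extensions_def)
  then show ?thesis
    by (metis (no_types, lifting) card_Un_disjoint disjoint_iff extensions_def finite_Un finite_extensions insert_subset mem_Collect_eq)
qed

lemma prob_of_odds_nonneg: "0 \<le> t \<Longrightarrow> 0 \<le> prob_of_odds t"
  and prob_of_odds_le_1: "0 \<le> t \<Longrightarrow> prob_of_odds t \<le> 1"
  and prob_of_odds_le: "0 \<le> t \<Longrightarrow> prob_of_odds t \<le> t"
  by (auto simp: prob_of_odds_def field_simps)

text \<open>With \<open>s1\<close> graphs that contain \<open>uv\<close> and \<open>s0\<close> that do not, the switching inequality bounds the odds \<open>s1 / s0\<close>, and
\<open>prob_of_odds\<close> turns this into a bound for the proportion \<open>s1 / (s0 + s1)\<close>.\<close>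

lemma edge_prob_upper:
  assumes u: "u \<in> {1..n}" and v: "v \<in> {1..n}" and uv: "u \<noteq> v" "{u, v} \<notin> J"
    and J: "finite J" "card J \<le> 6" and pos: "0 < switch_volume n d"
  shows "real (card (extensions n d (insert {u, v} J)))
         \<le> prob_of_odds (real (d u) * real (d v) / switch_volume n d) * real (card (extensions n d J))"
proof -
  let ?B = "switch_volume n d" and ?a = "real (d u) * real (d v)"
  let ?s1 = "real (card (extensions n d (insert {u, v} J)))"
  let ?s0 = "real (card {G \<in> extensions n d J. {u, v} \<notin> G})"
  have "?s1 * ?B \<le> ?s1 * (real (total_degree n d) - 2 * real (card J) - 2 * real (top_degree_sum n d))"
    using J by (intro mult_left_mono) (auto simp: switch_volume_def)
  also have "\<dots> \<le> ?s0 * ?a" by (rule switching_upper) (use assms in auto)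
  finally have "?s1 * (?B + ?a) \<le> (?s0 + ?s1) * ?a" by (simp add: algebra_simps)
  then have "?s1 \<le> (?s0 + ?s1) * ?a / (?B + ?a)" using pos
    by (simp add: field_simps add_pos_nonneg)
  also have "\<dots> = prob_of_odds (?a / ?B) * (?s0 + ?s1)" using pos
    by (simp add: prob_of_odds_def divide_simps add_pos_nonneg)
  finally show ?thesis by (simp add: card_extensions_insert[of n d J "{u, v}"] add.commute)
qed

section \<open>Lower bounds for edge probabilities\<close>

lemma card_ordered_edges:
  assumes "G \<in> graphs_with_degrees n d"
  shows "card {(x, y). {x, y} \<in> G} = total_degree n d" "finite {(x, y). {x, y} \<in> G}"
proof -
  have "{(x, y). {x, y} \<in> G} = {(x, y). x \<in> {1..n} \<and> {x, y} \<in> G}"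
    using edge_of_graph(2)[OF assms] by blast
  with card_arcs_from[OF assms, of "{1..n}"]
  show "card {(x, y). {x, y} \<in> G} = total_degree n d" "finite {(x, y). {x, y} \<in> G}"
    by (auto simp: total_degree_def)
qed

text \<open>The pairs \<open>(x, y)\<close> for which \<open>ux, vy\<close> may be switched into \<open>uv, xy\<close> without destroying an edge of \<open>J\<close> or
doubling an edge.\<close>

definition switchable :: "nat \<Rightarrow> nat \<Rightarrow> nat set set \<Rightarrow> nat set set \<Rightarrow> (nat \<times> nat) set" where
  "switchable u v J G = {(x, y). x \<in> neighbours G u \<and> y \<in> neighbours G v \<and> x \<noteq> y \<and>
     {x, y} \<notin> G \<and> {u, x} \<notin> J \<and> {v, y} \<notin> J}"

text \<open>The same double counting for the reverse switching, which creates \<open>uv\<close>. Here a result is reached from at most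
one graph for each of its ordered edges \<open>(x, y)\<close>.\<close>

lemma switching_lower:
  assumes u: "u \<in> {1..n}" and v: "v \<in> {1..n}" and uv: "u \<noteq> v" "{u, v} \<notin> J"
  shows "(\<Sum>G\<in>{G \<in> extensions n d J. {u, v} \<notin> G}. card (switchable u v J G))
         \<le> card (extensions n d (insert {u, v} J)) * total_degree n d"
proof -
  let ?S1 = "extensions n d (insert {u, v} J)" and ?S0 = "{G \<in> extensions n d J. {u, v} \<notin> G}"
  let ?valid = "switchable u v J" and ?arcs = "\<lambda>G. {(x :: nat, y). {x, y} \<in> G}"
  have fin_valid: "finite (?valid G)" if "G \<in> ?S0" for G
  proof -
    have "?valid G \<subseteq> neighbours G u \<times> neighbours G v" by (auto simp: switchable_def)
    moreover have "finite (neighbours G w)" for w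
      using that by (intro finite_neighbours) (auto simp: extensions_def)
    ultimately show ?thesis by (meson finite_SigmaI finite_subset)
  qed
  define move where "move = (\<lambda>(G, x, y). (switch u x v y G, x, y))"
  have props: "G \<in> graphs_with_degrees n d" "{u, x} \<in> G" "{v, y} \<in> G" "{u, v} \<notin> G" "{x, y} \<notin> G"
      "u \<noteq> v" "u \<noteq> x" "u \<noteq> y" "x \<noteq> v" "x \<noteq> y" "v \<noteq> y" "{u, x} \<notin> J" "{v, y} \<notin> J" "J \<subseteq> G"
    if "G \<in> ?S0" "(x, y) \<in> ?valid G" for G x y
  proof -
    show G: "G \<in> graphs_with_degrees n d" using that by (simp add: extensions_def)
    show *: "{u, x} \<in> G" "{v, y} \<in> G" "{u, v} \<notin> G" "{x, y} \<notin> G" "u \<noteq> v" "x \<noteq> y" "{u, x} \<notin> J" "{v, y} \<notin> J" "J \<subseteq> G"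
      using that uv by (auto simp: switchable_def extensions_def neighbours_def)
    show "u \<noteq> x" "v \<noteq> y" using edge_of_graph(1)[OF G] * by blast+
    show "u \<noteq> y" using *(2,3,4) by (auto simp: insert_commute)
    show "x \<noteq> v" using *(2,3,4) by auto
  qed
  have inj: "inj_on move (Sigma ?S0 ?valid)"
  proof (rule inj_onI)
    fix p p' assume "p \<in> Sigma ?S0 ?valid" "p' \<in> Sigma ?S0 ?valid" and eq': "move p = move p'"
    then obtain G x y G' x' y' where pp: "p = (G, x, y)" "p' = (G', x', y')"
      and *: "G \<in> ?S0" "(x, y) \<in> ?valid G" "G' \<in> ?S0" "(x', y') \<in> ?valid G'"
      by (metis (no_types, lifting) SigmaE surj_pair)
    have eq: "move (G, x, y) = move (G', x', y')" using eq' pp by simp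
    from eq have xy: "x' = x" "y' = y" and sw: "switch u x v y G = switch u x v y G'"
      by (auto simp: move_def)
    have "G = switch u v x y (switch u x v y G)"
      using props[of G x y] * by (intro switch_switch[symmetric]) auto
    also have "\<dots> = switch u v x y (switch u x v y G')" by (simp add: sw)
    also have "\<dots> = G'" using props[of G' x y] * xy by (intro switch_switch) auto
    finally show "p = p'" using xy pp by simp
  qed
  have image: "move ` Sigma ?S0 ?valid \<subseteq> Sigma ?S1 ?arcs"
  proof (rule image_subsetI)
    fix p assume "p \<in> Sigma ?S0 ?valid"
    then obtain G x y where pp: "p = (G, x, y)" and *: "G \<in> ?S0" "(x, y) \<in> ?valid G"
      by (metis (no_types, lifting) SigmaE surj_pair)
    note p = props[OF *]
    have "switch u x v y G \<in> graphs_with_degrees n d"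
      using p by (intro switch_mem) auto
    moreover have "J \<subseteq> switch u x v y G" using p uv by (auto simp: switch_def)
    moreover have "{u, v} \<in> switch u x v y G" "{x, y} \<in> switch u x v y G" by (auto simp: switch_def)
    ultimately show "move p \<in> Sigma ?S1 ?arcs"
      by (auto simp: pp move_def extensions_def)
  qed
  have arcs: "finite (?arcs G)" "card (?arcs G) = total_degree n d" if "G \<in> ?S1" for G
    using card_ordered_edges[of G n d] that by (auto simp: extensions_def)
  have "(\<Sum>G\<in>?S0. card (?valid G)) = card (Sigma ?S0 ?valid)"
    using fin_valid by (subst card_SigmaI) auto
  also have "\<dots> \<le> card (Sigma ?S1 ?arcs)"
    using arcs by (intro card_inj_on_le[OF inj image] finite_SigmaI) auto
  also have "\<dots> = card ?S1 * total_degree n d"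
    using arcs by (subst card_SigmaI) auto
  finally show ?thesis .
qed

text \<open>The middle edges of the paths \<open>u, x, y, v\<close> none of whose edges is prescribed; these are the essential obstruction to the reverse
switching.\<close>

definition connectors :: "nat \<Rightarrow> nat \<Rightarrow> nat set set \<Rightarrow> nat set set \<Rightarrow> (nat \<times> nat) set" where
  "connectors u v J G = {(x, y). x \<in> neighbours G u \<and> y \<in> neighbours G v \<and>
     {x, y} \<in> G \<and> {u, x} \<notin> J \<and> {v, y} \<notin> J \<and> {x, y} \<notin> J}"

text \<open>A pair of neighbours of \<open>u\<close> and \<open>v\<close> fails to be switchable if it is a connector, if \<open>x = y\<close>, or if one of
\<open>ux\<close>, \<open>vy\<close>, \<open>xy\<close> is prescribed.\<close>

lemma card_switchable_ge:
  assumes G: "G \<in> graphs_with_degrees n d" and u: "u \<in> {1..n}" and v: "v \<in> {1..n}" and J: "finite J"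
  shows "d u * d v \<le> card (switchable u v J G) + card (connectors u v J G) +
           (d u + card J * (d u + d v) + 2 * card J)"
proof -
  let ?Nu = "neighbours G u" and ?Nv = "neighbours G v"
  let ?E = "(\<lambda>x. (x, x)) ` ?Nu" and ?F = "{x. {u, x} \<in> J} \<times> ?Nv" and ?H = "?Nu \<times> {y. {v, y} \<in> J}"
    and ?I = "{(x, y). {x, y} \<in> J}"
  have fin: "finite ?Nu" "finite ?Nv" and card: "card ?Nu = d u" "card ?Nv = d v"
    using finite_neighbours[OF G] card_neighbours[OF G] u v by auto
  have NJ: "finite {x. {w, x} \<in> J}" "card {x. {w, x} \<in> J} \<le> card J" for w
  proof -
    have inj: "inj_on (\<lambda>x. {w, x}) {x. {w, x} \<in> J}" by (auto simp: inj_on_def doubleton_eq_iff)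
    have im: "(\<lambda>x. {w, x}) ` {x. {w, x} \<in> J} \<subseteq> J" by auto
    show "finite {x. {w, x} \<in> J}" by (rule inj_on_finite[OF inj im J])
    show "card {x. {w, x} \<in> J} \<le> card J" by (rule card_inj_on_le[OF inj im J])
  qed
  have finS: "finite (switchable u v J G)" and finC: "finite (connectors u v J G)"
    by (rule finite_subset[of _ "?Nu \<times> ?Nv"], force simp: switchable_def connectors_def, simp add: fin)+
  note finI = card_arcs_le(2)[OF J]
  have "d u * d v = card (?Nu \<times> ?Nv)" using card by (simp add: card_cartesian_product)
  also have "\<dots> \<le> card (switchable u v J G \<union> (connectors u v J G \<union> (?E \<union> (?F \<union> (?H \<union> ?I)))))"
  proof (rule card_mono)
    show "finite (switchable u v J G \<union> (connectors u v J G \<union> (?E \<union> (?F \<union> (?H \<union> ?I)))))"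
      using fin NJ finS finC finI by simp
    show "?Nu \<times> ?Nv \<subseteq> switchable u v J G \<union> (connectors u v J G \<union> (?E \<union> (?F \<union> (?H \<union> ?I))))"
      by (auto simp: switchable_def connectors_def)
  qed
  also have "\<dots> \<le> card (switchable u v J G) + (card (connectors u v J G) + (card ?E + (card ?F + (card ?H + card ?I))))"
    by (intro order_trans[OF card_Un_le] add_left_mono order_refl)
  also have "card ?E \<le> d u" using card_image_le[OF fin(1), of "\<lambda>x. (x, x)"] card by simp
  also have "card ?F \<le> card J * d v" using NJ(2)[of u] card by (simp add: card_cartesian_product)
  also have "card ?H \<le> d u * card J" using NJ(2)[of v] card by (simp add: card_cartesian_product)
  also have "card ?I \<le> 2 * card J" by (rule card_arcs_le(1)[OF J])
  finally show ?thesis by (simp add: algebra_simps)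
qed

text \<open>Up to the factor \<open>d u * d v\<close>, this bounds the expected number of connectors of \<open>u\<close> and \<open>v\<close>. It is essentially
the probability that two vertices chosen with probability proportional to their degrees are adjacent, which explains why it is small.\<close>

definition connection_rate :: "nat \<Rightarrow> (nat \<Rightarrow> nat) \<Rightarrow> real" where
  "connection_rate n d = (\<Sum>x\<in>{1..n}. \<Sum>y\<in>{1..n}. real (d x) * real (d y) *
     prob_of_odds (real (d x) * real (d y) / switch_volume n d)) / (switch_volume n d)\<^sup>2"

text \<open>The general first moment computation: the total number of configurations \<open>p \<in> P\<close> present in the graphs is the sum over \<open>p\<close> of the number of
graphs that contain the edges \<open>E p\<close>.\<close>

lemma sum_card_le_sum_extensions:
  assumes fin: "finite P" and sub: "\<And>G. G \<in> extensions n d J \<Longrightarrow> Q G \<Longrightarrow> R G = {p \<in> P. E p \<subseteq> G}"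
  shows "(\<Sum>G\<in>{G \<in> extensions n d J. Q G}. card (R G)) \<le> (\<Sum>p\<in>P. card (extensions n d (E p \<union> J)))"
proof -
  have "(\<Sum>G\<in>{G \<in> extensions n d J. Q G}. card (R G)) =
        (\<Sum>G\<in>{G \<in> extensions n d J. Q G}. card {p \<in> P. E p \<subseteq> G})"
    using sub by (intro sum.cong) auto
  also have "\<dots> \<le> (\<Sum>G\<in>extensions n d J. card {p \<in> P. E p \<subseteq> G})"
    by (intro sum_mono2) auto
  also have "\<dots> = (\<Sum>G\<in>extensions n d J. \<Sum>p\<in>P. if E p \<subseteq> G then 1 else 0)"
    using fin by (simp add: sum.If_cases Int_def)
  also have "\<dots> = (\<Sum>p\<in>P. \<Sum>G\<in>extensions n d J. if E p \<subseteq> G then 1 else 0)"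
    by (rule sum.swap)
  also have "\<dots> = (\<Sum>p\<in>P. card (extensions n d (E p \<union> J)))"
  proof (rule sum.cong)
    fix p
    have "extensions n d (E p \<union> J) = {G \<in> extensions n d J. E p \<subseteq> G}" by (auto simp: extensions_def)
    then show "(\<Sum>G\<in>extensions n d J. if E p \<subseteq> G then 1 else 0) = card (extensions n d (E p \<union> J))"
      by (simp add: sum.If_cases Int_def)
  qed simp
  finally show ?thesis .
qed

text \<open>The upper bound for edge probabilities, used three times, bounds the number of graphs that contain a given path \<open>u, x, y, v\<close>.
For the outer edges the odds suffice as a bound; for the middle edge the probability itself is kept, since the
odds may exceed one.\<close>

lemma sum_connectors_le:
  assumes u: "u \<in> {1..n}" and v: "v \<in> {1..n}" and uv: "u \<noteq> v"
    and J: "finite J" "card J \<le> 2" and pos: "0 < switch_volume n d"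
  shows "(\<Sum>G\<in>{G \<in> extensions n d J. {u, v} \<notin> G}. real (card (connectors u v J G)))
         \<le> connection_rate n d * (real (d u) * real (d v)) * real (card (extensions n d J))"
proof -
  let ?B = "switch_volume n d" and ?t = "real (card (extensions n d J))"
  let ?g = "\<lambda>x y. prob_of_odds (real (d x) * real (d y) / ?B)"
  let ?E = "\<lambda>(x, y). {{u, x}, {v, y}, {x, y}}"
  let ?P = "{(x, y). x \<in> {1..n} \<and> y \<in> {1..n} \<and> x \<notin> {u, v} \<and> y \<notin> {u, v} \<and> x \<noteq> y \<and>
     {u, x} \<notin> J \<and> {v, y} \<notin> J \<and> {x, y} \<notin> J}"
  have g0: "0 \<le> ?g x y" for x y using pos by (intro prob_of_odds_nonneg) simp
  have gle: "?g x y \<le> real (d x) * real (d y) / ?B" for x y using pos by (intro prob_of_odds_le) simp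
  have finP: "finite ?P" by (rule finite_subset[of _ "{1..n} \<times> {1..n}"]) auto
  have conn: "connectors u v J G = {p \<in> ?P. ?E p \<subseteq> G}" if "G \<in> extensions n d J" "{u, v} \<notin> G" for G
  proof -
    have G: "G \<in> graphs_with_degrees n d" using that by (simp add: extensions_def)
    show ?thesis
      using edge_of_graph[OF G] that(2) by (auto simp: connectors_def neighbours_def insert_commute)
  qed
  \<comment> \<open>The vertices \<open>u, x, y, v\<close> are distinct, so the edges of the path are three different ones outside \<open>J\<close>.\<close>
  have path: "real (card (extensions n d (?E p \<union> J))) \<le>
      (\<lambda>(x, y). (real (d u) * real (d x) / ?B) * (real (d v) * real (d y) / ?B) * ?g x y * ?t) p"
    if p: "p \<in> ?P" for p
  proof -
    obtain x y where xy: "p = (x, y)" by force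
    with p have q: "x \<in> {1..n}" "y \<in> {1..n}" "x \<noteq> u" "x \<noteq> v" "y \<noteq> u" "y \<noteq> v" "x \<noteq> y"
      "{u, x} \<notin> J" "{v, y} \<notin> J" "{x, y} \<notin> J" by auto
    have c1: "card (insert {v, y} J) \<le> 6" and c2: "card (insert {u, x} (insert {v, y} J)) \<le> 6"
      using J by (auto simp: card_insert_if)
    have "real (card (extensions n d (insert {x, y} (insert {u, x} (insert {v, y} J))))) \<le>
        ?g x y * real (card (extensions n d (insert {u, x} (insert {v, y} J))))"
      by (rule edge_prob_upper) (use q J c2 pos in \<open>auto simp: doubleton_eq_iff\<close>)
    also have "real (card (extensions n d (insert {u, x} (insert {v, y} J)))) \<le>
        ?g u x * real (card (extensions n d (insert {v, y} J)))"
      by (rule edge_prob_upper) (use q J c1 pos u uv in \<open>auto simp: doubleton_eq_iff\<close>)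
    also have "real (card (extensions n d (insert {v, y} J))) \<le> ?g v y * ?t"
      by (rule edge_prob_upper) (use q J pos v in \<open>auto simp: doubleton_eq_iff\<close>)
    finally have "real (card (extensions n d (insert {x, y} (insert {u, x} (insert {v, y} J)))))
        \<le> ?g x y * (?g u x * (?g v y * ?t))"
      using g0 by (simp add: mult_left_mono)
    also have "\<dots> \<le> ?g x y * ((real (d u) * real (d x) / ?B) * ((real (d v) * real (d y) / ?B) * ?t))"
      using gle g0 pos by (intro mult_mono mult_left_mono mult_nonneg_nonneg) auto
    finally show ?thesis by (simp add: xy insert_commute mult_ac)
  qed
  have "(\<Sum>G\<in>{G \<in> extensions n d J. {u, v} \<notin> G}. real (card (connectors u v J G))) \<le>
      real (\<Sum>p\<in>?P. card (extensions n d (?E p \<union> J)))"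
    unfolding of_nat_sum[symmetric] of_nat_le_iff
    by (rule sum_card_le_sum_extensions[OF finP]) (use conn in auto)
  also have "\<dots> \<le> (\<Sum>p\<in>?P. (\<lambda>(x, y). (real (d u) * real (d x) / ?B) * (real (d v) * real (d y) / ?B) * ?g x y * ?t) p)"
    unfolding of_nat_sum by (rule sum_mono) (rule path)
  also have "\<dots> \<le> (\<Sum>p\<in>{1..n} \<times> {1..n}. (\<lambda>(x, y). (real (d u) * real (d x) / ?B) * (real (d v) * real (d y) / ?B) * ?g x y * ?t) p)"
    using pos g0 by (intro sum_mono2) auto
  also have "\<dots> = connection_rate n d * (real (d u) * real (d v)) * ?t"
    unfolding connection_rate_def sum.cartesian_product[symmetric]
    by (simp add: sum_distrib_left sum_distrib_right sum_divide_distrib power2_eq_square divide_simps mult_ac)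
  finally show ?thesis .
qed

text \<open>Let \<open>p\<close> be the proportion of graphs that contain \<open>uv\<close>, let \<open>x\<close> be the odds \<open>d u * d v / L\<close>, and let \<open>\<eta>\<close> be the
error \<open>connection_rate n d + 9 / \<omega>\<close>. Since the obstructions take away at most a fraction \<open>\<eta>\<close> of the \<open>d u * d v\<close> pairs on average over all
graphs, the reverse switching gives \<open>p \<ge> x * (1 - p - \<eta>)\<close>, which is \<open>p \<ge> (1 - \<eta>) * x / (1 + x)\<close>. Averaging over all
graphs, rather than over those without \<open>uv\<close>, is what makes the bound hold uniformly in \<open>x\<close>.\<close>

lemma edge_prob_lower:
  assumes u: "u \<in> {1..n}" and v: "v \<in> {1..n}" and uv: "u \<noteq> v" "{u, v} \<notin> J"
    and J: "finite J" "card J \<le> 2" and pos: "0 < switch_volume n d"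
    and \<omega>: "1 \<le> \<omega>" "\<omega> \<le> real (d u)" "\<omega> \<le> real (d v)"
  shows "(1 - (connection_rate n d + 9 / \<omega>)) * prob_of_odds (real (d u) * real (d v) / real (total_degree n d)) *
           real (card (extensions n d J)) \<le> real (card (extensions n d (insert {u, v} J)))"
proof -
  let ?S0 = "{G \<in> extensions n d J. {u, v} \<notin> G}" and ?a = "real (d u) * real (d v)"
  let ?t = "real (card (extensions n d J))" and ?s1 = "real (card (extensions n d (insert {u, v} J)))"
  let ?L = "real (total_degree n d)" and ?\<kappa> = "connection_rate n d"
  have L: "0 < ?L" using pos by (simp add: switch_volume_def)
  have t: "?t = ?s1 + real (card ?S0)" by (simp add: card_extensions_insert[of n d J "{u, v}"])
  \<comment> \<open>As \<open>card J \<le> 2\<close>, the left-hand side is at most \<open>3 * d u + 2 * d v + 4\<close>, and each of \<open>d u\<close>, \<open>d v\<close>, \<open>1\<close> is at most \<open>d u * d v / \<omega>\<close>.\<close>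
  have junk: "real (d u + card J * (d u + d v) + 2 * card J) \<le> 9 / \<omega> * ?a"
  proof -
    have "real (d u + card J * (d u + d v) + 2 * card J) \<le> real (d u + 2 * (d u + d v) + 2 * 2)"
      using J(2) by (intro of_nat_mono add_mono mult_mono) auto
    then have "real (d u + card J * (d u + d v) + 2 * card J) * \<omega> \<le> real (d u + 2 * (d u + d v) + 2 * 2) * \<omega>"
      using \<omega>(1) by (intro mult_right_mono) auto
    also have "\<dots> = 3 * (real (d u) * \<omega>) + 2 * (\<omega> * real (d v)) + 4 * (\<omega> * 1)" by (simp add: algebra_simps)
    also have "\<dots> \<le> 3 * ?a + 2 * ?a + 4 * ?a"
      using \<omega> by (intro add_mono mult_left_mono mult_mono) auto
    finally have "real (d u + card J * (d u + d v) + 2 * card J) * \<omega> \<le> 9 * ?a" by simp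
    then show ?thesis using \<omega> by (simp add: field_simps)
  qed
  have each: "?a - 9 / \<omega> * ?a \<le> real (card (switchable u v J G)) + real (card (connectors u v J G))"
    if "G \<in> ?S0" for G
  proof -
    have G: "G \<in> graphs_with_degrees n d" using that by (simp add: extensions_def)
    have "real (d u * d v) \<le> real (card (switchable u v J G) + card (connectors u v J G) +
           (d u + card J * (d u + d v) + 2 * card J))"
      by (intro of_nat_mono card_switchable_ge[OF G u v J(1)])
    with junk show ?thesis by simp
  qed
  have "real (card ?S0) * (?a - 9 / \<omega> * ?a) \<le>
      (\<Sum>G\<in>?S0. real (card (switchable u v J G)) + real (card (connectors u v J G)))"
    using each by (intro sum_bounded_below) auto
  also have "\<dots> = real (\<Sum>G\<in>?S0. card (switchable u v J G)) + (\<Sum>G\<in>?S0. real (card (connectors u v J G)))"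
    by (simp add: sum.distrib)
  also have "\<dots> \<le> ?s1 * ?L + ?\<kappa> * ?a * ?t"
  proof (rule add_mono)
    show "real (\<Sum>G\<in>?S0. card (switchable u v J G)) \<le> ?s1 * ?L"
      unfolding of_nat_mult[symmetric] by (rule of_nat_mono) (rule switching_lower[OF u v uv])
    show "(\<Sum>G\<in>?S0. real (card (connectors u v J G))) \<le> ?\<kappa> * ?a * ?t"
      by (rule sum_connectors_le[OF u v uv(1) J pos])
  qed
  finally have main: "real (card ?S0) * (?a - 9 / \<omega> * ?a) \<le> ?s1 * ?L + ?\<kappa> * ?a * ?t" .
  have "0 \<le> 9 / \<omega> * ?a * ?s1" using \<omega> by simp
  with main have "(1 - (?\<kappa> + 9 / \<omega>)) * ?a * ?t \<le> ?s1 * (?L + ?a)"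
    unfolding t by (simp add: algebra_simps)
  then have "(1 - (?\<kappa> + 9 / \<omega>)) * ?a * ?t / (?L + ?a) \<le> ?s1" using L
    by (simp add: pos_divide_le_eq add_pos_nonneg)
  moreover have "(1 - (?\<kappa> + 9 / \<omega>)) * ?a * ?t / (?L + ?a) = (1 - (?\<kappa> + 9 / \<omega>)) * prob_of_odds (?a / ?L) * ?t"
    using L by (simp add: prob_of_odds_def divide_simps add_pos_nonneg)
  ultimately show ?thesis by simp
qed

section \<open>Moments of triangle counts\<close>

definition triangle_edges :: "nat \<times> nat \<times> nat \<Rightarrow> nat set set" where
  "triangle_edges = (\<lambda>(i, j, k). {{i, j}, {j, k}, {i, k}})"

definition triangle_weight :: "real \<Rightarrow> (nat \<Rightarrow> nat) \<Rightarrow> nat \<times> nat \<times> nat \<Rightarrow> real" where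
  "triangle_weight \<theta> d = (\<lambda>(i, j, k). prob_of_odds (real (d i) * real (d j) / \<theta>) *
     prob_of_odds (real (d j) * real (d k) / \<theta>) * prob_of_odds (real (d i) * real (d k) / \<theta>))"

definition triples :: "'a set \<Rightarrow> ('a \<times> 'a \<times> 'a) set" where
  "triples A = A \<times> A \<times> A"

definition injective_triple :: "nat \<times> nat \<times> nat \<Rightarrow> bool" where
  "injective_triple = (\<lambda>(i, j, k). i \<noteq> j \<and> j \<noteq> k \<and> i \<noteq> k)"

definition entries :: "nat \<times> nat \<times> nat \<Rightarrow> nat set" where
  "entries = (\<lambda>(i, j, k). {i, j, k})"

definition ordered_triangles :: "nat set \<Rightarrow> nat set set \<Rightarrow> (nat \<times> nat \<times> nat) set" where
  "ordered_triangles A G = {t \<in> triples A. triangle_edges t \<subseteq> G}"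

lemma finite_triples [simp]: "finite A \<Longrightarrow> finite (triples A)"
  by (simp add: triples_def)

lemma card_triples: "card (triples A) = card A ^ 3"
  by (simp add: triples_def card_cartesian_product power3_eq_cube)

lemma triangle_weight_bounds:
  assumes "0 \<le> \<theta>"
  shows "0 \<le> triangle_weight \<theta> d t" "triangle_weight \<theta> d t \<le> 1"
proof -
  obtain i j k where t: "t = (i, j, k)" by (cases t)
  let ?g = "\<lambda>x y. prob_of_odds (real (d x) * real (d y) / \<theta>)"
  have g: "0 \<le> ?g x y" "?g x y \<le> 1" for x y
    using assms by (auto intro!: prob_of_odds_nonneg prob_of_odds_le_1)
  show "0 \<le> triangle_weight \<theta> d t" using g by (simp add: t triangle_weight_def)
  show "triangle_weight \<theta> d t \<le> 1"
    unfolding t triangle_weight_def prod.case by (intro mult_le_one mult_nonneg_nonneg g)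
qed

lemma card_triangle_edges_le: "card (triangle_edges t) \<le> 3" "finite (triangle_edges t)"
proof -
  obtain i j k where t: "t = (i, j, k)" by (cases t)
  show "card (triangle_edges t) \<le> 3"
    using card_length[of "[{i, j}, {j, k}, {i, k}]"] by (simp add: t triangle_edges_def)
  show "finite (triangle_edges t)" by (simp add: t triangle_edges_def)
qed

lemma triangle_edges_inter_empty:
  assumes "entries s \<inter> entries t = {}"
  shows "triangle_edges s \<inter> triangle_edges t = {}"
proof -
  have "e \<noteq> {} \<and> e \<subseteq> entries r" if "e \<in> triangle_edges r" for e r
    using that by (cases r) (auto simp: triangle_edges_def entries_def)
  with assms show ?thesis by blast
qed

lemma injective_if_triangle:
  assumes "G \<in> graphs_with_degrees n d" "triangle_edges t \<subseteq> G"
  shows "injective_triple t"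
proof -
  obtain i j k where t: "t = (i, j, k)" by (cases t)
  have "{i, j} \<in> G" "{j, k} \<in> G" "{i, k} \<in> G"
    using assms(2) by (simp_all add: t triangle_edges_def)
  then show ?thesis
    using edge_of_graph(1)[OF assms(1)] unfolding t injective_triple_def by blast
qed

text \<open>Every triangle has six orderings.\<close>

lemma card_ordered_triangles:
  assumes G: "G \<in> graphs_with_degrees n d"
  shows "card (ordered_triangles {1..n} G) = 6 * card (triangles G)"
proof -
  define F where "F t = {(i, j, k). {i, j, k} = t \<and> i \<noteq> j \<and> j \<noteq> k \<and> i \<noteq> k}" for t :: "nat set"
  have F: "finite (F t) \<and> card (F t) = 6" if t: "card t = 3" for t
  proof -
    obtain a b c where abc: "t = {a, b, c}" "a \<noteq> b" "b \<noteq> c" "a \<noteq> c"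
      using t by (metis card_3_iff)
    have "F t = {(a, b, c), (a, c, b), (b, a, c), (b, c, a), (c, a, b), (c, b, a)}"
    proof
      show "F t \<subseteq> {(a, b, c), (a, c, b), (b, a, c), (b, c, a), (c, a, b), (c, b, a)}"
      proof
        fix s assume s: "s \<in> F t"
        obtain i j k where ijk: "s = (i, j, k)" by (cases s)
        with s abc(1) have eq: "{i, j, k} = {a, b, c}" and ne: "i \<noteq> j" "j \<noteq> k" "i \<noteq> k"
          by (auto simp: F_def)
        have "i \<in> {a, b, c}" "j \<in> {a, b, c}" "k \<in> {a, b, c}" using eq by blast+
        with ne show "s \<in> {(a, b, c), (a, c, b), (b, a, c), (b, c, a), (c, a, b), (c, b, a)}"
          unfolding ijk by auto
      qed
      show "{(a, b, c), (a, c, b), (b, a, c), (b, c, a), (c, a, b), (c, b, a)} \<subseteq> F t"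
        using abc by (auto simp: F_def)
    qed
    then show ?thesis using abc(2-4) by simp
  qed
  have "t \<subseteq> {1..n}" if "t \<in> triangles G" for t
  proof -
    have "card t = 3" using that by (simp add: triangles_def)
    then obtain a b c where abc: "t = {a, b, c}" "a \<noteq> b" "b \<noteq> c" "a \<noteq> c"
      by (metis card_3_iff)
    then have "{a, b} \<in> G" "{b, c} \<in> G" using that by (auto simp: triangles_def)
    then show ?thesis using edge_of_graph[OF G] abc(1) by blast
  qed
  then have fin: "finite (triangles G)"
    by (intro finite_subset[of "triangles G" "Pow {1..n}"]) auto
  have eq: "ordered_triangles {1..n} G = (\<Union>t\<in>triangles G. F t)"
  proof (rule set_eqI)
    fix s :: "nat \<times> nat \<times> nat"
    obtain i j k where s: "s = (i, j, k)" by (cases s)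
    show "s \<in> ordered_triangles {1..n} G \<longleftrightarrow> s \<in> (\<Union>t\<in>triangles G. F t)"
    proof
      assume "s \<in> ordered_triangles {1..n} G"
      then have "{i, j} \<in> G" "{j, k} \<in> G" "{i, k} \<in> G"
        by (auto simp: s ordered_triangles_def triangle_edges_def)
      moreover from this have "i \<noteq> j" "j \<noteq> k" "i \<noteq> k" using edge_of_graph(1)[OF G] by blast+
      ultimately have "{i, j, k} \<in> triangles G" "s \<in> F {i, j, k}"
        by (auto simp: triangles_def F_def s insert_commute)
      then show "s \<in> (\<Union>t\<in>triangles G. F t)" by blast
    next
      assume "s \<in> (\<Union>t\<in>triangles G. F t)"
      then have "{i, j} \<in> G" "{j, k} \<in> G" "{i, k} \<in> G"
        by (auto simp: triangles_def F_def s)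
      moreover from this have "i \<in> {1..n}" "j \<in> {1..n}" "k \<in> {1..n}" using edge_of_graph[OF G] by blast+
      ultimately show "s \<in> ordered_triangles {1..n} G"
        by (simp add: s ordered_triangles_def triangle_edges_def triples_def)
    qed
  qed
  have "card (ordered_triangles {1..n} G) = (\<Sum>t\<in>triangles G. card (F t))"
    unfolding eq
  proof (rule card_UN_disjoint[OF fin])
    show "\<forall>t\<in>triangles G. finite (F t)" using F by (auto simp: triangles_def)
    show "\<forall>s\<in>triangles G. \<forall>t\<in>triangles G. s \<noteq> t \<longrightarrow> F s \<inter> F t = {}" by (auto simp: F_def)
  qed
  also have "\<dots> = (\<Sum>t\<in>triangles G. 6)" using F by (intro sum.cong) (auto simp: triangles_def)
  finally show ?thesis by simp
qed

text \<open>The three edges are prescribed one after another; allowing \<open>J\<close> to contain another triangle makes the bound usable for the second moment.\<close>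

lemma triangle_prob_upper:
  assumes t: "t \<in> triples {1..n}" "injective_triple t"
    and J: "finite J" "card J \<le> 3" "triangle_edges t \<inter> J = {}" and pos: "0 < switch_volume n d"
  shows "real (card (extensions n d (triangle_edges t \<union> J)))
         \<le> triangle_weight (switch_volume n d) d t * real (card (extensions n d J))"
proof -
  let ?g = "\<lambda>x y. prob_of_odds (real (d x) * real (d y) / switch_volume n d)"
  have g0: "0 \<le> ?g x y" for x y using pos by (intro prob_of_odds_nonneg) simp
  obtain i j k where ijk: "t = (i, j, k)" by (cases t)
  with t J have q: "i \<in> {1..n}" "j \<in> {1..n}" "k \<in> {1..n}" "i \<noteq> j" "j \<noteq> k" "i \<noteq> k"
    "{i, j} \<notin> J" "{j, k} \<notin> J" "{i, k} \<notin> J"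
    by (auto simp: triples_def injective_triple_def triangle_edges_def)
  have c1: "card (insert {i, k} J) \<le> 6" and c2: "card (insert {j, k} (insert {i, k} J)) \<le> 6"
    using J by (auto simp: card_insert_if)
  have "real (card (extensions n d (insert {i, j} (insert {j, k} (insert {i, k} J))))) \<le>
      ?g i j * real (card (extensions n d (insert {j, k} (insert {i, k} J))))"
    by (rule edge_prob_upper) (use q J c2 pos in \<open>auto simp: doubleton_eq_iff\<close>)
  moreover have "real (card (extensions n d (insert {j, k} (insert {i, k} J)))) \<le>
      ?g j k * real (card (extensions n d (insert {i, k} J)))"
    by (rule edge_prob_upper) (use q J c1 pos in \<open>auto simp: doubleton_eq_iff\<close>)
  moreover have "real (card (extensions n d (insert {i, k} J))) \<le> ?g i k * real (card (extensions n d J))"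
    by (rule edge_prob_upper) (use q J pos in \<open>auto simp: doubleton_eq_iff\<close>)
  ultimately have "real (card (extensions n d (insert {i, j} (insert {j, k} (insert {i, k} J))))) \<le>
      ?g i j * (?g j k * (?g i k * real (card (extensions n d J))))"
    using g0 by (meson mult_left_mono order_trans)
  then show ?thesis by (simp add: ijk triangle_edges_def triangle_weight_def mult_ac)
qed

lemma triangle_prob_lower:
  assumes t: "t \<in> triples {1..n}" "injective_triple t" and pos: "0 < switch_volume n d"
    and \<omega>: "1 \<le> \<omega>" "\<And>i. i \<in> entries t \<Longrightarrow> \<omega> \<le> real (d i)"
    and \<eta>: "connection_rate n d + 9 / \<omega> \<le> 1"
  shows "(1 - (connection_rate n d + 9 / \<omega>)) ^ 3 * triangle_weight (real (total_degree n d)) d t *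
           real (card (graphs_with_degrees n d)) \<le> real (card (extensions n d (triangle_edges t)))"
proof -
  let ?g = "\<lambda>x y. prob_of_odds (real (d x) * real (d y) / real (total_degree n d))"
  let ?c = "1 - (connection_rate n d + 9 / \<omega>)"
  have g0: "0 \<le> ?g x y" for x y by (intro prob_of_odds_nonneg) simp
  have c0: "0 \<le> ?c" using \<eta> by simp
  obtain i j k where ijk: "t = (i, j, k)" by (cases t)
  with t have q: "i \<in> {1..n}" "j \<in> {1..n}" "k \<in> {1..n}" "i \<noteq> j" "j \<noteq> k" "i \<noteq> k"
    by (auto simp: triples_def injective_triple_def)
  have w: "\<omega> \<le> real (d i)" "\<omega> \<le> real (d j)" "\<omega> \<le> real (d k)" using \<omega>(2) by (auto simp: ijk entries_def)
  have "?c * ?g i j * (?c * ?g j k * (?c * ?g i k * real (card (extensions n d {}))))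
      \<le> ?c * ?g i j * (?c * ?g j k * real (card (extensions n d {{i, k}})))"
    using c0 g0 by (intro mult_left_mono edge_prob_lower) (use q w pos \<omega>(1) in \<open>auto simp: doubleton_eq_iff\<close>)
  also have "\<dots> \<le> ?c * ?g i j * real (card (extensions n d {{j, k}, {i, k}}))"
    using c0 g0 by (intro mult_left_mono edge_prob_lower) (use q w pos \<omega>(1) in \<open>auto simp: doubleton_eq_iff\<close>)
  also have "\<dots> \<le> real (card (extensions n d {{i, j}, {j, k}, {i, k}}))"
    using c0 g0 by (intro edge_prob_lower) (use q w pos \<omega>(1) in \<open>auto simp: doubleton_eq_iff card_insert_if\<close>)
  finally show ?thesis
    by (simp add: ijk triangle_edges_def triangle_weight_def power3_eq_cube mult_ac)
qed

lemma sum_card_ordered_triangles: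
  assumes "finite A"
  shows "(\<Sum>G\<in>graphs_with_degrees n d. real (card (ordered_triangles A G))) =
         (\<Sum>t\<in>triples A. real (card (extensions n d (triangle_edges t))))"
proof -
  have "(\<Sum>G\<in>graphs_with_degrees n d. real (card (ordered_triangles A G))) =
        (\<Sum>G\<in>graphs_with_degrees n d. \<Sum>t\<in>triples A. of_bool (triangle_edges t \<subseteq> G))"
    using assms by (simp add: ordered_triangles_def Int_def)
  also have "\<dots> = (\<Sum>t\<in>triples A. \<Sum>G\<in>graphs_with_degrees n d. of_bool (triangle_edges t \<subseteq> G))"
    by (rule sum.swap)
  also have "\<dots> = (\<Sum>t\<in>triples A. real (card (extensions n d (triangle_edges t))))"
    by (simp add: extensions_def finite_graphs_with_degrees Int_def)
  finally show ?thesis .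
qed

lemma sum_of_bool_filter:
  "finite X \<Longrightarrow> (\<Sum>x\<in>X. of_bool (P x)) = real (card {x \<in> X. P x})"
  by (simp add: Int_def)

lemma sum_card_ordered_triangles_sq:
  assumes "finite A"
  shows "(\<Sum>G\<in>graphs_with_degrees n d. (real (card (ordered_triangles A G)))\<^sup>2) =
         (\<Sum>s\<in>triples A. \<Sum>t\<in>triples A. real (card (extensions n d (triangle_edges s \<union> triangle_edges t))))"
proof -
  have "(\<Sum>G\<in>graphs_with_degrees n d. (real (card (ordered_triangles A G)))\<^sup>2) =
        (\<Sum>G\<in>graphs_with_degrees n d. \<Sum>(s, t)\<in>triples A \<times> triples A. of_bool (triangle_edges s \<union> triangle_edges t \<subseteq> G))"
  proof (rule sum.cong)
    fix G
    have eq: "{p \<in> triples A \<times> triples A. case p of (s, t) \<Rightarrow> triangle_edges s \<union> triangle_edges t \<subseteq> G} =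
        ordered_triangles A G \<times> ordered_triangles A G"
      by (auto simp: ordered_triangles_def)
    have "(\<Sum>(s, t)\<in>triples A \<times> triples A. of_bool (triangle_edges s \<union> triangle_edges t \<subseteq> G)) =
        (\<Sum>p\<in>triples A \<times> triples A. of_bool (case p of (s, t) \<Rightarrow> triangle_edges s \<union> triangle_edges t \<subseteq> G) :: real)"
      by (intro sum.cong) auto
    also have "\<dots> = real (card {p \<in> triples A \<times> triples A. case p of (s, t) \<Rightarrow> triangle_edges s \<union> triangle_edges t \<subseteq> G})"
      by (rule sum_of_bool_filter) (use assms in simp)
    also have "\<dots> = (real (card (ordered_triangles A G)))\<^sup>2"
      unfolding eq by (simp add: card_cartesian_product power2_eq_square)
    finally show "(real (card (ordered_triangles A G)))\<^sup>2 =
      (\<Sum>(s, t)\<in>triples A \<times> triples A. of_bool (triangle_edges s \<union> triangle_edges t \<subseteq> G))" by simp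
  qed simp
  also have "\<dots> = (\<Sum>(s, t)\<in>triples A \<times> triples A. \<Sum>G\<in>graphs_with_degrees n d. of_bool (triangle_edges s \<union> triangle_edges t \<subseteq> G))"
    by (subst sum.swap) (simp add: case_prod_unfold)
  also have "\<dots> = (\<Sum>s\<in>triples A. \<Sum>t\<in>triples A. \<Sum>G\<in>graphs_with_degrees n d. of_bool (triangle_edges s \<union> triangle_edges t \<subseteq> G))"
    by (rule sum.cartesian_product[symmetric])
  also have "\<dots> = (\<Sum>s\<in>triples A. \<Sum>t\<in>triples A. real (card (extensions n d (triangle_edges s \<union> triangle_edges t))))"
    by (simp add: extensions_def finite_graphs_with_degrees Int_def del: Un_subset_iff)
  finally show ?thesis .
qed

lemma extensions_degenerate:
  assumes "\<not> injective_triple t" "triangle_edges t \<subseteq> J"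
  shows "extensions n d J = {}"
proof -
  have "injective_triple t" if "G \<in> extensions n d J" for G
    using that assms(2) by (intro injective_if_triangle[of G n d]) (auto simp: extensions_def)
  with assms(1) show ?thesis by blast
qed

lemma card_extensions_mono: "J \<subseteq> J' \<Longrightarrow> card (extensions n d J') \<le> card (extensions n d J)"
  by (rule card_mono[OF finite_extensions]) (force simp: extensions_def)

lemma first_moment_upper:
  assumes pos: "0 < switch_volume n d"
  shows "(\<Sum>G\<in>graphs_with_degrees n d. real (card (ordered_triangles {1..n} G))) \<le>
         (\<Sum>t\<in>triples {1..n}. triangle_weight (switch_volume n d) d t) * real (card (graphs_with_degrees n d))"
proof -
  have "real (card (extensions n d (triangle_edges t))) \<le>
      triangle_weight (switch_volume n d) d t * real (card (graphs_with_degrees n d))"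
    if t: "t \<in> triples {1..n}" for t
  proof (cases "injective_triple t")
    case True
    from triangle_prob_upper[OF t True, of "{}" d] pos show ?thesis by simp
  next
    case False
    then have "extensions n d (triangle_edges t) = {}" by (rule extensions_degenerate) simp
    then show ?thesis using pos by (simp add: triangle_weight_bounds)
  qed
  then show ?thesis
    unfolding sum_card_ordered_triangles[OF finite_atLeastAtMost] sum_distrib_right by (rule sum_mono)
qed

lemma card_degenerate_triples:
  assumes "finite A"
  shows "card {t \<in> triples A. \<not> injective_triple t} \<le> 3 * card A ^ 2"
proof -
  let ?f = "\<lambda>(i, j). (i, i, j)" and ?g = "\<lambda>(i, j). (i, j, j)" and ?h = "\<lambda>(i, j). (i, j, i)"
  have im: "card (f ` (A \<times> A)) \<le> card A ^ 2" for f :: "nat \<times> nat \<Rightarrow> nat \<times> nat \<times> nat"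
    using card_image_le[OF finite_cartesian_product[OF assms assms], of f]
    by (simp only: card_cartesian_product power2_eq_square)
  have "card {t \<in> triples A. \<not> injective_triple t} \<le> card (?f ` (A \<times> A) \<union> (?g ` (A \<times> A) \<union> ?h ` (A \<times> A)))"
    using assms by (intro card_mono) (auto simp: triples_def injective_triple_def image_iff)
  also have "\<dots> \<le> card (?f ` (A \<times> A)) + (card (?g ` (A \<times> A)) + card (?h ` (A \<times> A)))"
    by (intro order_trans[OF card_Un_le] add_left_mono order_refl)
  also have "\<dots> \<le> 3 * card A ^ 2" using im[of ?f] im[of ?g] im[of ?h] by linarith
  finally show ?thesis .
qed

lemma card_overlapping_triples:
  assumes "finite A"
  shows "card {t \<in> triples A. entries s \<inter> entries t \<noteq> {}} \<le> 9 * card A ^ 2"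
proof -
  let ?E = "entries s"
  have E: "finite ?E" "card ?E \<le> 3" by (auto simp: entries_def card_insert_if split: prod.split)
  have "card {t \<in> triples A. ?E \<inter> entries t \<noteq> {}} \<le> card (?E \<times> A \<times> A \<union> (A \<times> ?E \<times> A \<union> A \<times> A \<times> ?E))"
    using assms E by (intro card_mono) (auto simp: triples_def entries_def)
  also have "\<dots> \<le> card (?E \<times> A \<times> A) + (card (A \<times> ?E \<times> A) + card (A \<times> A \<times> ?E))"
    by (intro order_trans[OF card_Un_le] add_left_mono order_refl)
  also have "\<dots> = 3 * (card ?E * card A ^ 2)"
    by (simp add: card_cartesian_product power2_eq_square)
  also have "\<dots> \<le> 3 * (3 * card A ^ 2)" using E by (intro mult_left_mono mult_right_mono) auto
  finally show ?thesis by simp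
qed

text \<open>The lower bound for edge probabilities only applies to triples of distinct vertices, and the term \<open>3 * card A ^ 2\<close> accounts for
the others.\<close>

lemma first_moment_lower:
  assumes A: "A \<subseteq> {1..n}" and pos: "0 < switch_volume n d"
    and \<omega>: "1 \<le> \<omega>" "\<And>i. i \<in> A \<Longrightarrow> \<omega> \<le> real (d i)"
    and \<eta>: "connection_rate n d + 9 / \<omega> \<le> 1"
  shows "(1 - (connection_rate n d + 9 / \<omega>)) ^ 3 *
           ((\<Sum>t\<in>triples A. triangle_weight (real (total_degree n d)) d t) - 3 * real (card A) ^ 2) *
           real (card (graphs_with_degrees n d))
         \<le> (\<Sum>G\<in>graphs_with_degrees n d. real (card (ordered_triangles A G)))"
proof -
  let ?c = "1 - (connection_rate n d + 9 / \<omega>)" and ?w = "triangle_weight (real (total_degree n d)) d"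
    and ?t = "real (card (graphs_with_degrees n d))"
  have finA: "finite A" using A finite_subset by blast
  have w: "0 \<le> ?w t" "?w t \<le> 1" for t by (rule triangle_weight_bounds, simp)+
  have "(\<Sum>t\<in>triples A. ?w t) = (\<Sum>t\<in>{t \<in> triples A. injective_triple t}. ?w t) +
      (\<Sum>t\<in>{t \<in> triples A. \<not> injective_triple t}. ?w t)"
    using finA by (subst sum.union_disjoint[symmetric]) (auto intro!: sum.cong)
  also have "(\<Sum>t\<in>{t \<in> triples A. \<not> injective_triple t}. ?w t) \<le> real (card {t \<in> triples A. \<not> injective_triple t}) * 1"
    using w by (intro sum_bounded_above)
  also have "\<dots> \<le> 3 * real (card A) ^ 2"
    using of_nat_mono[OF card_degenerate_triples[OF finA], where 'a = real] by simp
  finally have "(\<Sum>t\<in>triples A. ?w t) - 3 * real (card A) ^ 2 \<le> (\<Sum>t\<in>{t \<in> triples A. injective_triple t}. ?w t)"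
    by simp
  then have "?c ^ 3 * ((\<Sum>t\<in>triples A. ?w t) - 3 * real (card A) ^ 2) * ?t \<le>
      ?c ^ 3 * (\<Sum>t\<in>{t \<in> triples A. injective_triple t}. ?w t) * ?t"
    using \<eta> by (intro mult_right_mono mult_left_mono) auto
  also have "\<dots> = (\<Sum>t\<in>{t \<in> triples A. injective_triple t}. ?c ^ 3 * ?w t * ?t)"
    by (simp add: sum_distrib_left sum_distrib_right)
  also have "\<dots> \<le> (\<Sum>t\<in>{t \<in> triples A. injective_triple t}. real (card (extensions n d (triangle_edges t))))"
    using A \<omega> \<eta> pos
    by (intro sum_mono triangle_prob_lower) (auto simp: triples_def entries_def)
  also have "\<dots> \<le> (\<Sum>t\<in>triples A. real (card (extensions n d (triangle_edges t))))"
    using finA by (intro sum_mono2) auto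
  finally show ?thesis by (simp add: sum_card_ordered_triangles[OF finA])
qed

text \<open>For two triples without a common vertex all six edges are distinct and the bound for triangles is used twice. The
pairs of triples that share a vertex are merely counted, which gives a power of \<open>card A\<close> one lower than the main
term.\<close>

lemma second_moment_upper:
  assumes A: "A \<subseteq> {1..n}" and pos: "0 < switch_volume n d"
  shows "(\<Sum>G\<in>graphs_with_degrees n d. (real (card (ordered_triangles A G)))\<^sup>2) \<le>
         ((\<Sum>t\<in>triples A. triangle_weight (switch_volume n d) d t)\<^sup>2 + 9 * real (card A) ^ 5) *
         real (card (graphs_with_degrees n d))"
proof -
  let ?w = "triangle_weight (switch_volume n d) d" and ?t = "real (card (graphs_with_degrees n d))"
  let ?o = "\<lambda>s t. of_bool (entries s \<inter> entries t \<noteq> {}) :: real"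
  have finA: "finite A" using A finite_subset by blast
  have w: "0 \<le> ?w t" for t using pos by (intro triangle_weight_bounds) simp
  have "real (card (extensions n d (triangle_edges s \<union> triangle_edges t))) \<le> (?w s * ?w t + ?o s t) * ?t"
    if s: "s \<in> triples A" and t: "t \<in> triples A" for s t
  proof (cases "injective_triple s \<and> injective_triple t \<and> entries s \<inter> entries t = {}")
    case True
    have st: "s \<in> triples {1..n}" "t \<in> triples {1..n}" using s t A by (auto simp: triples_def)
    have "real (card (extensions n d (triangle_edges s \<union> triangle_edges t))) \<le>
        ?w s * real (card (extensions n d (triangle_edges t)))"
      using True by (intro triangle_prob_upper st card_triangle_edges_le triangle_edges_inter_empty pos) auto
    moreover have "real (card (extensions n d (triangle_edges t))) \<le> ?w t * ?t"
      using triangle_prob_upper[OF st(2), of "{}" d] True pos by simp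
    ultimately have "real (card (extensions n d (triangle_edges s \<union> triangle_edges t))) \<le> ?w s * (?w t * ?t)"
      using w by (meson mult_left_mono order_trans)
    then show ?thesis using True by (simp add: mult.assoc)
  next
    case False
    show ?thesis
    proof (cases "injective_triple s \<and> injective_triple t")
      case True
      with False have "?o s t = 1" by simp
      moreover have "real (card (extensions n d (triangle_edges s \<union> triangle_edges t))) \<le> 1 * ?t"
        using card_extensions_mono[of "{}" _ n d] by simp
      moreover have "0 \<le> ?w s * ?w t * ?t" using w by simp
      ultimately show ?thesis by (simp add: distrib_right)
    next
      case False
      then have "extensions n d (triangle_edges s \<union> triangle_edges t) = {}"
        using extensions_degenerate[of s] extensions_degenerate[of t] by auto
      then show ?thesis using w by simp
    qed
  qed
  then have "(\<Sum>G\<in>graphs_with_degrees n d. (real (card (ordered_triangles A G)))\<^sup>2) \<le>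
      (\<Sum>s\<in>triples A. \<Sum>t\<in>triples A. (?w s * ?w t + ?o s t) * ?t)"
    unfolding sum_card_ordered_triangles_sq[OF finA] by (intro sum_mono)
  also have "\<dots> = ((\<Sum>t\<in>triples A. ?w t)\<^sup>2 + (\<Sum>s\<in>triples A. \<Sum>t\<in>triples A. ?o s t)) * ?t"
    by (simp add: sum_distrib_right[symmetric] sum.distrib power2_eq_square sum_product del: sum_of_bool_eq)
  also have "\<dots> \<le> ((\<Sum>t\<in>triples A. ?w t)\<^sup>2 + 9 * real (card A) ^ 5) * ?t"
  proof -
    have "(\<Sum>t\<in>triples A. ?o s t) \<le> 9 * real (card A) ^ 2" for s
      using of_nat_mono[OF card_overlapping_triples[OF finA, of s], where 'a = real] finA
      by (simp add: Int_def)
    then have "(\<Sum>s\<in>triples A. \<Sum>t\<in>triples A. ?o s t) \<le> real (card (triples A)) * (9 * real (card A) ^ 2)"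
      by (intro sum_bounded_above)
    also have "\<dots> = 9 * real (card A) ^ 5" by (simp add: card_triples power_add[symmetric])
    finally show ?thesis by (intro mult_right_mono add_left_mono) auto
  qed
  finally show ?thesis .
qed

section \<open>The triangle integral and the power measure\<close>

text \<open>The freedom of choosing \<open>r\<close> is the source of the different bounds below, each of which is good in
one region.\<close>

lemma inverse_one_plus_le_powr:
  fixes t r :: real
  assumes "0 < t" "0 \<le> r" "r \<le> 1"
  shows "1 / (1 + t) \<le> t powr (- r)"
proof -
  have "t powr r \<le> 1 + t"
  proof (cases "t \<le> 1")
    case True
    have "t powr r \<le> 1" using assms True by (intro powr_le1) auto
    then show ?thesis using assms by simp
  next
    case False
    have "t powr r \<le> t powr 1" using assms False by (intro powr_mono) auto
    then show ?thesis using assms by simp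
  qed
  then show ?thesis using assms by (simp add: powr_minus divide_simps)
qed

definition triangle_integrand :: "real \<Rightarrow> real \<Rightarrow> real \<Rightarrow> real \<Rightarrow> real" where
  "triangle_integrand \<tau> x y z = (x * y * z) powr (2 - \<tau>) / ((1 + x * y) * (1 + y * z) * (1 + x * z))"

lemma triangle_integrand_le_powr:
  assumes pos: "0 < x" "0 < y" "0 < z" and r: "r1 \<in> {0..1}" "r2 \<in> {0..1}" "r3 \<in> {0..1}"
  shows "triangle_integrand \<tau> x y z \<le>
    x powr (2 - \<tau> - r1 - r3) * y powr (2 - \<tau> - r1 - r2) * z powr (2 - \<tau> - r2 - r3)"
proof -
  have "triangle_integrand \<tau> x y z =
      (x * y * z) powr (2 - \<tau>) * (1 / (1 + x * y)) * (1 / (1 + y * z)) * (1 / (1 + x * z))"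
    by (simp add: triangle_integrand_def)
  also have "\<dots> \<le> (x * y * z) powr (2 - \<tau>) * (x * y) powr (- r1) * (y * z) powr (- r2) * (x * z) powr (- r3)"
    using pos r by (intro mult_mono inverse_one_plus_le_powr order_refl mult_nonneg_nonneg) auto
  also have "\<dots> = x powr (2 - \<tau> - r1 - r3) * y powr (2 - \<tau> - r1 - r2) * z powr (2 - \<tau> - r2 - r3)"
    using pos by (simp add: powr_mult powr_diff powr_minus powr_add field_simps)
  finally show ?thesis .
qed

text \<open>The exponents differ from the critical value \<open>-1\<close> by \<open>(3 - \<tau>) / 4\<close>, towards integrability both at \<open>0\<close> and at infinity.\<close>

definition product_majorant :: "real \<Rightarrow> real \<Rightarrow> real" where
  "product_majorant \<tau> x = (if x \<le> 1 then x powr (- 1 + (3 - \<tau>) / 4) else x powr (- 1 - (3 - \<tau>) / 4))"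

lemma product_majorant_nonneg: "0 \<le> product_majorant \<tau> x"
  by (simp add: product_majorant_def)

text \<open>How many of the three variables are at most one decides which exponents \<open>r1\<close>, \<open>r2\<close>, \<open>r3\<close> to use for the three factors of the
denominator. With \<open>\<delta> = (3 - \<tau>) / 4\<close> a choice is needed for which the exponents of the small variables come out at least \<open>-1 + \<delta>\<close> and those of the large ones at most
\<open>-1 - \<delta>\<close>.\<close>

lemma triangle_integrand_le_majorant_sorted:
  assumes tau: "2 < \<tau>" "\<tau> < 3" and xyz: "0 < x" "x \<le> y" "y \<le> z"
  shows "triangle_integrand \<tau> x y z \<le> product_majorant \<tau> x * product_majorant \<tau> y * product_majorant \<tau> z"
proof -
  let ?bound = "product_majorant \<tau> x * product_majorant \<tau> y * product_majorant \<tau> z"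
  define \<delta> where "\<delta> = (3 - \<tau>) / 4"
  have d: "0 < \<delta>" "\<delta> < 1 / 4" and tau_eq: "2 - \<tau> = - 1 + 4 * \<delta>" using tau by (auto simp: \<delta>_def)
  have pos: "0 < x" "0 < y" "0 < z" using xyz by auto
  have small: "w powr a \<le> product_majorant \<tau> w" if "w \<le> 1" "0 < w" "- 1 + \<delta> \<le> a" for w a
    using that unfolding product_majorant_def \<delta>_def by (auto intro: powr_mono')
  have large: "w powr a \<le> product_majorant \<tau> w" if "1 < w" "a \<le> - 1 - \<delta>" for w a
    using that unfolding product_majorant_def \<delta>_def by (auto intro: powr_mono)
  note bound = triangle_integrand_le_powr[OF pos, where \<tau> = \<tau>, unfolded tau_eq]
  \<comment> \<open>The exponents are \<open>(0, 0, 0)\<close>, \<open>(0, 3 * \<delta>, 3 * \<delta>)\<close>, \<open>(\<delta>, 1, \<delta>)\<close> and \<open>(1, 1, 1)\<close>, respectively.\<close>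
  consider "z \<le> 1" | "y \<le> 1" "1 < z" | "x \<le> 1" "1 < y" | "1 < x" by linarith
  then show ?thesis
  proof cases
    case 1
    have "triangle_integrand \<tau> x y z \<le> x powr (- 1 + 4 * \<delta> - 0 - 0) * y powr (- 1 + 4 * \<delta> - 0 - 0) * z powr (- 1 + 4 * \<delta> - 0 - 0)"
      by (rule bound) auto
    also have "\<dots> \<le> ?bound"
      using 1 xyz d by (intro mult_mono small product_majorant_nonneg mult_nonneg_nonneg) auto
    finally show ?thesis .
  next
    case 2
    have "triangle_integrand \<tau> x y z \<le> x powr (- 1 + 4 * \<delta> - 0 - 3 * \<delta>) * y powr (- 1 + 4 * \<delta> - 0 - 3 * \<delta>) * z powr (- 1 + 4 * \<delta> - 3 * \<delta> - 3 * \<delta>)"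
      by (rule bound) (use d in auto)
    also have "\<dots> \<le> ?bound"
      using 2 xyz d by (intro mult_mono small large product_majorant_nonneg mult_nonneg_nonneg) auto
    finally show ?thesis .
  next
    case 3
    have "triangle_integrand \<tau> x y z \<le> x powr (- 1 + 4 * \<delta> - \<delta> - \<delta>) * y powr (- 1 + 4 * \<delta> - \<delta> - 1) * z powr (- 1 + 4 * \<delta> - 1 - \<delta>)"
      by (rule bound) (use d in auto)
    also have "\<dots> \<le> ?bound"
      using 3 xyz d by (intro mult_mono small large product_majorant_nonneg mult_nonneg_nonneg) auto
    finally show ?thesis .
  next
    case 4
    have "triangle_integrand \<tau> x y z \<le> x powr (- 1 + 4 * \<delta> - 1 - 1) * y powr (- 1 + 4 * \<delta> - 1 - 1) * z powr (- 1 + 4 * \<delta> - 1 - 1)"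
      by (rule bound) auto
    also have "\<dots> \<le> ?bound"
      using 4 xyz d by (intro mult_mono large product_majorant_nonneg mult_nonneg_nonneg) auto
    finally show ?thesis .
  qed
qed

lemma triangle_integrand_swap:
  "triangle_integrand \<tau> x y z = triangle_integrand \<tau> y x z"
  "triangle_integrand \<tau> x y z = triangle_integrand \<tau> x z y"
  by (simp_all add: triangle_integrand_def mult_ac)

lemma triangle_integrand_le_majorant:
  assumes tau: "2 < \<tau>" "\<tau> < 3" and pos: "0 < x" "0 < y" "0 < z"
  shows "triangle_integrand \<tau> x y z \<le> product_majorant \<tau> x * product_majorant \<tau> y * product_majorant \<tau> z"
proof -
  note sorted = triangle_integrand_le_majorant_sorted[OF tau]
  consider "x \<le> y" "y \<le> z" | "x \<le> z" "z \<le> y" | "y \<le> x" "x \<le> z" | "y \<le> z" "z \<le> x" | "z \<le> x" "x \<le> y" | "z \<le> y" "y \<le> x"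
    by linarith
  then show ?thesis
  proof cases
    case 1 then show ?thesis using sorted[of x y z] pos by simp
  next
    case 2 then show ?thesis using sorted[of x z y] pos triangle_integrand_swap(2)[of \<tau> x y z] by (simp add: mult_ac)
  next
    case 3 then show ?thesis using sorted[of y x z] pos triangle_integrand_swap(1)[of \<tau> x y z] by (simp add: mult_ac)
  next
    case 4 then show ?thesis
      using sorted[of y z x] pos triangle_integrand_swap(1)[of \<tau> x y z] triangle_integrand_swap(2)[of \<tau> y x z] by (simp add: mult_ac)
  next
    case 5 then show ?thesis
      using sorted[of z x y] pos triangle_integrand_swap(2)[of \<tau> x y z] triangle_integrand_swap(1)[of \<tau> x z y] by (simp add: mult_ac)
  next
    case 6 then show ?thesis
      using sorted[of z y x] pos triangle_integrand_swap(1)[of \<tau> x y z] triangle_integrand_swap(2)[of \<tau> y x z]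
        triangle_integrand_swap(1)[of \<tau> y z x] by (simp add: mult_ac)
  qed
qed

definition power_measure :: "real \<Rightarrow> real \<Rightarrow> real measure" where
  "power_measure k \<tau> = density lborel (\<lambda>x. ennreal (indicator {0<..} x * (k * (\<tau> - 1) * x powr (- \<tau>))))"

lemma sets_power_measure [simp, measurable_cong]: "sets (power_measure k \<tau>) = sets borel"
  by (simp add: power_measure_def)

lemma space_power_measure [simp]: "space (power_measure k \<tau>) = UNIV"
  by (simp add: power_measure_def)

lemma emeasure_power_measure_greaterThan:
  assumes "0 < y" "1 < \<tau>" "0 \<le> k"
  shows "emeasure (power_measure k \<tau>) {y<..} = ennreal (k * y powr (1 - \<tau>))"
proof -
  let ?f = "\<lambda>x. k * (\<tau> - 1) * x powr (- \<tau>)"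
  have "emeasure (power_measure k \<tau>) {y<..} = (\<integral>\<^sup>+x. ennreal (indicator {0<..} x * ?f x) * indicator {y<..} x \<partial>lborel)"
    unfolding power_measure_def by (subst emeasure_density) auto
  also have "\<dots> = (\<integral>\<^sup>+x. ennreal (?f x) * indicator {y..} x \<partial>lborel)"
  proof (rule nn_integral_cong_AE)
    show "AE x in lborel. ennreal (indicator {0<..} x * ?f x) * indicator {y<..} x = ennreal (?f x) * indicator {y..} x"
      using AE_lborel_singleton[of y] by eventually_elim (use assms in \<open>auto simp: indicator_def\<close>)
  qed
  also have "\<dots> = 0 - (- k * y powr (1 - \<tau>))"
  proof (rule nn_integral_FTC_atLeast)
    show "?f \<in> borel_measurable borel" by measurable
    show "((\<lambda>x. - k * x powr (1 - \<tau>)) has_real_derivative ?f x) (at x)" if "y \<le> x" for x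
    proof -
      have "((\<lambda>x. x powr (1 - \<tau>)) has_real_derivative (1 - \<tau>) * x powr (1 - \<tau> - 1)) (at x)"
        using that assms by (intro has_real_derivative_powr) auto
      from DERIV_cmult[OF this, of "- k"] show ?thesis by (simp add: algebra_simps)
    qed
    show "0 \<le> ?f x" if "y \<le> x" for x using assms by simp
    have "((\<lambda>x. - k * x powr (1 - \<tau>)) \<longlongrightarrow> - k * 0) at_top"
      using assms by (intro tendsto_mult tendsto_const tendsto_neg_powr filterlim_ident) auto
    then show "((\<lambda>x. - k * x powr (1 - \<tau>)) \<longlongrightarrow> 0) at_top" by simp
  qed
  finally show ?thesis by simp
qed

lemma nn_integral_powr_less_infinity:
  fixes a b :: real
  assumes "- 1 < a" "b < - 1"
  shows "(\<integral>\<^sup>+x. ennreal (if x \<le> 1 then x powr a else x powr b) * indicator {0<..} x \<partial>lborel) < \<infinity>"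
proof -
  have 1: "(\<integral>\<^sup>+x. ennreal (indicator {0..1} x * x powr a) \<partial>lborel) < \<infinity>"
  proof -
    have "((\<lambda>x. x powr a) has_integral (1 powr (a + 1) / (a + 1))) {0..1}"
      using has_integral_powr_from_0[of a 1] assms by simp
    then have "(\<integral>\<^sup>+x. ennreal (indicator {0..1} x * x powr a) \<partial>lborel) = ennreal (1 powr (a + 1) / (a + 1))"
      by (intro nn_integral_has_integral_lebesgue) auto
    then show ?thesis by simp
  qed
  have 2: "(\<integral>\<^sup>+x. ennreal (x powr b) * indicator {1<..} x \<partial>lborel) < \<infinity>"
  proof -
    have "(\<integral>\<^sup>+x. ennreal (x powr b) * indicator {1<..} x \<partial>lborel) = emeasure (power_measure (1 / (- b - 1)) (- b)) {1<..}"
      unfolding power_measure_def using assms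
      by (subst emeasure_density) (auto intro!: nn_integral_cong simp: indicator_def)
    also have "\<dots> < \<infinity>" using assms by (subst emeasure_power_measure_greaterThan) auto
    finally show ?thesis .
  qed
  have "(\<integral>\<^sup>+x. ennreal (if x \<le> 1 then x powr a else x powr b) * indicator {0<..} x \<partial>lborel) \<le>
      (\<integral>\<^sup>+x. (ennreal (indicator {0..1} x * x powr a) + ennreal (x powr b) * indicator {1<..} x) \<partial>lborel)"
    by (intro nn_integral_mono) (auto simp: indicator_def)
  also have "\<dots> = (\<integral>\<^sup>+x. ennreal (indicator {0..1} x * x powr a) \<partial>lborel) + (\<integral>\<^sup>+x. ennreal (x powr b) * indicator {1<..} x \<partial>lborel)"
    by (rule nn_integral_add) auto
  also have "\<dots> < \<infinity>" using 1 2 by simp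
  finally show ?thesis .
qed

text \<open>The majorant is a product, so the triple integral is at most the third power of an integral of one variable.\<close>

lemma triangle_integral_finite:
  assumes tau: "2 < \<tau>" "\<tau> < 3"
  shows "triangle_integral \<tau> < \<infinity>"
proof -
  let ?p = "\<lambda>x. ennreal (product_majorant \<tau> x)"
  let ?I = "\<integral>\<^sup>+x. ?p x * indicator {0<..} x \<partial>lborel"
  have [measurable]: "product_majorant \<tau> \<in> borel_measurable borel"
    unfolding product_majorant_def[abs_def] by measurable
  have I: "?I < \<infinity>"
    unfolding product_majorant_def by (rule nn_integral_powr_less_infinity) (use tau in auto)
  have z: "(\<integral>\<^sup>+z\<in>{0<..}. ennreal (triangle_integrand \<tau> x y z) \<partial>lborel) \<le> ?p x * (?p y * ?I)" if "0 < x" "0 < y" for x y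
  proof -
    have "(\<integral>\<^sup>+z\<in>{0<..}. ennreal (triangle_integrand \<tau> x y z) \<partial>lborel) \<le>
        (\<integral>\<^sup>+z. ?p x * ?p y * (?p z * indicator {0<..} z) \<partial>lborel)"
    proof (intro nn_integral_mono)
      fix z
      show "ennreal (triangle_integrand \<tau> x y z) * indicator {0<..} z \<le> ?p x * ?p y * (?p z * indicator {0<..} z)"
      proof (cases "0 < z")
        case True
        have "ennreal (triangle_integrand \<tau> x y z) \<le> ennreal (product_majorant \<tau> x * product_majorant \<tau> y * product_majorant \<tau> z)"
          by (intro ennreal_leI triangle_integrand_le_majorant tau that True)
        with True show ?thesis by (simp add: ennreal_mult product_majorant_nonneg)
      qed simp
    qed
    also have "\<dots> = ?p x * (?p y * ?I)" by (subst nn_integral_cmult) (auto simp: mult_ac)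
    finally show ?thesis .
  qed
  have y: "(\<integral>\<^sup>+y\<in>{0<..}. (\<integral>\<^sup>+z\<in>{0<..}. ennreal (triangle_integrand \<tau> x y z) \<partial>lborel) \<partial>lborel) \<le> ?p x * (?I * ?I)"
    if "0 < x" for x
  proof -
    have "(\<integral>\<^sup>+y\<in>{0<..}. (\<integral>\<^sup>+z\<in>{0<..}. ennreal (triangle_integrand \<tau> x y z) \<partial>lborel) \<partial>lborel) \<le>
        (\<integral>\<^sup>+y. ?p x * ?I * (?p y * indicator {0<..} y) \<partial>lborel)"
    proof (intro nn_integral_mono)
      fix y
      show "(\<integral>\<^sup>+z\<in>{0<..}. ennreal (triangle_integrand \<tau> x y z) \<partial>lborel) * indicator {0<..} y \<le> ?p x * ?I * (?p y * indicator {0<..} y)"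
        using z[OF that, of y] by (cases "0 < y") (auto simp: mult_ac)
    qed
    also have "\<dots> = ?p x * (?I * ?I)" by (subst nn_integral_cmult) (auto simp: mult_ac)
    finally show ?thesis .
  qed
  have "triangle_integral \<tau> \<le> (\<integral>\<^sup>+x. (?I * ?I) * (?p x * indicator {0<..} x) \<partial>lborel)"
    unfolding triangle_integral_def triangle_integrand_def[symmetric]
  proof (intro nn_integral_mono)
    fix x
    show "(\<integral>\<^sup>+y\<in>{0<..}. (\<integral>\<^sup>+z\<in>{0<..}. ennreal (triangle_integrand \<tau> x y z) \<partial>lborel) \<partial>lborel) * indicator {0<..} x
        \<le> (?I * ?I) * (?p x * indicator {0<..} x)"
      using y[of x] by (cases "0 < x") (auto simp: mult_ac)
  qed
  also have "\<dots> = ?I * ?I * ?I" by (subst nn_integral_cmult) auto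
  also have "\<dots> < \<infinity>" using I by (simp add: ennreal_mult_less_top)
  finally show ?thesis .
qed

lemma sigma_finite_power_measure: "sigma_finite_measure (power_measure k \<tau>)"
  unfolding power_measure_def 
  by (subst sigma_finite_measure.sigma_finite_iff_density_finite[OF lborel.sigma_finite_measure_axioms]) auto

lemma nn_integral_power_measure:
  assumes "f \<in> borel_measurable borel"
  shows "(\<integral>\<^sup>+x. f x \<partial>power_measure k \<tau>) =
    (\<integral>\<^sup>+x. ennreal (indicator {0<..} x * (k * (\<tau> - 1) * x powr (- \<tau>))) * f x \<partial>lborel)"
  unfolding power_measure_def using assms by (subst nn_integral_density) auto

definition limit_weight :: "real \<Rightarrow> real \<Rightarrow> real \<Rightarrow> real" where
  "limit_weight x y z = (if 0 < x \<and> 0 < y \<and> 0 < z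
     then prob_of_odds (x * y) * prob_of_odds (y * z) * prob_of_odds (x * z) else 0)"

lemma prob_of_odds_measurable [measurable]: "prob_of_odds \<in> borel_measurable borel"
  unfolding prob_of_odds_def[abs_def] by measurable

lemma limit_weight_measurable [measurable (raw)]:
  assumes [measurable]: "f \<in> borel_measurable M" "g \<in> borel_measurable M" "h \<in> borel_measurable M"
  shows "(\<lambda>p. limit_weight (f p) (g p) (h p)) \<in> borel_measurable M"
  unfolding limit_weight_def by measurable

lemma triangle_integrand_measurable [measurable (raw)]:
  assumes [measurable]: "f \<in> borel_measurable M" "g \<in> borel_measurable M" "h \<in> borel_measurable M"
  shows "(\<lambda>p. triangle_integrand \<tau> (f p) (g p) (h p)) \<in> borel_measurable M"
  unfolding triangle_integrand_def by measurable

text \<open>The factors \<open>x powr \<tau>\<close> cancel against the density of the power measure, which turns the limit of the triangle weights into the integrand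
of \<^const>\<open>triangle_integral\<close>.\<close>

lemma limit_weight_eq:
  assumes "0 < x" "0 < y" "0 < z"
  shows "limit_weight x y z = (x powr \<tau> * y powr \<tau> * z powr \<tau>) * triangle_integrand \<tau> x y z"
proof -
  have "(x * y * z) powr (2 - \<tau>) = x\<^sup>2 * y\<^sup>2 * z\<^sup>2 / (x powr \<tau> * y powr \<tau> * z powr \<tau>)"
    using assms by (simp add: powr_mult powr_diff field_simps powr_numeral)
  then have "(x powr \<tau> * y powr \<tau> * z powr \<tau>) * (x * y * z) powr (2 - \<tau>) = (x * y) * (y * z) * (x * z)"
    using assms by (simp add: power2_eq_square)
  moreover have "limit_weight x y z = (x * y) * (y * z) * (x * z) / ((1 + x * y) * (1 + y * z) * (1 + x * z))"
    using assms by (simp add: limit_weight_def prob_of_odds_def)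
  ultimately show ?thesis by (simp add: triangle_integrand_def)
qed

lemma integral_limit_weight:
  assumes tau: "1 < \<tau>" and k: "0 \<le> k"
  shows "(\<integral>\<^sup>+x. \<integral>\<^sup>+y. \<integral>\<^sup>+z. ennreal (limit_weight x y z) \<partial>power_measure k \<tau> \<partial>power_measure k \<tau> \<partial>power_measure k \<tau>)
    = ennreal ((k * (\<tau> - 1)) ^ 3) * triangle_integral \<tau>"
proof -
  let ?Z = "\<lambda>x y. \<integral>\<^sup>+z. ennreal (triangle_integrand \<tau> x y z) * indicator {0<..} z \<partial>lborel"
  let ?c = "k * (\<tau> - 1)" and ?T = "\<lambda>x y z. ennreal (triangle_integrand \<tau> x y z)" and ?i = "indicator {0<..} :: real \<Rightarrow> ennreal"
  let ?M = "power_measure k \<tau>"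
  interpret M: sigma_finite_measure ?M by (rule sigma_finite_power_measure)
  have c: "0 \<le> ?c" using tau k by simp
  have z: "(\<integral>\<^sup>+z. ennreal (limit_weight x y z) \<partial>?M) = ennreal (?c * x powr \<tau> * y powr \<tau>) * (\<integral>\<^sup>+z. ?T x y z * ?i z \<partial>lborel)"
    if "0 < x" "0 < y" for x y
  proof -
    have "(\<integral>\<^sup>+z. ennreal (limit_weight x y z) \<partial>?M) =
        (\<integral>\<^sup>+z. ennreal (indicator {0<..} z * (?c * z powr (- \<tau>))) * ennreal (limit_weight x y z) \<partial>lborel)"
      by (rule nn_integral_power_measure) measurable
    also have "\<dots> = (\<integral>\<^sup>+z. ennreal (?c * x powr \<tau> * y powr \<tau>) * (?T x y z * ?i z) \<partial>lborel)"
    proof (intro nn_integral_cong)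
      fix z
      show "ennreal (indicator {0<..} z * (?c * z powr (- \<tau>))) * ennreal (limit_weight x y z) =
          ennreal (?c * x powr \<tau> * y powr \<tau>) * (?T x y z * ?i z)"
      proof (cases "0 < z")
        case True
        have "?c * z powr (- \<tau>) * limit_weight x y z = ?c * x powr \<tau> * y powr \<tau> * triangle_integrand \<tau> x y z"
          using that True by (simp add: limit_weight_eq[of x y z \<tau>] powr_minus field_simps)
        then show ?thesis using True c that
          by (simp add: ennreal_mult'[symmetric] triangle_integrand_def)
      qed simp
    qed
    also have "\<dots> = ennreal (?c * x powr \<tau> * y powr \<tau>) * (\<integral>\<^sup>+z. ?T x y z * ?i z \<partial>lborel)"
      using that by (intro nn_integral_cmult) measurable
    finally show ?thesis .
  qed
  have y: "(\<integral>\<^sup>+y. \<integral>\<^sup>+z. ennreal (limit_weight x y z) \<partial>?M \<partial>?M) =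
      ennreal (?c\<^sup>2 * x powr \<tau>) * (\<integral>\<^sup>+y. (\<integral>\<^sup>+z. ?T x y z * ?i z \<partial>lborel) * ?i y \<partial>lborel)" if "0 < x" for x
  proof -
    have "(\<integral>\<^sup>+y. \<integral>\<^sup>+z. ennreal (limit_weight x y z) \<partial>?M \<partial>?M) =
        (\<integral>\<^sup>+y. ennreal (indicator {0<..} y * (?c * y powr (- \<tau>))) * (\<integral>\<^sup>+z. ennreal (limit_weight x y z) \<partial>?M) \<partial>lborel)"
      by (rule nn_integral_power_measure) measurable
    also have "\<dots> = (\<integral>\<^sup>+y. ennreal (?c\<^sup>2 * x powr \<tau>) * ((\<integral>\<^sup>+z. ?T x y z * ?i z \<partial>lborel) * ?i y) \<partial>lborel)"
    proof (intro nn_integral_cong)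
      fix y
      show "ennreal (indicator {0<..} y * (?c * y powr (- \<tau>))) * (\<integral>\<^sup>+z. ennreal (limit_weight x y z) \<partial>?M) =
          ennreal (?c\<^sup>2 * x powr \<tau>) * ((\<integral>\<^sup>+z. ?T x y z * ?i z \<partial>lborel) * ?i y)"
      proof (cases "0 < y")
        case True
        have "?c * y powr (- \<tau>) * (?c * x powr \<tau> * y powr \<tau>) = ?c\<^sup>2 * x powr \<tau>"
          using that True by (simp add: powr_minus field_simps power2_eq_square)
        then have "ennreal (?c * y powr (- \<tau>)) * ennreal (?c * x powr \<tau> * y powr \<tau>) = ennreal (?c\<^sup>2 * x powr \<tau>)"
          using c by (simp add: ennreal_mult'[symmetric])
        then show ?thesis using True that by (simp add: z mult.assoc[symmetric])
      qed simp
    qed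
    also have "\<dots> = ennreal (?c\<^sup>2 * x powr \<tau>) * (\<integral>\<^sup>+y. (\<integral>\<^sup>+z. ?T x y z * ?i z \<partial>lborel) * ?i y \<partial>lborel)"
      using that by (intro nn_integral_cmult) measurable
    finally show ?thesis .
  qed
  have "(\<integral>\<^sup>+x. \<integral>\<^sup>+y. \<integral>\<^sup>+z. ennreal (limit_weight x y z) \<partial>?M \<partial>?M \<partial>?M) =
      (\<integral>\<^sup>+x. ennreal (indicator {0<..} x * (?c * x powr (- \<tau>))) * (\<integral>\<^sup>+y. \<integral>\<^sup>+z. ennreal (limit_weight x y z) \<partial>?M \<partial>?M) \<partial>lborel)"
    by (rule nn_integral_power_measure) measurable
  also have "\<dots> = (\<integral>\<^sup>+x. ennreal (?c ^ 3) * ((\<integral>\<^sup>+y. (\<integral>\<^sup>+z. ?T x y z * ?i z \<partial>lborel) * ?i y \<partial>lborel) * ?i x) \<partial>lborel)"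
  proof (intro nn_integral_cong)
    fix x
    show "ennreal (indicator {0<..} x * (?c * x powr (- \<tau>))) * (\<integral>\<^sup>+y. \<integral>\<^sup>+z. ennreal (limit_weight x y z) \<partial>?M \<partial>?M) =
        ennreal (?c ^ 3) * ((\<integral>\<^sup>+y. (\<integral>\<^sup>+z. ?T x y z * ?i z \<partial>lborel) * ?i y \<partial>lborel) * ?i x)"
    proof (cases "0 < x")
      case True
      have "?c * x powr (- \<tau>) * (?c\<^sup>2 * x powr \<tau>) = ?c ^ 3"
        using True by (simp add: powr_minus field_simps power2_eq_square power3_eq_cube)
      then have "ennreal (?c * x powr (- \<tau>)) * ennreal (?c\<^sup>2 * x powr \<tau>) = ennreal (?c ^ 3)"
        using c by (simp add: ennreal_mult'[symmetric])
      then show ?thesis using True by (simp add: y mult.assoc[symmetric])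
    qed simp
  qed
  also have "\<dots> = ennreal (?c ^ 3) * (\<integral>\<^sup>+x. (\<integral>\<^sup>+y. (\<integral>\<^sup>+z. ?T x y z * ?i z \<partial>lborel) * ?i y \<partial>lborel) * ?i x \<partial>lborel)"
    by (intro nn_integral_cmult) measurable
  also have "(\<integral>\<^sup>+x. (\<integral>\<^sup>+y. (\<integral>\<^sup>+z. ?T x y z * ?i z \<partial>lborel) * ?i y \<partial>lborel) * ?i x \<partial>lborel) = triangle_integral \<tau>"
    by (simp add: triangle_integral_def triangle_integrand_def)
  finally show ?thesis .
qed

section \<open>Degree sequences with a power-law tail\<close>

text \<open>The hypotheses of the theorem with the constant \<open>K\<close> of the tail bound made explicit.\<close>

locale power_law_degrees =
  fixes \<tau> C \<mu> K :: real and d :: "nat \<Rightarrow> nat \<Rightarrow> nat" and D :: "nat pmf"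
  assumes tau_gt: "2 < \<tau>" and tau_lt: "\<tau> < 3" and C_pos: "0 < C" and K_pos: "0 < K"
    and degrees: "degree_sequences d"
    and tail_bound: "\<And>n j. 2 \<le> n \<Longrightarrow> j \<in> {1..max_degree n (d n)} \<Longrightarrow>
      1 - degree_cdf n (d n) j \<le> K * real j powr (1 - \<tau>)"
    and tail_asymp: "power_law_tail_asymp \<tau> C d"
    and power_law_D: "power_law \<tau> C D"
    and mu_eq: "\<mu> = measure_pmf.expectation D real"
begin

definition tail_count :: "nat \<Rightarrow> nat \<Rightarrow> nat" where
  "tail_count n j = card {i \<in> {1..n}. j < d n i}"

lemma tail_count_eq: "1 \<le> n \<Longrightarrow> real (tail_count n j) = real n * (1 - degree_cdf n (d n) j)"
proof -
  assume n: "1 \<le> n"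
  have "{1..n} = {i \<in> {1..n}. d n i \<le> j} \<union> {i \<in> {1..n}. j < d n i}" by auto
  then have "n = card ({i \<in> {1..n}. d n i \<le> j} \<union> {i \<in> {1..n}. j < d n i})"
    by (metis card_atLeastAtMost diff_Suc_1)
  also have "\<dots> = card {i \<in> {1..n}. d n i \<le> j} + tail_count n j"
    unfolding tail_count_def by (rule card_Un_disjoint) auto
  finally have "real n = real (card {i \<in> {1..n}. d n i \<le> j}) + real (tail_count n j)"
    by (metis of_nat_add)
  moreover have "degree_cdf n (d n) j = real (card {i \<in> {1..n}. d n i \<le> j}) / real n"
    using sum_of_bool_filter[of "{1..n}" "\<lambda>i. d n i \<le> j"] by (simp add: degree_cdf_def)
  ultimately show ?thesis using n by (simp add: field_simps)
qed

lemma degree_pos: "2 \<le> n \<Longrightarrow> i \<in> {1..n} \<Longrightarrow> 0 < d n i"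
  using degrees by (auto simp: degree_sequences_def degree_sequence_def)

lemma graphs_nonempty: "2 \<le> n \<Longrightarrow> graphs_with_degrees n (d n) \<noteq> {}"
  using degrees by (auto simp: degree_sequences_def degree_sequence_def)

lemma tail_count_0: "2 \<le> n \<Longrightarrow> tail_count n 0 = n"
proof -
  assume "2 \<le> n"
  then have "{i \<in> {1..n}. 0 < d n i} = {1..n}" using degree_pos by auto
  then show ?thesis by (simp add: tail_count_def)
qed

lemma tail_count_above_max: "max_degree n (d n) \<le> j \<Longrightarrow> tail_count n j = 0"
proof -
  assume "max_degree n (d n) \<le> j"
  then have "{i \<in> {1..n}. j < d n i} = {}" using degree_le_max_degree[of _ n "d n"] by fastforce
  then show ?thesis by (simp add: tail_count_def)
qed

lemma tail_count_le:
  assumes "2 \<le> n" "1 \<le> j"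
  shows "real (tail_count n j) \<le> real n * (K * real j powr (1 - \<tau>))"
proof (cases "j \<le> max_degree n (d n)")
  case True
  then have "1 - degree_cdf n (d n) j \<le> K * real j powr (1 - \<tau>)"
    using assms by (intro tail_bound) auto
  then show ?thesis using assms by (simp add: tail_count_eq mult_left_mono)
next
  case False
  then show ?thesis using K_pos by (simp add: tail_count_above_max)
qed

lemma tail_count_asymp:
  assumes b: "0 < b" and j: "\<forall>\<^sub>F n in sequentially. 1 \<le> j n \<and> real (j n) \<le> b * sqrt (real n)"
  shows "(\<lambda>n. real (tail_count n (j n)) / (real n * (C * real (j n) powr (1 - \<tau>)))) \<longlonglongrightarrow> 1"
proof -
  let ?S = "\<lambda>n. {j::nat. 1 \<le> j \<and> real j \<le> b * sqrt (real n)}"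
  let ?f = "\<lambda>n j. \<bar>(1 - degree_cdf n (d n) j) / (C * real j powr (1 - \<tau>)) - 1\<bar>"
  have lim: "(\<lambda>n. SUP j\<in>?S n. ?f n j) \<longlonglongrightarrow> 0"
    using tail_asymp b by (simp add: power_law_tail_asymp_def)
  have "\<forall>\<^sub>F n in sequentially.
      norm (real (tail_count n (j n)) / (real n * (C * real (j n) powr (1 - \<tau>))) - 1) \<le> (SUP j\<in>?S n. ?f n j)"
    using j eventually_ge_at_top[of 1]
  proof eventually_elim
    case (elim n)
    have fin: "finite (?S n)"
      by (rule finite_subset[of _ "{..nat \<lfloor>b * sqrt (real n)\<rfloor>}"]) (auto simp: le_nat_floor)
    have "?f n (j n) \<le> (SUP j\<in>?S n. ?f n j)"
      using elim fin by (intro cSUP_upper bdd_above_finite finite_imageI) auto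
    then show ?case using elim by (simp add: tail_count_eq)
  qed
  from Lim_null_comparison[OF this lim]
  show ?thesis by (rule Lim_null[THEN iffD2])
qed

definition tail_limit :: "nat \<Rightarrow> real" where
  "tail_limit j = (if j = 0 then 1 else C * real j powr (1 - \<tau>))"

lemma tail_fraction_tendsto: "(\<lambda>n. real (tail_count n j) / real n) \<longlonglongrightarrow> tail_limit j"
proof (cases "j = 0")
  case True
  have "\<forall>\<^sub>F n in sequentially. real (tail_count n j) / real n = 1"
    using eventually_ge_at_top[of 2] by eventually_elim (simp add: True tail_count_0)
  then show ?thesis by (simp add: True tail_limit_def tendsto_eventually)
next
  case False
  have "(\<lambda>n. real (tail_count n j) / (real n * (C * real j powr (1 - \<tau>)))) \<longlonglongrightarrow> 1"
  proof (rule tail_count_asymp[of "real j"])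
    show "0 < real j" using False by simp
    show "\<forall>\<^sub>F n in sequentially. 1 \<le> j \<and> real j \<le> real j * sqrt (real n)"
      using eventually_ge_at_top[of 1] by eventually_elim (use False in auto)
  qed
  from tendsto_mult_left[OF this, of "C * real j powr (1 - \<tau>)"]
  show ?thesis using False C_pos by (simp add: tail_limit_def)
qed

lemma summable_tail: "summable (\<lambda>j. c * real j powr (1 - \<tau>))"
  using tau_gt by (intro summable_mult) (simp add: summable_real_powr_iff)

lemma summable_tail_limit: "summable tail_limit"
proof -
  have "summable (\<lambda>j. tail_limit (Suc j))"
    using summable_tail[of C] by (subst (asm) summable_Suc_iff[symmetric]) (simp add: tail_limit_def)
  then show ?thesis by (rule summable_Suc_iff[THEN iffD1])
qed

lemma tail_limit_nonneg: "0 \<le> tail_limit j"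
  using C_pos by (simp add: tail_limit_def)

lemma prob_tail: "measure_pmf.prob D {k. j < k} = tail_limit j"
proof (cases "j = 0")
  case True
  have "measure_pmf.prob D {k. j < k} = 1"
    using power_law_D unfolding True power_law_def
    by (intro measure_pmf.prob_eq_1[THEN iffD2]) (auto simp: AE_measure_pmf_iff)
  then show ?thesis by (simp add: True tail_limit_def)
next
  case False
  then show ?thesis using power_law_D by (simp add: power_law_def tail_limit_def)
qed

text \<open>The expectation of a random variable with values in the natural numbers is the sum of its tail probabilities.\<close>

lemma mean_eq_suminf: "\<mu> = suminf tail_limit"
proof -
  have "(\<integral>\<^sup>+k. of_nat k \<partial>measure_pmf D) = (\<integral>\<^sup>+k. (\<Sum>j. indicator {k. j < k} k) \<partial>measure_pmf D)"
  proof (intro nn_integral_cong)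
    fix k :: nat
    have "(\<Sum>j. indicator {k. j < k} k :: ennreal) = (\<Sum>j\<in>{..<k}. indicator {k. j < k} k)"
      by (rule suminf_finite) auto
    also have "\<dots> = (\<Sum>j\<in>{..<k}. 1)" by (intro sum.cong) auto
    finally show "of_nat k = (\<Sum>j. indicator {k. j < k} k :: ennreal)" by simp
  qed
  also have "\<dots> = (\<Sum>j. \<integral>\<^sup>+k. indicator {k. j < k} k \<partial>measure_pmf D)"
    by (rule nn_integral_suminf) simp
  also have "\<dots> = (\<Sum>j. ennreal (tail_limit j))"
    by (simp add: measure_pmf.emeasure_eq_measure prob_tail)
  also have "\<dots> = ennreal (suminf tail_limit)"
    using summable_tail_limit tail_limit_nonneg by (intro suminf_ennreal2)
  finally have "(\<integral>\<^sup>+k. ennreal (real k) \<partial>measure_pmf D) = ennreal (suminf tail_limit)"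
    by (simp add: ennreal_of_nat_eq_real_of_nat)
  then show ?thesis
    unfolding mu_eq by (subst integral_eq_nn_integral) (auto simp: suminf_nonneg summable_tail_limit tail_limit_nonneg)
qed

lemma mean_ge_1: "1 \<le> \<mu>"
proof -
  have "sum tail_limit {0} \<le> suminf tail_limit"
    by (rule sum_le_suminf) (auto simp: summable_tail_limit tail_limit_nonneg)
  then show ?thesis by (simp add: mean_eq_suminf tail_limit_def)
qed

text \<open>Summation by parts: \<open>d n i = t + card {j. t \<le> j \<and> j < d n i}\<close> for \<open>d n i > t\<close>. The case \<open>t = 0\<close> expresses the
total degree by tail counts.\<close>

lemma sum_excess_eq:
  assumes M: "max_degree n (d n) \<le> M"
  shows "(\<Sum>i\<in>{i \<in> {1..n}. t < d n i}. d n i) = t * tail_count n t + (\<Sum>j\<in>{t..<M}. tail_count n j)"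
proof -
  have "(\<Sum>i\<in>{i \<in> {1..n}. t < d n i}. d n i) =
      (\<Sum>i\<in>{i \<in> {1..n}. t < d n i}. t + card {j \<in> {t..<M}. j < d n i})"
  proof (rule sum.cong)
    fix i assume i: "i \<in> {i \<in> {1..n}. t < d n i}"
    then have "d n i \<le> M" using degree_le_max_degree[of i n "d n"] M by simp
    then have "{j \<in> {t..<M}. j < d n i} = {t..<d n i}" by auto
    with i show "d n i = t + card {j \<in> {t..<M}. j < d n i}" by simp
  qed simp
  also have "\<dots> = t * tail_count n t + (\<Sum>i\<in>{i \<in> {1..n}. t < d n i}. card {j \<in> {t..<M}. j < d n i})"
    by (simp add: sum.distrib tail_count_def)
  also have "(\<Sum>i\<in>{i \<in> {1..n}. t < d n i}. card {j \<in> {t..<M}. j < d n i}) =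
      (\<Sum>i\<in>{1..n}. \<Sum>j\<in>{t..<M}. if j < d n i then 1 else 0)"
    by (rule sum.mono_neutral_cong_left) (auto simp: sum.If_cases Int_def)
  also have "\<dots> = (\<Sum>j\<in>{t..<M}. \<Sum>i\<in>{1..n}. if j < d n i then 1 else 0)"
    by (rule sum.swap)
  also have "\<dots> = (\<Sum>j\<in>{t..<M}. tail_count n j)"
    by (simp add: tail_count_def sum.If_cases Int_def)
  finally show ?thesis .
qed

lemma total_degree_eq_suminf:
  assumes "2 \<le> n"
  shows "real (total_degree n (d n)) = (\<Sum>j. real (tail_count n j))"
proof -
  let ?M = "max_degree n (d n)"
  have "{i \<in> {1..n}. 0 < d n i} = {1..n}" using degree_pos[OF assms] by auto
  then have "total_degree n (d n) = (\<Sum>j\<in>{0..<?M}. tail_count n j)"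
    using sum_excess_eq[of n ?M 0] by (simp add: total_degree_def)
  moreover have "(\<Sum>j. real (tail_count n j)) = (\<Sum>j\<in>{0..<?M}. real (tail_count n j))"
    by (rule suminf_finite) (auto simp: tail_count_above_max)
  ultimately show ?thesis by simp
qed

text \<open>The tail counts divided by \<open>n\<close> converge to the tail probabilities of \<open>D\<close>, and the tail bound provides the summable
majorant that Tannery's theorem requires.\<close>

lemma total_degree_tendsto: "(\<lambda>n. real (total_degree n (d n)) / real n) \<longlonglongrightarrow> \<mu>"
proof -
  let ?M = "\<lambda>j. if j = 0 then 1 else K * real j powr (1 - \<tau>)"
  have sM: "summable ?M"
  proof -
    have "summable (\<lambda>j. ?M (Suc j))"
      using summable_tail[of K] by (subst (asm) summable_Suc_iff[symmetric]) simp
    then show ?thesis by (rule summable_Suc_iff[THEN iffD1])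
  qed
  have bound: "norm (real (tail_count n j) / real n) \<le> ?M j" if "2 \<le> n" for n j
    using that tail_count_le[of n j] by (auto simp: tail_count_0 field_simps)
  have "\<forall>\<^sub>F (j, n) in at_top \<times>\<^sub>F sequentially. norm (real (tail_count n j) / real n) \<le> ?M j"
    using eventually_prodI[OF always_eventually[of "\<lambda>j. True"] eventually_ge_at_top[of 2]]
    by (rule eventually_mono) (use bound in auto)
  from tannerys_theorem[OF tail_fraction_tendsto this sM]
  have "(\<lambda>n. \<Sum>j. real (tail_count n j) / real n) \<longlonglongrightarrow> \<mu>"
    by (simp add: mean_eq_suminf)
  moreover have "\<forall>\<^sub>F n in sequentially. (\<Sum>j. real (tail_count n j) / real n) = real (total_degree n (d n)) / real n"
    using eventually_ge_at_top[of 2]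
  proof eventually_elim
    case (elim n)
    have "summable (\<lambda>j. real (tail_count n j))"
      by (rule summable_finite[of "{0..<max_degree n (d n)}"]) (auto simp: tail_count_above_max)
    then show ?case using elim by (simp add: suminf_divide total_degree_eq_suminf)
  qed
  ultimately show ?thesis by (rule Lim_transform_eventually)
qed

text \<open>This bounds, uniformly in \<open>n\<close>, the contribution of the degrees above \<open>t\<close> to the average degree. That it vanishes as \<open>t\<close> grows
is the uniform integrability of the degrees.\<close>

definition excess_bound :: "nat \<Rightarrow> real" where
  "excess_bound t = K * real t powr (2 - \<tau>) + (\<Sum>j. K * real (j + t) powr (1 - \<tau>))"

lemma sum_excess_le:
  assumes n: "2 \<le> n" and t: "1 \<le> t"
  shows "real (\<Sum>i\<in>{i \<in> {1..n}. t < d n i}. d n i) \<le> real n * excess_bound t"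
proof -
  define M where "M = max t (max_degree n (d n))"
  have "real (\<Sum>i\<in>{i \<in> {1..n}. t < d n i}. d n i) = real t * real (tail_count n t) + (\<Sum>j\<in>{t..<M}. real (tail_count n j))"
    using sum_excess_eq[of n M t] by (simp add: M_def)
  also have "\<dots> \<le> real t * (real n * (K * real t powr (1 - \<tau>))) + (\<Sum>j\<in>{t..<M}. real n * (K * real j powr (1 - \<tau>)))"
    using n t by (intro add_mono mult_left_mono sum_mono tail_count_le) auto
  also have "real t * (real n * (K * real t powr (1 - \<tau>))) = real n * (K * real t powr (2 - \<tau>))"
    using t by (simp add: powr_mult_base[symmetric] mult_ac) (simp add: powr_mult_base)
  also have "(\<Sum>j\<in>{t..<M}. real n * (K * real j powr (1 - \<tau>))) = real n * (\<Sum>j\<in>{0..<M - t}. K * real (j + t) powr (1 - \<tau>))"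
  proof -
    have "(\<Sum>j\<in>{t..<M}. K * real j powr (1 - \<tau>)) = (\<Sum>j\<in>{0..<M - t}. K * real (j + t) powr (1 - \<tau>))"
      using sum.shift_bounds_nat_ivl[of "\<lambda>j. K * real j powr (1 - \<tau>)" 0 t "M - t"] by (simp add: M_def)
    then show ?thesis by (subst sum_distrib_left[symmetric]) (simp only:)
  qed
  also have "(\<Sum>j\<in>{0..<M - t}. K * real (j + t) powr (1 - \<tau>)) \<le> (\<Sum>j. K * real (j + t) powr (1 - \<tau>))"
    using summable_ignore_initial_segment[OF summable_tail[of K], of t] K_pos by (intro sum_le_suminf) auto
  finally show ?thesis by (simp add: excess_bound_def distrib_left mult_left_mono)
qed

lemma excess_bound_nonneg: "0 \<le> excess_bound t"
  using K_pos summable_ignore_initial_segment[OF summable_tail[of K], of t]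
  by (simp add: excess_bound_def suminf_nonneg)

lemma excess_bound_tendsto: "excess_bound \<longlonglongrightarrow> 0"
proof -
  have "(\<lambda>t. K * real t powr (2 - \<tau>)) \<longlonglongrightarrow> K * 0"
    using tau_gt by (intro tendsto_mult tendsto_const tendsto_neg_powr filterlim_real_sequentially) auto
  moreover have "(\<lambda>t. \<Sum>j. K * real (j + t) powr (1 - \<tau>)) \<longlonglongrightarrow> 0"
    using suminf_exist_split2[OF summable_tail[of K]] by simp
  ultimately show ?thesis unfolding excess_bound_def[abs_def] using tendsto_add by fastforce
qed

lemma tendsto_0_by_truncation:
  fixes x :: "nat \<Rightarrow> real"
  assumes nonneg: "\<forall>\<^sub>F n in sequentially. 0 \<le> x n"
    and le: "\<And>t. 1 \<le> t \<Longrightarrow> \<forall>\<^sub>F n in sequentially. x n \<le> a t n + c * excess_bound t"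
    and a: "\<And>t. a t \<longlonglongrightarrow> 0"
  shows "x \<longlonglongrightarrow> 0"
proof (rule tendstoI)
  fix e :: real assume e: "0 < e"
  have "(\<lambda>t. c * excess_bound t) \<longlonglongrightarrow> c * 0" by (intro tendsto_mult tendsto_const excess_bound_tendsto)
  then have "\<forall>\<^sub>F t in sequentially. c * excess_bound t < e / 2" using e by (intro order_tendstoD(2)) auto
  then have "\<forall>\<^sub>F t in sequentially. c * excess_bound t < e / 2 \<and> 1 \<le> t"
    using eventually_ge_at_top[of 1] by eventually_elim auto
  then obtain t where t: "c * excess_bound t < e / 2" "1 \<le> t"
    using eventually_happens' sequentially_bot by blast
  have "\<forall>\<^sub>F n in sequentially. a t n < e / 2" using a[of t] e by (intro order_tendstoD(2)) auto
  with le[OF t(2)] nonneg show "\<forall>\<^sub>F n in sequentially. dist (x n) 0 < e"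
    by eventually_elim (use t in auto)
qed

lemma max_degree_tendsto: "(\<lambda>n. real (max_degree n (d n)) / real n) \<longlonglongrightarrow> 0"
proof (rule tendsto_0_by_truncation[where a = "\<lambda>t n. real t / real n" and c = 1])
  fix t :: nat assume t: "1 \<le> t"
  show "\<forall>\<^sub>F n in sequentially. real (max_degree n (d n)) / real n \<le> real t / real n + 1 * excess_bound t"
    using eventually_ge_at_top[of 2]
  proof eventually_elim
    case (elim n)
    have "max_degree n (d n) \<in> d n ` {1..n}" unfolding max_degree_def using elim by (intro Max_in) auto
    then obtain i where i: "i \<in> {1..n}" "max_degree n (d n) = d n i" by auto
    have "d n i \<le> t + (\<Sum>i\<in>{i \<in> {1..n}. t < d n i}. d n i)"
    proof (cases "t < d n i")
      case True
      then show ?thesis using i member_le_sum[of i "{i \<in> {1..n}. t < d n i}" "d n"] by simp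
    qed simp
    then have "real (max_degree n (d n)) \<le> real t + real n * excess_bound t"
      using sum_excess_le[OF elim t] i(2) by linarith
    then show ?case using elim by (simp add: field_simps)
  qed
qed (auto intro: lim_const_over_n)

text \<open>Among at most \<open>max_degree + 1 = o(n)\<close> vertices, those of degree at most \<open>t\<close> contribute \<open>o(n)\<close> for fixed \<open>t\<close>, and the others at most \<open>n * excess_bound t\<close>.\<close>

lemma top_degree_sum_tendsto: "(\<lambda>n. real (top_degree_sum n (d n)) / real n) \<longlonglongrightarrow> 0"
proof (rule tendsto_0_by_truncation[where a = "\<lambda>t n. real t * (real (max_degree n (d n)) / real n + 1 / real n)" and c = 1])
  fix t :: nat
  have "(\<lambda>n. real t * (real (max_degree n (d n)) / real n + 1 / real n)) \<longlonglongrightarrow> real t * (0 + 0)"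
    by (intro tendsto_mult tendsto_const tendsto_add max_degree_tendsto lim_const_over_n)
  then show "(\<lambda>n. real t * (real (max_degree n (d n)) / real n + 1 / real n)) \<longlonglongrightarrow> 0" by simp
  assume t: "1 \<le> t"
  show "\<forall>\<^sub>F n in sequentially. real (top_degree_sum n (d n)) / real n \<le>
      real t * (real (max_degree n (d n)) / real n + 1 / real n) + 1 * excess_bound t"
    using eventually_ge_at_top[of 2]
  proof eventually_elim
    case (elim n)
    let ?F = "{W. W \<subseteq> {1..n} \<and> card W \<le> max_degree n (d n) + 1}"
    have "finite ?F" by (rule finite_subset[of _ "Pow {1..n}"]) auto
    moreover have "{} \<in> ?F" by simp
    ultimately have "top_degree_sum n (d n) \<in> (\<lambda>W. \<Sum>i\<in>W. d n i) ` ?F"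
      unfolding top_degree_sum_def by (intro Max_in) auto
    then obtain W where W: "W \<subseteq> {1..n}" "card W \<le> max_degree n (d n) + 1" "top_degree_sum n (d n) = (\<Sum>i\<in>W. d n i)"
      by auto
    have fW: "finite W" using W(1) finite_subset by blast
    have "(\<Sum>i\<in>W. d n i) \<le> (\<Sum>i\<in>W. t + (if t < d n i then d n i else 0))" by (intro sum_mono) auto
    also have "\<dots> = t * card W + (\<Sum>i\<in>W \<inter> {i. t < d n i}. d n i)"
      using fW by (simp add: sum.distrib sum.If_cases)
    also have "\<dots> \<le> t * (max_degree n (d n) + 1) + (\<Sum>i\<in>{i \<in> {1..n}. t < d n i}. d n i)"
      using W by (intro add_mono mult_left_mono sum_mono2) auto
    finally have "real (top_degree_sum n (d n)) \<le> real (t * (max_degree n (d n) + 1) + (\<Sum>i\<in>{i \<in> {1..n}. t < d n i}. d n i))"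
      unfolding W(3) by (rule of_nat_mono)
    also have "\<dots> \<le> real t * (real (max_degree n (d n)) + 1) + real n * excess_bound t"
      using sum_excess_le[OF elim t] by (simp add: algebra_simps)
    finally show ?case using elim by (simp add: field_simps)
  qed
qed auto

lemma switch_volume_tendsto: "(\<lambda>n. switch_volume n (d n) / real n) \<longlonglongrightarrow> \<mu>"
proof -
  have "(\<lambda>n. real (total_degree n (d n)) / real n - 2 * (real (top_degree_sum n (d n)) / real n) - 12 / real n) \<longlonglongrightarrow> \<mu> - 2 * 0 - 0"
    by (intro tendsto_diff tendsto_mult tendsto_const total_degree_tendsto top_degree_sum_tendsto lim_const_over_n)
  then show ?thesis by (simp add: switch_volume_def diff_divide_distrib)
qed

lemma eventually_switch_volume_pos: "\<forall>\<^sub>F n in sequentially. 0 < switch_volume n (d n)"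
proof -
  have "\<forall>\<^sub>F n in sequentially. 0 < switch_volume n (d n) / real n"
    using switch_volume_tendsto mean_ge_1 by (intro order_tendstoD(1)) auto
  then show ?thesis by eventually_elim (auto simp: zero_less_divide_iff)
qed

text \<open>For two vertices of degree at most \<open>t\<close> the odds are at most \<open>t\<^sup>2 / switch_volume\<close>. Pairs with a vertex of larger degree have small weight by
uniform integrability.\<close>

lemma connection_rate_tendsto: "(\<lambda>n. connection_rate n (d n)) \<longlonglongrightarrow> 0"
proof -
  let ?L = "\<lambda>n. real (total_degree n (d n))" and ?B = "\<lambda>n. switch_volume n (d n)"
  define a where "a t n = (?L n / real n)\<^sup>2 / (?B n / real n) ^ 3 * (real t ^ 2 / real n)" for t n
  define q where "q n = 2 * (?L n / real n) / (?B n / real n)\<^sup>2" for n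
  have q: "q \<longlonglongrightarrow> 2 * \<mu> / \<mu>\<^sup>2" unfolding q_def using mean_ge_1
    by (intro tendsto_intros total_degree_tendsto switch_volume_tendsto) auto
  have q_le: "\<forall>\<^sub>F n in sequentially. q n < 2 * \<mu> / \<mu>\<^sup>2 + 1"
    by (rule order_tendstoD(2)[OF q]) simp
  show ?thesis
  proof (rule tendsto_0_by_truncation[where a = a and c = "2 * \<mu> / \<mu>\<^sup>2 + 1"])
    fix t :: nat
    have "a t \<longlonglongrightarrow> \<mu>\<^sup>2 / \<mu> ^ 3 * 0" unfolding a_def using mean_ge_1
      by (intro tendsto_intros total_degree_tendsto switch_volume_tendsto lim_const_over_n) auto
    then show "a t \<longlonglongrightarrow> 0" by simp
    assume t: "1 \<le> t"
    show "\<forall>\<^sub>F n in sequentially. connection_rate n (d n) \<le> a t n + (2 * \<mu> / \<mu>\<^sup>2 + 1) * excess_bound t"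
      using eventually_switch_volume_pos q_le eventually_ge_at_top[of 2]
    proof eventually_elim
      case (elim n)
      let ?V = "{1..n}" and ?H = "real (\<Sum>i\<in>{i \<in> {1..n}. t < d n i}. d n i)"
      let ?d = "\<lambda>x. real (d n x)" and ?h = "\<lambda>x. of_bool (t < d n x) :: real"
      have B: "0 < ?B n" using elim by simp
      have L: "(\<Sum>x\<in>?V. ?d x) = ?L n" by (simp add: total_degree_def)
      have H: "(\<Sum>x\<in>?V. ?d x * ?h x) = ?H"
        by (simp add: of_bool_def if_distrib sum.If_cases Int_def cong: if_cong)
      \<comment> \<open>A probability is at most one, which is used as soon as one of the two degrees exceeds \<open>t\<close>.\<close>
      have g: "prob_of_odds (?d x * ?d y / ?B n) \<le> real t ^ 2 / ?B n + ?h x + ?h y" for x y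
      proof (cases "t < d n x \<or> t < d n y")
        case True
        have "prob_of_odds (?d x * ?d y / ?B n) \<le> 1" using B by (intro prob_of_odds_le_1) simp
        moreover have "0 \<le> real t ^ 2 / ?B n" using B by simp
        ultimately show ?thesis using True by (auto simp: of_bool_def)
      next
        case False
        have "prob_of_odds (?d x * ?d y / ?B n) \<le> ?d x * ?d y / ?B n" using B by (intro prob_of_odds_le) simp
        also have "\<dots> \<le> real t * real t / ?B n" using B False by (intro divide_right_mono mult_mono) auto
        finally show ?thesis using False by (simp add: power2_eq_square)
      qed
      have "(\<Sum>x\<in>?V. \<Sum>y\<in>?V. ?d x * ?d y * prob_of_odds (?d x * ?d y / ?B n)) \<le>
          (\<Sum>x\<in>?V. \<Sum>y\<in>?V. ?d x * ?d y * (real t ^ 2 / ?B n + ?h x + ?h y))"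
        using g by (intro sum_mono mult_left_mono) auto
      also have "\<dots> = (\<Sum>x\<in>?V. \<Sum>y\<in>?V. real t ^ 2 / ?B n * (?d x * ?d y) + (?d x * ?h x) * ?d y + ?d x * (?d y * ?h y))"
        by (simp add: algebra_simps)
      also have "\<dots> = real t ^ 2 / ?B n * (?L n * ?L n) + ?H * ?L n + ?L n * ?H"
        by (simp only: sum.distrib sum_product[symmetric] sum_distrib_left[symmetric] sum_distrib_right[symmetric] L H)
      finally have "connection_rate n (d n) \<le> (real t ^ 2 / ?B n * (?L n * ?L n) + ?H * ?L n + ?L n * ?H) / (?B n)\<^sup>2"
        unfolding connection_rate_def by (intro divide_right_mono) auto
      also have "\<dots> \<le> (real t ^ 2 / ?B n * (?L n * ?L n) + (real n * excess_bound t) * ?L n + ?L n * (real n * excess_bound t)) / (?B n)\<^sup>2"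
        using sum_excess_le[OF elim(3) t] B
        by (intro divide_right_mono add_mono mult_left_mono mult_right_mono) auto
      also have "\<dots> = a t n + q n * excess_bound t"
        unfolding a_def q_def using elim B by (simp add: field_simps power2_eq_square power3_eq_cube)
      also have "\<dots> \<le> a t n + (2 * \<mu> / \<mu>\<^sup>2 + 1) * excess_bound t"
        using elim excess_bound_nonneg[of t] by (intro add_left_mono mult_right_mono) auto
      finally show ?case .
    qed
  next
    show "\<forall>\<^sub>F n in sequentially. 0 \<le> connection_rate n (d n)"
      using eventually_switch_volume_pos
      by eventually_elim (auto simp: connection_rate_def intro!: divide_nonneg_nonneg sum_nonneg mult_nonneg_nonneg prob_of_odds_nonneg)
  qed
qed

end

section \<open>Degrees as quantiles of the power measure\<close>

lemma initial_segment_card: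
  fixes S :: "nat set"
  assumes fin: "finite S" and down: "\<And>i j. j \<in> S \<Longrightarrow> i \<le> j \<Longrightarrow> i \<in> S"
  shows "j < card S \<longleftrightarrow> j \<in> S"
proof -
  define m where "m = (LEAST j. j \<notin> S)"
  have "\<exists>j. j \<notin> S" using fin by (metis ex_new_if_finite infinite_UNIV_nat)
  then have m: "m \<notin> S" unfolding m_def by (rule LeastI_ex)
  have "S = {..<m}"
  proof
    show "S \<subseteq> {..<m}" using down m by (metis leI lessThan_iff subsetI)
    show "{..<m} \<subseteq> S" unfolding m_def using not_less_Least by blast
  qed
  then show ?thesis by simp
qed

context power_law_degrees
begin

text \<open>With this constant the tail \<open>hub_const * x powr (1 - \<tau>)\<close> of the power measure is the limit of the number of vertices of
degree above \<open>x * sqrt (\<mu> * n)\<close>, divided by \<open>hub_scale n\<close>.\<close>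

definition hub_const :: real where "hub_const = C * \<mu> powr ((1 - \<tau>) / 2)"

definition hub_scale :: "nat \<Rightarrow> real" where "hub_scale n = real n powr ((3 - \<tau>) / 2)"

abbreviation \<nu> :: "real measure" where "\<nu> \<equiv> power_measure hub_const \<tau>"

text \<open>The generalized inverse of the tail counts: \<open>quantile n x\<close> exceeds \<open>j\<close> exactly if the power measure of \<open>{x<..}\<close> is less than \<open>tail_count n j / hub_scale n\<close>. It vanishes for \<open>x \<le> 0\<close>, where
the power measure has no mass.\<close>

definition quantile :: "nat \<Rightarrow> real \<Rightarrow> nat" where
  "quantile n x = (if x \<le> 0 then 0 else card {j. hub_const * x powr (1 - \<tau>) * hub_scale n < real (tail_count n j)})"

lemma hub_const_pos: "0 < hub_const"
  using C_pos mean_ge_1 by (simp add: hub_const_def)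

lemma hub_scale_pos: "1 \<le> n \<Longrightarrow> 0 < hub_scale n"
  by (simp add: hub_scale_def)

lemma tail_count_antimono: "j \<le> j' \<Longrightarrow> tail_count n j' \<le> tail_count n j"
  unfolding tail_count_def by (intro card_mono) auto

lemma less_quantile_iff:
  assumes "0 < x" "1 \<le> n"
  shows "j < quantile n x \<longleftrightarrow> hub_const * x powr (1 - \<tau>) * hub_scale n < real (tail_count n j)"
proof -
  let ?S = "{j. hub_const * x powr (1 - \<tau>) * hub_scale n < real (tail_count n j)}"
  have "?S \<subseteq> {..<max_degree n (d n)}"
  proof
    fix j assume "j \<in> ?S"
    moreover have "0 \<le> hub_const * x powr (1 - \<tau>) * hub_scale n" using hub_const_pos hub_scale_pos[OF assms(2)] by simp
    ultimately have "tail_count n j \<noteq> 0" by auto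
    then show "j \<in> {..<max_degree n (d n)}" using tail_count_above_max by (metis leI lessThan_iff)
  qed
  then have "finite ?S" using finite_subset by blast
  moreover have "i \<in> ?S" if "j \<in> ?S" "i \<le> j" for i j
    using that tail_count_antimono[OF that(2), of n] by simp
  ultimately have "j < card ?S \<longleftrightarrow> j \<in> ?S" by (rule initial_segment_card)
  then show ?thesis using assms by (simp add: quantile_def)
qed

lemma quantile_nonpos: "x \<le> 0 \<Longrightarrow> quantile n x = 0"
  by (simp add: quantile_def)

lemma mono_quantile:
  assumes n: "1 \<le> n"
  shows "mono (\<lambda>x. real (quantile n x))"
proof (rule monoI)
  fix x y :: real assume xy: "x \<le> y"
  show "real (quantile n x) \<le> real (quantile n y)"
  proof (cases "0 < x")
    case True
    have "j < quantile n y" if "j < quantile n x" for j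
    proof -
      have "y powr (1 - \<tau>) \<le> x powr (1 - \<tau>)" using True xy tau_gt by (intro powr_mono2') auto
      then have "hub_const * y powr (1 - \<tau>) * hub_scale n \<le> hub_const * x powr (1 - \<tau>) * hub_scale n"
        using hub_const_pos hub_scale_pos[OF n] by (intro mult_right_mono mult_left_mono) auto
      then show ?thesis using that True xy n by (simp add: less_quantile_iff)
    qed
    then show ?thesis by (meson leI less_irrefl of_nat_le_iff)
  qed (simp add: quantile_nonpos)
qed

lemma quantile_measurable: "1 \<le> n \<Longrightarrow> (\<lambda>x. real (quantile n x)) \<in> borel_measurable borel"
  by (intro borel_measurable_mono mono_quantile)

lemma emeasure_less_quantile:
  assumes n: "1 \<le> n"
  shows "emeasure \<nu> {x. j < quantile n x} = ennreal (real (tail_count n j) / hub_scale n)"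
proof (cases "tail_count n j = 0")
  case True
  have "\<not> j < quantile n x" for x
  proof (cases "0 < x")
    case pos: True
    have "0 \<le> hub_const * x powr (1 - \<tau>) * hub_scale n" using hub_const_pos hub_scale_pos[OF n] by simp
    then show ?thesis using True pos n by (simp add: less_quantile_iff)
  qed (simp add: quantile_nonpos)
  then show ?thesis using True by simp
next
  case False
  define c where "c = real (tail_count n j) / (hub_const * hub_scale n)"
  define y where "y = c powr (1 / (1 - \<tau>))"
  have c: "0 < c" using False hub_const_pos hub_scale_pos[OF n] by (simp add: c_def)
  have y: "0 < y" "y powr (1 - \<tau>) = c" using c tau_gt by (simp_all add: y_def powr_powr)
  have "j < quantile n x \<longleftrightarrow> y < x" for x
  proof (cases "0 < x")
    case True
    have "j < quantile n x \<longleftrightarrow> x powr (1 - \<tau>) < y powr (1 - \<tau>)"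
      using True n hub_const_pos hub_scale_pos[OF n] by (simp add: less_quantile_iff y c_def field_simps)
    also have "\<dots> \<longleftrightarrow> y < x"
    proof (cases "x \<le> y")
      case le: True
      have "y powr (1 - \<tau>) \<le> x powr (1 - \<tau>)" using True le tau_gt by (intro powr_mono2') auto
      then show ?thesis using le by simp
    next
      case gt: False
      then have "x powr (1 - \<tau>) < y powr (1 - \<tau>)" using y(1) tau_gt by (intro powr_less_mono2_neg) auto
      then show ?thesis using gt by simp
    qed
    finally show ?thesis .
  next
    case False
    then show ?thesis using y(1) by (simp add: quantile_nonpos)
  qed
  then have "{x. j < quantile n x} = {y<..}" by auto
  then have "emeasure \<nu> {x. j < quantile n x} = ennreal (hub_const * c)"
    using y tau_gt hub_const_pos by (simp add: emeasure_power_measure_greaterThan)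
  also have "hub_const * c = real (tail_count n j) / hub_scale n" using hub_const_pos by (simp add: c_def)
  finally show ?thesis .
qed

lemma emeasure_quantile_eq:
  assumes n: "1 \<le> n" and m: "1 \<le> m"
  shows "emeasure \<nu> {x. quantile n x = m} = ennreal (real (card {i \<in> {1..n}. d n i = m}) / hub_scale n)"
proof -
  let ?A = "\<lambda>j. {x. j < quantile n x}"
  have meas: "?A j \<in> sets \<nu>" for j
  proof -
    have "?A j = {x \<in> space borel. real j < real (quantile n x)}" by simp
    also have "\<dots> \<in> sets borel" using quantile_measurable[OF n] by measurable
    finally show ?thesis by simp
  qed
  have "{x. quantile n x = m} = ?A (m - 1) - ?A m" using m by auto
  then have "emeasure \<nu> {x. quantile n x = m} = emeasure \<nu> (?A (m - 1) - ?A m)" by simp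
  also have "\<dots> = emeasure \<nu> (?A (m - 1)) - emeasure \<nu> (?A m)"
    by (rule emeasure_Diff) (use meas in \<open>auto simp: emeasure_less_quantile[OF n]\<close>)
  also have "\<dots> = ennreal (real (tail_count n (m - 1)) / hub_scale n - real (tail_count n m) / hub_scale n)"
    using hub_scale_pos[OF n] by (simp add: emeasure_less_quantile[OF n] ennreal_minus)
  also have "real (tail_count n (m - 1)) / hub_scale n - real (tail_count n m) / hub_scale n =
      real (card {i \<in> {1..n}. d n i = m}) / hub_scale n"
  proof -
    have "{i \<in> {1..n}. m - 1 < d n i} = {i \<in> {1..n}. d n i = m} \<union> {i \<in> {1..n}. m < d n i}" using m by auto
    then have "tail_count n (m - 1) = card {i \<in> {1..n}. d n i = m} + tail_count n m"
      unfolding tail_count_def by (simp only:) (rule card_Un_disjoint; auto)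
    then show ?thesis by (simp add: diff_divide_distrib[symmetric])
  qed
  finally show ?thesis .
qed

text \<open>The quantile takes each value \<open>m > 0\<close> on a set whose measure is the number of vertices of degree \<open>m\<close>, divided by
\<open>hub_scale n\<close>. The value \<open>0\<close> is taken on a set of infinite measure, which is why \<open>f 0 = 0\<close> is required.\<close>

lemma nn_integral_quantile:
  assumes n: "2 \<le> n" and [measurable]: "f \<in> borel_measurable borel" and f0: "f 0 = (0 :: ennreal)"
  shows "(\<integral>\<^sup>+x. f (real (quantile n x)) \<partial>\<nu>) = (\<Sum>i\<in>{1..n}. f (real (d n i))) * ennreal (1 / hub_scale n)"
proof -
  have n1: "1 \<le> n" using n by simp
  let ?M = "max_degree n (d n)"
  have [measurable]: "(\<lambda>x. real (quantile n x)) \<in> borel_measurable borel" by (rule quantile_measurable[OF n1])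
  have le: "quantile n x \<le> ?M" for x
  proof (cases "0 < x")
    case True
    have "\<not> ?M < quantile n x"
    proof -
      have "0 \<le> hub_const * x powr (1 - \<tau>) * hub_scale n" using hub_const_pos hub_scale_pos[OF n1] by simp
      then show ?thesis using True n1 tail_count_above_max[of n ?M] by (simp add: less_quantile_iff)
    qed
    then show ?thesis by simp
  qed (simp add: quantile_nonpos)
  have meas: "{x. quantile n x = m} \<in> sets \<nu>" for m
  proof -
    have "{x. quantile n x = m} = {x \<in> space borel. real (quantile n x) = real m}" by simp
    also have "\<dots> \<in> sets borel" by measurable
    finally show ?thesis by simp
  qed
  have "f (real (quantile n x)) = (\<Sum>m\<in>{1..?M}. f (real m) * indicator {x. quantile n x = m} x)" for x
  proof (cases "quantile n x = 0")
    case True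
    then have "(\<Sum>m\<in>{1..?M}. f (real m) * indicator {x. quantile n x = m} x) = 0"
      by (intro sum.neutral) (auto simp: indicator_def)
    then show ?thesis using True f0 by simp
  next
    case False
    then have "(\<Sum>m\<in>{1..?M}. f (real m) * indicator {x. quantile n x = m} x) =
        (\<Sum>m\<in>{1..?M}. if m = quantile n x then f (real m) else 0)"
      by (intro sum.cong) (auto simp: indicator_def)
    also have "\<dots> = f (real (quantile n x))" using False le[of x] by (simp add: Suc_le_eq)
    finally show ?thesis by simp
  qed
  then have "(\<integral>\<^sup>+x. f (real (quantile n x)) \<partial>\<nu>) =
      (\<integral>\<^sup>+x. (\<Sum>m\<in>{1..?M}. f (real m) * indicator {x. quantile n x = m} x) \<partial>\<nu>)"
    by (intro nn_integral_cong) simp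
  also have "\<dots> = (\<Sum>m\<in>{1..?M}. \<integral>\<^sup>+x. f (real m) * indicator {x. quantile n x = m} x \<partial>\<nu>)"
    using meas by (intro nn_integral_sum) auto
  also have "\<dots> = (\<Sum>m\<in>{1..?M}. f (real m) * emeasure \<nu> {x. quantile n x = m})"
    using meas by (intro sum.cong nn_integral_cmult_indicator) auto
  also have "\<dots> = (\<Sum>m\<in>{1..?M}. (\<Sum>i\<in>{i \<in> {1..n}. d n i = m}. f (real (d n i))) * ennreal (1 / hub_scale n))"
  proof (rule sum.cong)
    fix m assume m: "m \<in> {1..?M}"
    have "(\<Sum>i\<in>{i \<in> {1..n}. d n i = m}. f (real (d n i))) = (\<Sum>i\<in>{i \<in> {1..n}. d n i = m}. f (real m))"
      by (intro sum.cong) auto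
    also have "\<dots> = of_nat (card {i \<in> {1..n}. d n i = m}) * f (real m)" by simp
    finally show "f (real m) * emeasure \<nu> {x. quantile n x = m} =
        (\<Sum>i\<in>{i \<in> {1..n}. d n i = m}. f (real (d n i))) * ennreal (1 / hub_scale n)"
      using m n1 hub_scale_pos[OF n1]
      by (simp add: emeasure_quantile_eq ennreal_of_nat_eq_real_of_nat ennreal_mult'[symmetric] mult_ac)
  qed simp
  also have "\<dots> = (\<Sum>m\<in>{1..?M}. \<Sum>i\<in>{i \<in> {1..n}. d n i = m}. f (real (d n i))) * ennreal (1 / hub_scale n)"
    by (simp add: sum_distrib_right)
  also have "(\<Sum>m\<in>{1..?M}. \<Sum>i\<in>{i \<in> {1..n}. d n i = m}. f (real (d n i))) = (\<Sum>i\<in>{1..n}. f (real (d n i)))"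
    using degree_pos[OF n] degree_le_max_degree[of _ n "d n"] by (intro sum.group) (auto simp: Suc_le_eq)
  finally show ?thesis .
qed

lemma nn_integral_quantile_triple:
  fixes F :: "real \<Rightarrow> real \<Rightarrow> real \<Rightarrow> ennreal"
  assumes n: "2 \<le> n"
    and F [measurable (raw)]: "\<And>f g h M. f \<in> borel_measurable M \<Longrightarrow> g \<in> borel_measurable M \<Longrightarrow> h \<in> borel_measurable M \<Longrightarrow>
      (\<lambda>p :: real. F (f p) (g p) (h p)) \<in> borel_measurable M"
    and F0: "\<And>a b. F 0 a b = 0" "\<And>a b. F a 0 b = 0" "\<And>a b. F a b 0 = 0"
  shows "(\<integral>\<^sup>+x. \<integral>\<^sup>+y. \<integral>\<^sup>+z. F (real (quantile n x)) (real (quantile n y)) (real (quantile n z)) \<partial>\<nu> \<partial>\<nu> \<partial>\<nu>) =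
    (\<Sum>i\<in>{1..n}. \<Sum>j\<in>{1..n}. \<Sum>l\<in>{1..n}. F (real (d n i)) (real (d n j)) (real (d n l))) * ennreal (1 / hub_scale n) ^ 3"
proof -
  let ?q = "\<lambda>x. real (quantile n x)"
  let ?s = "ennreal (1 / hub_scale n)" and ?d = "\<lambda>i. real (d n i)"
  have "(\<integral>\<^sup>+x. \<integral>\<^sup>+y. \<integral>\<^sup>+z. F (?q x) (?q y) (?q z) \<partial>\<nu> \<partial>\<nu> \<partial>\<nu>) =
      (\<integral>\<^sup>+x. \<integral>\<^sup>+y. (\<Sum>l\<in>{1..n}. F (?q x) (?q y) (?d l)) * ?s \<partial>\<nu> \<partial>\<nu>)"
    by (intro nn_integral_cong nn_integral_quantile n F0) measurable
  also have "\<dots> = (\<integral>\<^sup>+x. (\<Sum>j\<in>{1..n}. (\<Sum>l\<in>{1..n}. F (?q x) (?d j) (?d l)) * ?s) * ?s \<partial>\<nu>)"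
  proof (intro nn_integral_cong)
    fix x
    show "(\<integral>\<^sup>+y. (\<Sum>l\<in>{1..n}. F (?q x) (?q y) (?d l)) * ?s \<partial>\<nu>) =
        (\<Sum>j\<in>{1..n}. (\<Sum>l\<in>{1..n}. F (?q x) (?d j) (?d l)) * ?s) * ?s"
      by (rule nn_integral_quantile[OF n, of "\<lambda>b. (\<Sum>l\<in>{1..n}. F (?q x) b (?d l)) * ?s"])
         (simp_all add: F0)
  qed
  also have "\<dots> = (\<Sum>i\<in>{1..n}. (\<Sum>j\<in>{1..n}. (\<Sum>l\<in>{1..n}. F (?d i) (?d j) (?d l)) * ?s) * ?s) * ?s"
    by (rule nn_integral_quantile[OF n, of "\<lambda>a. (\<Sum>j\<in>{1..n}. (\<Sum>l\<in>{1..n}. F a (?d j) (?d l)) * ?s) * ?s"])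
       (simp_all add: F0)
  also have "\<dots> = (\<Sum>i\<in>{1..n}. \<Sum>j\<in>{1..n}. \<Sum>l\<in>{1..n}. F (?d i) (?d j) (?d l)) * ?s ^ 3"
    by (simp only: sum_distrib_right[symmetric] power3_eq_cube mult.assoc)
  finally show ?thesis .
qed

end

section \<open>Convergence of the triangle weights\<close>

text \<open>This turns a bound for the degrees up to a constant factor into a bound for the edge probabilities up to a constant
factor.\<close>

lemma prob_of_odds_le_scaled:
  assumes "0 \<le> a" "a \<le> c * t" "1 \<le> c" "0 \<le> t"
  shows "prob_of_odds a \<le> c * prob_of_odds t"
proof -
  have "prob_of_odds a \<le> prob_of_odds (c * t)"
    using assms by (simp add: prob_of_odds_def divide_simps algebra_simps)
  also have "\<dots> = c * t / (1 + c * t)" by (simp add: prob_of_odds_def)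
  also have "\<dots> \<le> c * t / (1 + t)"
  proof (rule divide_left_mono)
    have "1 * t \<le> c * t" using assms by (intro mult_right_mono) auto
    then show "1 + t \<le> 1 + c * t" by simp
  qed (use assms in \<open>auto intro!: mult_pos_pos add_pos_nonneg\<close>)
  finally show ?thesis by (simp add: prob_of_odds_def)
qed

lemma nn_integral_power_measure_triple:
  assumes [measurable]: "f \<in> borel_measurable (power_measure k \<tau> \<Otimes>\<^sub>M power_measure k \<tau> \<Otimes>\<^sub>M power_measure k \<tau>)"
  shows "integral\<^sup>N (power_measure k \<tau> \<Otimes>\<^sub>M power_measure k \<tau> \<Otimes>\<^sub>M power_measure k \<tau>) f =
    (\<integral>\<^sup>+x. \<integral>\<^sup>+y. \<integral>\<^sup>+z. f (x, y, z) \<partial>power_measure k \<tau> \<partial>power_measure k \<tau> \<partial>power_measure k \<tau>)"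
proof -
  let ?M = "power_measure k \<tau>"
  interpret M: sigma_finite_measure ?M by (rule sigma_finite_power_measure)
  interpret MM: pair_sigma_finite ?M ?M ..
  have "integral\<^sup>N (?M \<Otimes>\<^sub>M ?M \<Otimes>\<^sub>M ?M) f = (\<integral>\<^sup>+x. \<integral>\<^sup>+p. f (x, p) \<partial>(?M \<Otimes>\<^sub>M ?M) \<partial>?M)"
    by (rule MM.nn_integral_fst[symmetric]) measurable
  also have "\<dots> = (\<integral>\<^sup>+x. \<integral>\<^sup>+y. \<integral>\<^sup>+z. f (x, y, z) \<partial>?M \<partial>?M \<partial>?M)"
    by (intro nn_integral_cong M.nn_integral_fst[symmetric]) measurable
  finally show ?thesis .
qed

lemma sqrt_n_at_top: "filterlim (\<lambda>n. sqrt (real n)) at_top sequentially"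
  by (rule filterlim_compose[OF sqrt_at_top filterlim_real_sequentially])

context power_law_degrees
begin

lemma n_over_hub_scale: "1 \<le> n \<Longrightarrow> real n / hub_scale n = sqrt (real n) powr (\<tau> - 1)"
proof -
  assume n: "1 \<le> n"
  have "real n / hub_scale n = real n powr (1 - (3 - \<tau>) / 2)"
    using n by (simp add: hub_scale_def powr_diff)
  also have "1 - (3 - \<tau>) / 2 = 1 / 2 * (\<tau> - 1)" by (simp add: field_simps)
  also have "real n powr (1 / 2 * (\<tau> - 1)) = (real n powr (1 / 2)) powr (\<tau> - 1)" by (simp add: powr_powr)
  finally show ?thesis by (simp add: powr_half_sqrt)
qed

lemma floor_sqrt_tendsto:
  assumes "0 < y"
  shows "(\<lambda>n. real (nat \<lfloor>y * sqrt (real n)\<rfloor>) / sqrt (real n)) \<longlonglongrightarrow> y"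
proof (rule tendsto_sandwich)
  show "\<forall>\<^sub>F n in sequentially. y - 1 / sqrt (real n) \<le> real (nat \<lfloor>y * sqrt (real n)\<rfloor>) / sqrt (real n)"
    using eventually_ge_at_top[of 1]
  proof eventually_elim
    case (elim n)
    have "y * sqrt (real n) - 1 \<le> real (nat \<lfloor>y * sqrt (real n)\<rfloor>)" by linarith
    then have "(y * sqrt (real n) - 1) / sqrt (real n) \<le> real (nat \<lfloor>y * sqrt (real n)\<rfloor>) / sqrt (real n)"
      by (intro divide_right_mono) auto
    moreover have "(y * sqrt (real n) - 1) / sqrt (real n) = y - 1 / sqrt (real n)"
      using elim by (simp add: field_simps)
    ultimately show ?case by simp
  qed
  show "\<forall>\<^sub>F n in sequentially. real (nat \<lfloor>y * sqrt (real n)\<rfloor>) / sqrt (real n) \<le> y"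
    using eventually_ge_at_top[of 1]
  proof eventually_elim
    case (elim n)
    have "real (nat \<lfloor>y * sqrt (real n)\<rfloor>) \<le> y * sqrt (real n)" using assms by (intro of_nat_floor) simp
    then show ?case using elim by (simp add: field_simps)
  qed
  have "(\<lambda>n. y - 1 / sqrt (real n)) \<longlonglongrightarrow> y - 0"
    by (intro tendsto_diff tendsto_const tendsto_divide_0[OF tendsto_const] filterlim_at_top_imp_at_infinity sqrt_n_at_top)
  then show "(\<lambda>n. y - 1 / sqrt (real n)) \<longlonglongrightarrow> y" by simp
qed auto

lemma hub_tail_tendsto:
  assumes y: "0 < y"
  shows "(\<lambda>n. real (tail_count n (nat \<lfloor>y * sqrt (real n)\<rfloor>)) / hub_scale n) \<longlonglongrightarrow> C * y powr (1 - \<tau>)"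
proof -
  let ?j = "\<lambda>n. nat \<lfloor>y * sqrt (real n)\<rfloor>"
  have "filterlim (\<lambda>n. y * sqrt (real n)) at_top sequentially" 
    by (intro filterlim_tendsto_pos_mult_at_top[OF tendsto_const y] sqrt_n_at_top)
  then have ge: "\<forall>\<^sub>F n in sequentially. 1 \<le> y * sqrt (real n)" by (simp add: filterlim_at_top)
  have j: "\<forall>\<^sub>F n in sequentially. 1 \<le> ?j n \<and> real (?j n) \<le> y * sqrt (real n)"
    using ge by eventually_elim (use y in \<open>auto simp: le_nat_iff intro!: of_nat_floor\<close>)
  have "(\<lambda>n. real (tail_count n (?j n)) / (real n * (C * real (?j n) powr (1 - \<tau>))) *
      (C * (real (?j n) / sqrt (real n)) powr (1 - \<tau>))) \<longlonglongrightarrow> 1 * (C * y powr (1 - \<tau>))"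
    using y by (intro tendsto_mult tendsto_const tendsto_powr tail_count_asymp[OF y j] floor_sqrt_tendsto) auto
  then have lim: "(\<lambda>n. real (tail_count n (?j n)) / (real n * (C * real (?j n) powr (1 - \<tau>))) *
      (C * (real (?j n) / sqrt (real n)) powr (1 - \<tau>))) \<longlonglongrightarrow> C * y powr (1 - \<tau>)" by simp
  have "\<forall>\<^sub>F n in sequentially. real (tail_count n (?j n)) / (real n * (C * real (?j n) powr (1 - \<tau>))) *
      (C * (real (?j n) / sqrt (real n)) powr (1 - \<tau>)) = real (tail_count n (?j n)) / hub_scale n"
    using j eventually_ge_at_top[of 1]
  proof eventually_elim
    case (elim n)
    have "(real (?j n) / sqrt (real n)) powr (1 - \<tau>) = real (?j n) powr (1 - \<tau>) * (real n / hub_scale n)"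
      using elim powr_minus[of "sqrt (real n)" "\<tau> - 1"]
      by (simp add: powr_divide n_over_hub_scale field_simps)
    moreover have "T / (m * (C * P)) * (C * (P * (m / h))) = T / h"
      if "0 < m" "0 < P" "0 < h" for T m P h :: real
      using that C_pos by (simp add: field_simps)
    moreover have "0 < real (?j n) powr (1 - \<tau>)" using elim by (subst powr_gt_zero) linarith
    ultimately show ?case using elim hub_scale_pos[OF elim(2)] by simp
  qed
  from Lim_transform_eventually[OF lim this] show ?thesis .
qed

text \<open>The quantile exceeds \<open>y * sqrt n\<close> if the tail count there, divided by \<open>hub_scale n\<close>, is larger than \<open>hub_const * x powr (1 - \<tau>)\<close>. As the former converges to
\<open>C * y powr (1 - \<tau>)\<close>, this is eventually the case for \<open>y < x * sqrt \<mu>\<close>, and eventually not the case for \<open>y > x * sqrt \<mu>\<close>.\<close>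

lemma quantile_tendsto:
  assumes x: "0 < x"
  shows "(\<lambda>n. real (quantile n x) / sqrt (real n)) \<longlonglongrightarrow> x * sqrt \<mu>"
proof -
  have mu: "0 < \<mu>" using mean_ge_1 by simp
  have key: "C * (x * sqrt \<mu>) powr (1 - \<tau>) = hub_const * x powr (1 - \<tau>)"
    using mu x by (simp add: powr_mult hub_const_def powr_half_sqrt[symmetric] powr_powr)
  show ?thesis
  proof (rule order_tendstoI)
    fix a assume a: "a < x * sqrt \<mu>"
    have "max a 0 < x * sqrt \<mu>" using a x mu by simp
    then obtain y where y: "max a 0 < y" "y < x * sqrt \<mu>" using dense by blast
    have y0: "0 < y" "a < y" using y by auto
    have "hub_const * x powr (1 - \<tau>) < C * y powr (1 - \<tau>)"
      unfolding key[symmetric] using y y0 C_pos tau_gt by (intro mult_strict_left_mono powr_less_mono2_neg) auto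
    then have "\<forall>\<^sub>F n in sequentially. hub_const * x powr (1 - \<tau>) < real (tail_count n (nat \<lfloor>y * sqrt (real n)\<rfloor>)) / hub_scale n"
      by (rule order_tendstoD(1)[OF hub_tail_tendsto[OF y0(1)]])
    then show "\<forall>\<^sub>F n in sequentially. a < real (quantile n x) / sqrt (real n)"
      using eventually_ge_at_top[of 1]
    proof eventually_elim
      case (elim n)
      have "nat \<lfloor>y * sqrt (real n)\<rfloor> < quantile n x"
        using elim x hub_scale_pos[OF elim(2)] by (simp add: less_quantile_iff field_simps)
      then have "y * sqrt (real n) \<le> real (quantile n x)" by linarith
      moreover have "a * sqrt (real n) < y * sqrt (real n)" using y0 elim by simp
      ultimately have "a * sqrt (real n) < real (quantile n x)" by linarith
      then show ?case using elim by (simp add: pos_less_divide_eq)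
    qed
  next
    fix a assume a: "x * sqrt \<mu> < a"
    then obtain y where y: "x * sqrt \<mu> < y" "y < a" using dense by blast
    have xm: "0 < x * sqrt \<mu>" using x mu by simp
    have y0: "0 < y" using y xm by linarith
    have "C * y powr (1 - \<tau>) < hub_const * x powr (1 - \<tau>)"
      unfolding key[symmetric] using y xm C_pos tau_gt by (intro mult_strict_left_mono powr_less_mono2_neg) auto
    then have "\<forall>\<^sub>F n in sequentially. real (tail_count n (nat \<lfloor>y * sqrt (real n)\<rfloor>)) / hub_scale n < hub_const * x powr (1 - \<tau>)"
      by (rule order_tendstoD(2)[OF hub_tail_tendsto[OF y0]])
    then show "\<forall>\<^sub>F n in sequentially. real (quantile n x) / sqrt (real n) < a"
      using eventually_ge_at_top[of 1]
    proof eventually_elim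
      case (elim n)
      have "\<not> nat \<lfloor>y * sqrt (real n)\<rfloor> < quantile n x"
        using elim x hub_scale_pos[OF elim(2)] by (simp add: less_quantile_iff field_simps)
      moreover have "real (nat \<lfloor>y * sqrt (real n)\<rfloor>) \<le> y * sqrt (real n)" using y0 by (intro of_nat_floor) simp
      ultimately have "real (quantile n x) \<le> y * sqrt (real n)" by linarith
      moreover have "y * sqrt (real n) < a * sqrt (real n)" using y elim by simp
      ultimately have "real (quantile n x) < a * sqrt (real n)" by linarith
      then show ?case using elim by (simp add: pos_divide_less_eq)
    qed
  qed
qed

lemma quantile_le_linear:
  "\<exists>\<kappa>>0. \<forall>n\<ge>2. \<forall>x>0. real (quantile n x) \<le> \<kappa> * sqrt (real n) * x"
proof -
  define K' where "K' = max K 1"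
  define c where "c = (K' / hub_const) powr (1 / (\<tau> - 1))"
  have K': "0 < K'" "K \<le> K'" "1 \<le> K'" by (auto simp: K'_def)
  have c: "0 < c" "c powr (\<tau> - 1) = K' / hub_const"
    using K' hub_const_pos tau_gt by (auto simp: c_def powr_powr)
  have "real (quantile n x) \<le> 2 * c * sqrt (real n) * x" if n: "2 \<le> n" and x: "0 < x" for n x
  proof (cases "quantile n x = 0")
    case True
    then show ?thesis using c x by simp
  next
    case False
    let ?q = "quantile n x"
    have n1: "1 \<le> n" using n by simp
    \<comment> \<open>The tail bound is available at \<open>a = ?q - 1\<close>, which has to be positive; for \<open>?q = 1\<close> the value \<open>a = 1\<close> serves, as \<open>K' \<ge> 1\<close>.\<close>
    have "\<exists>a\<ge>1. real ?q \<le> 2 * a \<and> hub_const * x powr (1 - \<tau>) * hub_scale n < real n * (K' * a powr (1 - \<tau>))"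
    proof (cases "?q = 1")
      case True
      then have "hub_const * x powr (1 - \<tau>) * hub_scale n < real (tail_count n 0)"
        using less_quantile_iff[OF x n1, of 0] by simp
      also have "\<dots> \<le> real n * (K' * 1 powr (1 - \<tau>))"
        using tail_count_0[OF n] mult_left_mono[OF K'(3), of "real n"] by simp
      finally show ?thesis using True by (intro exI[of _ 1]) auto
    next
      case q: False
      have "hub_const * x powr (1 - \<tau>) * hub_scale n < real (tail_count n (?q - 1))"
        using less_quantile_iff[OF x n1, of "?q - 1"] False by simp
      also have "\<dots> \<le> real n * (K * real (?q - 1) powr (1 - \<tau>))"
        using q False by (intro tail_count_le n) auto
      also have "\<dots> \<le> real n * (K' * real (?q - 1) powr (1 - \<tau>))"
        using K' by (intro mult_left_mono mult_right_mono) auto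
      finally show ?thesis using q False by (intro exI[of _ "real (?q - 1)"]) auto
    qed
    then obtain a where a: "1 \<le> a" "real ?q \<le> 2 * a"
      "hub_const * x powr (1 - \<tau>) * hub_scale n < real n * (K' * a powr (1 - \<tau>))" by auto
    have inv: "w powr (1 - \<tau>) = 1 / w powr (\<tau> - 1)" for w :: real
      using powr_minus_divide[of w "\<tau> - 1"] by simp
    have "a powr (\<tau> - 1) < K' / hub_const * (real n / hub_scale n) * x powr (\<tau> - 1)"
      using a(1,3) x hub_const_pos hub_scale_pos[OF n1] by (simp add: inv field_simps)
    also have "\<dots> = (c * sqrt (real n) * x) powr (\<tau> - 1)"
      using c x by (simp add: n_over_hub_scale[OF n1] powr_mult)
    finally have "a < c * sqrt (real n) * x"
      using powr_less_cancel2[of "\<tau> - 1" a "c * sqrt (real n) * x"] a(1) c x tau_gt n by simp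
    then show ?thesis using a(2) by (simp add: mult.assoc)
  qed
  then show ?thesis using c by (intro exI[of _ "2 * c"]) simp
qed

text \<open>The sum over triples is a triple integral of the weight at the quantiles, to which dominated convergence applies; the
bound is a multiple of the limit itself. Degrees below a threshold \<open>\<omega>\<close> of smaller order than \<open>sqrt n\<close> may be dropped without changing the limit, since
the quantile at each \<open>x > 0\<close> eventually exceeds \<open>\<omega>\<close>.\<close>

lemma weight_sum_tendsto:
  assumes \<theta>: "(\<lambda>n. \<theta> n / real n) \<longlonglongrightarrow> \<mu>"
    and \<omega>: "(\<lambda>n. \<omega> n / sqrt (real n)) \<longlonglongrightarrow> 0" and \<omega>_nonneg: "\<And>n. 0 \<le> \<omega> n"
  shows "(\<lambda>n. (\<Sum>t\<in>triples {i \<in> {1..n}. \<omega> n < real (d n i)}. triangle_weight (\<theta> n) (d n) t) / hub_scale n ^ 3)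
    \<longlonglongrightarrow> (hub_const * (\<tau> - 1)) ^ 3 * enn2real (triangle_integral \<tau>)"
proof -
  let ?q = "\<lambda>n x. real (quantile n x)"
  define F where "F n a b c = (if \<omega> n < a \<and> \<omega> n < b \<and> \<omega> n < c
    then prob_of_odds (a * b / \<theta> n) * prob_of_odds (b * c / \<theta> n) * prob_of_odds (a * c / \<theta> n) else 0)" for n and a b c :: real
  let ?S = "\<lambda>n. \<Sum>t\<in>triples {i \<in> {1..n}. \<omega> n < real (d n i)}. triangle_weight (\<theta> n) (d n) t"
  let ?P = "\<nu> \<Otimes>\<^sub>M \<nu> \<Otimes>\<^sub>M \<nu>"
  have "\<forall>\<^sub>F n in sequentially. 1 / 2 < \<theta> n / real n"
    using mean_ge_1 by (intro order_tendstoD(1)[OF \<theta>]) auto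
  then have "\<forall>\<^sub>F n in sequentially. 2 \<le> n \<and> real n \<le> 2 * \<theta> n"
    using eventually_ge_at_top[of 2] by eventually_elim (auto simp: field_simps)
  \<comment> \<open>The weights are well behaved only from some \<open>n0\<close> on; the sequence is shifted by \<open>n0\<close> at the end.\<close>
  then obtain n0 where n0: "\<And>n. n0 \<le> n \<Longrightarrow> 2 \<le> n \<and> real n \<le> 2 * \<theta> n"
    by (auto simp: eventually_at_top_linorder)
  have F_nonneg: "0 \<le> F n a b c" if "n0 \<le> n" for n a b c
  proof -
    have "0 < \<theta> n" using n0[OF that] by linarith
    then show ?thesis using \<omega>_nonneg[of n] unfolding F_def
      by (auto intro!: mult_nonneg_nonneg prob_of_odds_nonneg divide_nonneg_nonneg)
  qed
  have F_meas [measurable (raw)]: "(\<lambda>p. F n (f p) (g p) (h p)) \<in> borel_measurable M"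
    if [measurable]: "f \<in> borel_measurable M" "g \<in> borel_measurable M" "h \<in> borel_measurable M" for n f g h and M :: "'b measure"
    unfolding F_def by measurable
  have F0: "F n 0 a b = 0" "F n a 0 b = 0" "F n a b 0 = 0" for n a b
    using \<omega>_nonneg[of n] by (auto simp: F_def)
  have sum_F: "(\<Sum>i\<in>{1..n}. \<Sum>j\<in>{1..n}. \<Sum>l\<in>{1..n}. F n (real (d n i)) (real (d n j)) (real (d n l))) = ?S n" for n
  proof -
    have "(\<Sum>i\<in>{1..n}. \<Sum>j\<in>{1..n}. \<Sum>l\<in>{1..n}. F n (real (d n i)) (real (d n j)) (real (d n l))) =
        (\<Sum>(i, j, l)\<in>triples {1..n}. F n (real (d n i)) (real (d n j)) (real (d n l)))"
      by (simp add: triples_def sum.cartesian_product)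
    also have "\<dots> = ?S n"
      by (rule sum.mono_neutral_cong_right) (auto simp: triples_def F_def triangle_weight_def split: if_split_asm)
    finally show ?thesis .
  qed
  define U where "U n = (\<lambda>(x, y, z). ennreal (F n (?q n x) (?q n y) (?q n z)))" for n
  define V where "V = (\<lambda>(x, y, z). ennreal (limit_weight x y z))"
  obtain \<kappa> where \<kappa>: "0 < \<kappa>" "\<And>n x. 2 \<le> n \<Longrightarrow> 0 < x \<Longrightarrow> ?q n x \<le> \<kappa> * sqrt (real n) * x"
    using quantile_le_linear by auto
  define c where "c = max 1 (2 * \<kappa>\<^sup>2)"
  have c1: "1 \<le> c" by (simp add: c_def)
  have U_meas: "U n \<in> borel_measurable ?P" if "n0 \<le> n" for n
  proof -
    have n1: "1 \<le> n" using n0[OF that] by simp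
    have [measurable]: "(\<lambda>x. ?q n x) \<in> borel_measurable \<nu>"
      using quantile_measurable[OF n1] by (simp cong: measurable_cong_sets)
    show ?thesis unfolding U_def by measurable
  qed
  have V_meas [measurable]: "V \<in> borel_measurable ?P" unfolding V_def by measurable
  have U_int: "integral\<^sup>N ?P (U n) = ennreal (?S n / hub_scale n ^ 3)" if "n0 \<le> n" for n
  proof -
    have n: "2 \<le> n" and n1: "1 \<le> n" using n0[OF that] by auto
    have "integral\<^sup>N ?P (U n) = (\<integral>\<^sup>+x. \<integral>\<^sup>+y. \<integral>\<^sup>+z. ennreal (F n (?q n x) (?q n y) (?q n z)) \<partial>\<nu> \<partial>\<nu> \<partial>\<nu>)"
      by (subst nn_integral_power_measure_triple[OF U_meas[OF that]]) (simp add: U_def)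
    also have "\<dots> = (\<Sum>i\<in>{1..n}. \<Sum>j\<in>{1..n}. \<Sum>l\<in>{1..n}. ennreal (F n (real (d n i)) (real (d n j)) (real (d n l)))) * ennreal (1 / hub_scale n) ^ 3"
      by (rule nn_integral_quantile_triple[OF n, of "\<lambda>a b c. ennreal (F n a b c)"]) (simp_all add: F0)
    also have "(\<Sum>i\<in>{1..n}. \<Sum>j\<in>{1..n}. \<Sum>l\<in>{1..n}. ennreal (F n (real (d n i)) (real (d n j)) (real (d n l)))) = ennreal (?S n)"
      unfolding sum_F[symmetric] using F_nonneg[OF that] by (simp add: sum_nonneg)
    also have "ennreal (?S n) * ennreal (1 / hub_scale n) ^ 3 = ennreal (?S n / hub_scale n ^ 3)"
    proof -
      have "0 \<le> ?S n" unfolding sum_F[symmetric] by (intro sum_nonneg F_nonneg that)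
      then show ?thesis using hub_scale_pos[OF n1]
        by (simp add: ennreal_power ennreal_mult[symmetric] power_one_over)
    qed
    finally show ?thesis .
  qed
  have V_int: "integral\<^sup>N ?P V = ennreal ((hub_const * (\<tau> - 1)) ^ 3) * triangle_integral \<tau>"
  proof -
    have "integral\<^sup>N ?P V = (\<integral>\<^sup>+x. \<integral>\<^sup>+y. \<integral>\<^sup>+z. ennreal (limit_weight x y z) \<partial>\<nu> \<partial>\<nu> \<partial>\<nu>)"
      by (subst nn_integral_power_measure_triple[OF V_meas]) (simp add: V_def)
    also have "\<dots> = ennreal ((hub_const * (\<tau> - 1)) ^ 3) * triangle_integral \<tau>"
      using tau_gt hub_const_pos by (intro integral_limit_weight) auto
    finally show ?thesis .
  qed
  have I: "triangle_integral \<tau> < \<infinity>" by (rule triangle_integral_finite[OF tau_gt tau_lt])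
  have bound: "U n p \<le> ennreal (c ^ 3) * V p" if n: "n0 \<le> n" for n p
  proof -
    obtain x y z where p: "p = (x, y, z)" by (cases p)
    show ?thesis
    proof (cases "0 < x \<and> 0 < y \<and> 0 < z")
      case True
      have \<theta>_pos: "0 < \<theta> n" using n0[OF n] by linarith
      have pair: "prob_of_odds (?q n v * ?q n w / \<theta> n) \<le> c * prob_of_odds (v * w)"
        if vw: "0 < v" "0 < w" for v w
      proof (rule prob_of_odds_le_scaled)
        have "?q n v * ?q n w \<le> (\<kappa> * sqrt (real n) * v) * (\<kappa> * sqrt (real n) * w)"
          using \<kappa> vw n0[OF n] by (intro mult_mono) auto
        also have "\<dots> = \<kappa>\<^sup>2 * (v * w) * (sqrt (real n) * sqrt (real n))" by (simp add: power2_eq_square mult_ac)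
        also have "\<dots> = \<kappa>\<^sup>2 * (v * w) * real n" by simp
        also have "\<dots> \<le> \<kappa>\<^sup>2 * (v * w) * (2 * \<theta> n)" using n0[OF n] vw by (intro mult_left_mono) auto
        finally have "?q n v * ?q n w / \<theta> n \<le> 2 * \<kappa>\<^sup>2 * (v * w)"
          using \<theta>_pos by (simp add: field_simps)
        also have "\<dots> \<le> c * (v * w)" using vw by (intro mult_right_mono) (auto simp: c_def)
        finally show "?q n v * ?q n w / \<theta> n \<le> c * (v * w)" .
      qed (use vw \<theta>_pos c1 in auto)
      have nn: "0 \<le> prob_of_odds (?q n v * ?q n w / \<theta> n)" for v w
        using \<theta>_pos by (intro prob_of_odds_nonneg) simp
      have nn': "0 \<le> prob_of_odds (v * w)" if "0 < v" "0 < w" for v w using that by (intro prob_of_odds_nonneg) simp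
      have "F n (?q n x) (?q n y) (?q n z) \<le>
          prob_of_odds (?q n x * ?q n y / \<theta> n) *
          prob_of_odds (?q n y * ?q n z / \<theta> n) *
          prob_of_odds (?q n x * ?q n z / \<theta> n)"
        using nn by (simp add: F_def)
      also have "\<dots> \<le> (c * prob_of_odds (x * y)) * (c * prob_of_odds (y * z)) * (c * prob_of_odds (x * z))"
        using True nn nn' c1 by (intro mult_mono pair mult_nonneg_nonneg) auto
      also have "\<dots> = c ^ 3 * limit_weight x y z"
        using True by (simp add: limit_weight_def power3_eq_cube mult_ac)
      finally have "ennreal (F n (?q n x) (?q n y) (?q n z)) \<le> ennreal (c ^ 3 * limit_weight x y z)"
        by (rule ennreal_leI)
      then show ?thesis using c1 by (simp add: p U_def V_def ennreal_mult')
    next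
      case False
      then have "quantile n x = 0 \<or> quantile n y = 0 \<or> quantile n z = 0" using quantile_nonpos by force
      then have "U n p = 0" using F0 by (auto simp: p U_def)
      then show ?thesis by simp
    qed
  qed
  have pointwise: "(\<lambda>n. U n p) \<longlonglongrightarrow> V p" for p
  proof -
    obtain x y z where p: "p = (x, y, z)" by (cases p)
    show ?thesis
    proof (cases "0 < x \<and> 0 < y \<and> 0 < z")
      case True
      have mu: "0 < \<mu>" using mean_ge_1 by simp
      have pair: "(\<lambda>n. prob_of_odds (?q n v * ?q n w / \<theta> n)) \<longlonglongrightarrow> prob_of_odds (v * w)"
        if vw: "0 < v" "0 < w" for v w
      proof -
        have "(\<lambda>n. (?q n v / sqrt (real n)) * (?q n w / sqrt (real n)) / (\<theta> n / real n))
            \<longlonglongrightarrow> (v * sqrt \<mu>) * (w * sqrt \<mu>) / \<mu>"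
          using mu by (intro tendsto_divide tendsto_mult quantile_tendsto \<theta> vw) auto
        moreover have "(v * sqrt \<mu>) * (w * sqrt \<mu>) / \<mu> = v * w"
          using mu by (simp add: field_simps)
        moreover have "\<forall>\<^sub>F n in sequentially. (?q n v / sqrt (real n)) * (?q n w / sqrt (real n)) / (\<theta> n / real n)
            = ?q n v * ?q n w / \<theta> n"
          using eventually_ge_at_top[of 1] by eventually_elim (auto simp: field_simps)
        ultimately have "(\<lambda>n. ?q n v * ?q n w / \<theta> n) \<longlonglongrightarrow> v * w"
          using Lim_transform_eventually by fastforce
        moreover have "1 + v * w \<noteq> 0" using vw by (simp add: add_pos_pos less_imp_neq[symmetric])
        ultimately show ?thesis unfolding prob_of_odds_def by (intro tendsto_intros)
      qed
      have ind: "\<forall>\<^sub>F n in sequentially. \<omega> n < ?q n v" if v: "0 < v" for v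
      proof -
        have "(\<lambda>n. ?q n v / sqrt (real n) - \<omega> n / sqrt (real n)) \<longlonglongrightarrow> v * sqrt \<mu> - 0"
          by (intro tendsto_diff quantile_tendsto \<omega> v)
        then have "\<forall>\<^sub>F n in sequentially. 0 < ?q n v / sqrt (real n) - \<omega> n / sqrt (real n)"
          by (rule order_tendstoD(1)) (use v mu in simp)
        then show ?thesis using eventually_ge_at_top[of 1]
          by eventually_elim (auto simp: diff_divide_distrib[symmetric] zero_less_divide_iff)
      qed
      have "(\<lambda>n. prob_of_odds (?q n x * ?q n y / \<theta> n) *
          prob_of_odds (?q n y * ?q n z / \<theta> n) *
          prob_of_odds (?q n x * ?q n z / \<theta> n)) \<longlonglongrightarrow>
          prob_of_odds (x * y) * prob_of_odds (y * z) * prob_of_odds (x * z)"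
        using True by (intro tendsto_mult pair) auto
      moreover have "\<forall>\<^sub>F n in sequentially. prob_of_odds (?q n x * ?q n y / \<theta> n) *
          prob_of_odds (?q n y * ?q n z / \<theta> n) *
          prob_of_odds (?q n x * ?q n z / \<theta> n) =
          F n (?q n x) (?q n y) (?q n z)"
        using ind[OF conjunct1[OF True]] ind[OF conjunct1[OF conjunct2[OF True]]] ind[OF conjunct2[OF conjunct2[OF True]]]
        by eventually_elim (simp add: F_def)
      ultimately have "(\<lambda>n. F n (?q n x) (?q n y) (?q n z)) \<longlonglongrightarrow>
          prob_of_odds (x * y) * prob_of_odds (y * z) * prob_of_odds (x * z)"
        by (rule Lim_transform_eventually)
      then have "(\<lambda>n. F n (?q n x) (?q n y) (?q n z)) \<longlonglongrightarrow> limit_weight x y z"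
        using True by (simp add: limit_weight_def)
      then show ?thesis by (simp add: p U_def V_def tendsto_ennrealI)
    next
      case False
      have "U n p = 0" for n
      proof -
        have "quantile n x = 0 \<or> quantile n y = 0 \<or> quantile n z = 0" using False quantile_nonpos by force
        then show ?thesis using F0[of n] by (auto simp: p U_def)
      qed
      moreover have "V p = 0" using False by (auto simp: p V_def limit_weight_def)
      ultimately show ?thesis by simp
    qed
  qed
  have "(\<lambda>m. integral\<^sup>N ?P (U (m + n0))) \<longlonglongrightarrow> integral\<^sup>N ?P V"
  proof (rule nn_integral_dominated_convergence[where w = "\<lambda>p. ennreal (c ^ 3) * V p"])
    show "(\<integral>\<^sup>+p. ennreal (c ^ 3) * V p \<partial>?P) < \<infinity>"
      using I by (subst nn_integral_cmult) (auto simp: V_int ennreal_mult_less_top)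
    show "AE p in ?P. U (j + n0) p \<le> ennreal (c ^ 3) * V p" for j using bound by simp
    show "AE p in ?P. (\<lambda>m. U (m + n0) p) \<longlonglongrightarrow> V p"
      using pointwise by (intro AE_I2 LIMSEQ_ignore_initial_segment)
  qed (use U_meas V_meas in \<open>auto\<close>)
  then have "(\<lambda>m. ennreal (?S (m + n0) / hub_scale (m + n0) ^ 3)) \<longlonglongrightarrow>
      ennreal ((hub_const * (\<tau> - 1)) ^ 3 * enn2real (triangle_integral \<tau>))"
    using I hub_const_pos tau_gt by (simp add: U_int V_int ennreal_mult)
  then have "(\<lambda>m. ?S (m + n0) / hub_scale (m + n0) ^ 3) \<longlonglongrightarrow> (hub_const * (\<tau> - 1)) ^ 3 * enn2real (triangle_integral \<tau>)"
  proof (rule tendsto_ennrealD)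
    have "0 \<le> ?S (m + n0)" for m unfolding sum_F[symmetric] by (intro sum_nonneg F_nonneg) simp
    then show "\<forall>\<^sub>F m in sequentially. 0 \<le> ?S (m + n0) / hub_scale (m + n0) ^ 3"
      by (intro always_eventually allI divide_nonneg_nonneg) (auto simp: hub_scale_def)
  qed (use hub_const_pos tau_gt in auto)
  then show ?thesis by (rule LIMSEQ_offset)
qed

end

section \<open>Concentration of the triangle count\<close>

text \<open>If \<open>X\<close> differs from \<open>c\<close> by more than \<open>2 * \<delta>\<close>, then \<open>X - Y\<close> is at least \<open>\<delta>\<close> or \<open>Y\<close> differs from \<open>c\<close> by at least \<open>\<delta>\<close>. Only a bound for the mean of \<open>X\<close>
enters, so that \<open>X\<close> may well have a large variance.\<close>

lemma truncated_chebyshev: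
  fixes X Y :: "'a \<Rightarrow> real"
  assumes fin: "finite \<Omega>" "\<Omega> \<noteq> {}" and le: "\<And>\<omega>. \<omega> \<in> \<Omega> \<Longrightarrow> Y \<omega> \<le> X \<omega>" and \<delta>: "0 < \<delta>"
  shows "real (card {\<omega> \<in> \<Omega>. 2 * \<delta> < \<bar>X \<omega> - c\<bar>}) / real (card \<Omega>) \<le>
    ((\<Sum>\<omega>\<in>\<Omega>. X \<omega>) / real (card \<Omega>) - (\<Sum>\<omega>\<in>\<Omega>. Y \<omega>) / real (card \<Omega>)) / \<delta> +
    ((\<Sum>\<omega>\<in>\<Omega>. (Y \<omega>)\<^sup>2) / real (card \<Omega>) - 2 * c * ((\<Sum>\<omega>\<in>\<Omega>. Y \<omega>) / real (card \<Omega>)) + c\<^sup>2) / \<delta>\<^sup>2"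
proof -
  let ?N = "real (card \<Omega>)"
  have N: "0 < ?N" using fin by (simp add: card_gt_0_iff)
  have each: "of_bool (2 * \<delta> < \<bar>X \<omega> - c\<bar>) \<le> (X \<omega> - Y \<omega>) / \<delta> + (Y \<omega> - c)\<^sup>2 / \<delta>\<^sup>2" if \<omega>: "\<omega> \<in> \<Omega>" for \<omega>
  proof -
    have nn: "0 \<le> (X \<omega> - Y \<omega>) / \<delta>" "0 \<le> (Y \<omega> - c)\<^sup>2 / \<delta>\<^sup>2" using le[OF \<omega>] \<delta> by auto
    show ?thesis
    proof (cases "2 * \<delta> < \<bar>X \<omega> - c\<bar>")
      case True
      then consider "\<delta> \<le> X \<omega> - Y \<omega>" | "\<delta> \<le> \<bar>Y \<omega> - c\<bar>" using le[OF \<omega>] by linarith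
      then show ?thesis
      proof cases
        case 1
        then have "1 \<le> (X \<omega> - Y \<omega>) / \<delta>" using \<delta> by (simp add: field_simps)
        from add_mono[OF this nn(2)] True show ?thesis by simp
      next
        case 2
        then have "\<delta>\<^sup>2 \<le> \<bar>Y \<omega> - c\<bar>\<^sup>2" using \<delta> by (intro power_mono) auto
        then have "1 \<le> (Y \<omega> - c)\<^sup>2 / \<delta>\<^sup>2" using \<delta> by (simp add: field_simps)
        from add_mono[OF nn(1) this] True show ?thesis by simp
      qed
    next
      case False
      with nn show ?thesis by simp
    qed
  qed
  have "real (card {\<omega> \<in> \<Omega>. 2 * \<delta> < \<bar>X \<omega> - c\<bar>}) = (\<Sum>\<omega>\<in>\<Omega>. of_bool (2 * \<delta> < \<bar>X \<omega> - c\<bar>))"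
    by (rule sum_of_bool_filter[symmetric]) (rule fin)
  also have "\<dots> \<le> (\<Sum>\<omega>\<in>\<Omega>. (X \<omega> - Y \<omega>) / \<delta> + (Y \<omega> - c)\<^sup>2 / \<delta>\<^sup>2)" using each by (rule sum_mono)
  also have "\<dots> = ((\<Sum>\<omega>\<in>\<Omega>. X \<omega>) - (\<Sum>\<omega>\<in>\<Omega>. Y \<omega>)) / \<delta> + (\<Sum>\<omega>\<in>\<Omega>. (Y \<omega> - c)\<^sup>2) / \<delta>\<^sup>2"
    by (simp add: sum.distrib sum_subtractf sum_divide_distrib diff_divide_distrib)
  also have "(\<Sum>\<omega>\<in>\<Omega>. (Y \<omega> - c)\<^sup>2) = (\<Sum>\<omega>\<in>\<Omega>. (Y \<omega>)\<^sup>2) - 2 * c * (\<Sum>\<omega>\<in>\<Omega>. Y \<omega>) + ?N * c\<^sup>2"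
    by (simp add: power2_diff sum.distrib sum_subtractf sum_distrib_left sum_distrib_right mult_ac)
  finally have "real (card {\<omega> \<in> \<Omega>. 2 * \<delta> < \<bar>X \<omega> - c\<bar>}) / ?N \<le>
      (((\<Sum>\<omega>\<in>\<Omega>. X \<omega>) - (\<Sum>\<omega>\<in>\<Omega>. Y \<omega>)) / \<delta> + ((\<Sum>\<omega>\<in>\<Omega>. (Y \<omega>)\<^sup>2) - 2 * c * (\<Sum>\<omega>\<in>\<Omega>. Y \<omega>) + ?N * c\<^sup>2) / \<delta>\<^sup>2) / ?N"
    by (intro divide_right_mono) auto
  also have "\<dots> = ((\<Sum>\<omega>\<in>\<Omega>. X \<omega>) / ?N - (\<Sum>\<omega>\<in>\<Omega>. Y \<omega>) / ?N) / \<delta> +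
    ((\<Sum>\<omega>\<in>\<Omega>. (Y \<omega>)\<^sup>2) / ?N - 2 * c * ((\<Sum>\<omega>\<in>\<Omega>. Y \<omega>) / ?N) + c\<^sup>2) / \<delta>\<^sup>2"
    using N \<delta> by (simp add: add_divide_distrib diff_divide_distrib mult.commute)
  finally show ?thesis .
qed

context power_law_degrees
begin

text \<open>The exponent is slightly below \<open>1 / 2\<close>, which reconciles three demands: the threshold is of smaller order than \<open>sqrt n\<close>, so that no triangles are lost in the limit; it tends
to infinity, so that the error \<open>9 / \<omega>\<close> in \<open>edge_prob_lower\<close> vanishes; and it is so close to \<open>sqrt n\<close> that the number of hubs has an order
of at most \<open>hub_scale n powr (11 / 10)\<close>, so that pairs of overlapping triples are negligible.\<close>

definition hub_threshold :: "nat \<Rightarrow> real" where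
  "hub_threshold n = real n powr (1 / 2 - (3 - \<tau>) / 40)"

definition hubs :: "nat \<Rightarrow> nat set" where
  "hubs n = {i \<in> {1..n}. hub_threshold n < real (d n i)}"

definition limit_count :: real where
  "limit_count = (hub_const * (\<tau> - 1)) ^ 3 * enn2real (triangle_integral \<tau>)"

lemma powr_at_top: "0 < a \<Longrightarrow> filterlim (\<lambda>n. real n powr a) at_top sequentially"
proof -
  assume "0 < a"
  then have "filterlim (\<lambda>n. exp (a * ln (real n))) at_top sequentially"
    by (intro filterlim_compose[OF exp_at_top] filterlim_tendsto_pos_mult_at_top[OF tendsto_const]
        filterlim_compose[OF ln_at_top filterlim_real_sequentially])
  then show ?thesis
    by (rule filterlim_mono_eventually)
       (use eventually_gt_at_top[of 0] in \<open>auto elim!: eventually_mono simp: powr_def\<close>)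
qed

lemma hub_threshold_at_top: "filterlim hub_threshold at_top sequentially"
  unfolding hub_threshold_def[abs_def] using tau_gt by (intro powr_at_top) (simp add: field_simps)

lemma hub_scale_at_top: "filterlim hub_scale at_top sequentially"
  unfolding hub_scale_def[abs_def] using tau_lt by (intro powr_at_top) simp

lemma hub_threshold_over_sqrt: "(\<lambda>n. hub_threshold n / sqrt (real n)) \<longlonglongrightarrow> 0"
proof -
  have "(\<lambda>n. real n powr (- ((3 - \<tau>) / 40))) \<longlonglongrightarrow> 0"
    using tau_lt by (intro tendsto_neg_powr filterlim_real_sequentially) simp
  moreover have "\<forall>\<^sub>F n in sequentially. real n powr (- ((3 - \<tau>) / 40)) = hub_threshold n / sqrt (real n)"
    using eventually_ge_at_top[of 1]
  proof eventually_elim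
    case (elim n)
    have "hub_threshold n = real n powr (- ((3 - \<tau>) / 40) + 1 / 2)" by (simp add: hub_threshold_def)
    also have "\<dots> = real n powr (- ((3 - \<tau>) / 40)) * sqrt (real n)"
      by (simp only: powr_add powr_half_sqrt[OF of_nat_0_le_iff])
    finally show ?case using elim by simp
  qed
  ultimately show ?thesis by (rule Lim_transform_eventually)
qed

lemma card_hubs_le:
  "\<exists>c>0. \<forall>\<^sub>F n in sequentially. real (card (hubs n)) \<le> c * hub_scale n powr (11 / 10)"
proof (intro exI conjI)
  let ?c = "K * 2 powr (\<tau> - 1)"
  show "0 < ?c" using K_pos by simp
  have "\<forall>\<^sub>F n in sequentially. 1 \<le> hub_threshold n"
    using hub_threshold_at_top by (simp add: filterlim_at_top)
  then show "\<forall>\<^sub>F n in sequentially. real (card (hubs n)) \<le> ?c * hub_scale n powr (11 / 10)"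
    using eventually_ge_at_top[of 2]
  proof eventually_elim
    case (elim n)
    let ?w = "hub_threshold n"
    \<comment> \<open>The tail bound is about integers; rounding down costs at most a factor two, as \<open>?w \<ge> 1\<close>.\<close>
    define j where "j = nat \<lfloor>?w\<rfloor>"
    have "1 \<le> \<lfloor>?w\<rfloor>" "real j = of_int \<lfloor>?w\<rfloor>" using elim by (auto simp: j_def le_floor_iff)
    then have j: "1 \<le> j" "?w / 2 \<le> real j" "real j \<le> ?w" by linarith+
    have "hubs n \<subseteq> {i \<in> {1..n}. j < d n i}"
    proof
      fix i assume "i \<in> hubs n"
      then have "i \<in> {1..n}" "real j < real (d n i)" using j(3) by (auto simp: hubs_def)
      then show "i \<in> {i \<in> {1..n}. j < d n i}" by simp
    qed
    then have "card (hubs n) \<le> tail_count n j"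
      unfolding tail_count_def by (intro card_mono) auto
    then have "real (card (hubs n)) \<le> real (tail_count n j)" by simp
    also have "\<dots> \<le> real n * (K * real j powr (1 - \<tau>))" by (rule tail_count_le[OF elim(2) j(1)])
    also have "\<dots> \<le> real n * (K * (?w / 2) powr (1 - \<tau>))"
      using j elim tau_gt K_pos by (intro mult_left_mono powr_mono2') auto
    also have "\<dots> = ?c * (real n * ?w powr (1 - \<tau>))"
      using elim powr_minus_divide[of 2 "\<tau> - 1"] by (simp add: powr_divide)
    also have "real n * ?w powr (1 - \<tau>) = real n powr (1 + (1 / 2 - (3 - \<tau>) / 40) * (1 - \<tau>))"
      using elim by (simp add: hub_threshold_def powr_powr powr_add)
    also have "\<dots> \<le> real n powr ((3 - \<tau>) / 2 * (11 / 10))"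
    proof (rule powr_mono)
      have "(3 - \<tau>) / 2 * (11 / 10) - (1 + (1 / 2 - (3 - \<tau>) / 40) * (1 - \<tau>)) = (3 - \<tau>) * (3 - \<tau>) / 40"
        by (simp add: field_simps)
      also have "0 \<le> \<dots>" by simp
      finally show "1 + (1 / 2 - (3 - \<tau>) / 40) * (1 - \<tau>) \<le> (3 - \<tau>) / 2 * (11 / 10)" by simp
    qed (use elim in simp)
    also have "\<dots> = hub_scale n powr (11 / 10)" by (simp add: hub_scale_def powr_powr)
    finally show ?case using K_pos by (simp add: mult_left_mono)
  qed
qed

text \<open>This is used for \<open>p = 2\<close>, \<open>q = 3\<close> (degenerate triples) and for \<open>p = 5\<close>, \<open>q = 6\<close> (overlapping pairs of triples).\<close>

lemma card_hubs_power_negligible: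
  assumes "11 / 10 * real p < real q"
  shows "(\<lambda>n. real (card (hubs n)) ^ p / hub_scale n ^ q) \<longlonglongrightarrow> 0"
proof -
  obtain c where c: "0 < c" "\<forall>\<^sub>F n in sequentially. real (card (hubs n)) \<le> c * hub_scale n powr (11 / 10)"
    using card_hubs_le by auto
  let ?e = "11 / 10 * real p - real q"
  have "(\<lambda>n. c ^ p * hub_scale n powr ?e) \<longlonglongrightarrow> c ^ p * 0"
    using assms by (intro tendsto_mult tendsto_const tendsto_neg_powr hub_scale_at_top) simp
  then have lim: "(\<lambda>n. c ^ p * hub_scale n powr ?e) \<longlonglongrightarrow> 0" by simp
  show ?thesis
  proof (rule Lim_null_comparison[OF _ lim])
    show "\<forall>\<^sub>F n in sequentially. norm (real (card (hubs n)) ^ p / hub_scale n ^ q) \<le> c ^ p * hub_scale n powr ?e"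
      using c(2) eventually_ge_at_top[of 1]
    proof eventually_elim
      case (elim n)
      have N: "0 < hub_scale n" using elim by (intro hub_scale_pos)
      have "real (card (hubs n)) ^ p / hub_scale n ^ q \<le> (c * hub_scale n powr (11 / 10)) ^ p / hub_scale n ^ q"
        using elim N by (intro divide_right_mono power_mono) auto
      also have "\<dots> = c ^ p * hub_scale n powr ?e"
        using N by (simp add: power_mult_distrib powr_power powr_diff powr_realpow mult.commute)
      finally show ?case using N by simp
    qed
  qed
qed

lemma weight_sum_all_tendsto:
  "(\<lambda>n. (\<Sum>t\<in>triples {1..n}. triangle_weight (switch_volume n (d n)) (d n) t) / hub_scale n ^ 3) \<longlonglongrightarrow> limit_count"
proof -
  have "(\<lambda>n. (\<Sum>t\<in>triples {i \<in> {1..n}. 0 < real (d n i)}. triangle_weight (switch_volume n (d n)) (d n) t) / hub_scale n ^ 3)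
      \<longlonglongrightarrow> limit_count"
    unfolding limit_count_def by (rule weight_sum_tendsto[OF switch_volume_tendsto]) auto
  moreover have "\<forall>\<^sub>F n in sequentially.
      (\<Sum>t\<in>triples {i \<in> {1..n}. 0 < real (d n i)}. triangle_weight (switch_volume n (d n)) (d n) t) / hub_scale n ^ 3 =
      (\<Sum>t\<in>triples {1..n}. triangle_weight (switch_volume n (d n)) (d n) t) / hub_scale n ^ 3"
    using eventually_ge_at_top[of 2]
  proof eventually_elim
    case (elim n)
    then have "{i \<in> {1..n}. 0 < real (d n i)} = {1..n}" using degree_pos by auto
    then show ?case by simp
  qed
  ultimately show ?thesis by (rule Lim_transform_eventually)
qed

lemma weight_sum_hubs_tendsto:
  assumes "(\<lambda>n. \<theta> n / real n) \<longlonglongrightarrow> \<mu>"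
  shows "(\<lambda>n. (\<Sum>t\<in>triples (hubs n). triangle_weight (\<theta> n) (d n) t) / hub_scale n ^ 3) \<longlonglongrightarrow> limit_count"
  unfolding hubs_def limit_count_def
  by (rule weight_sum_tendsto[OF assms hub_threshold_over_sqrt]) (simp add: hub_threshold_def)

definition deficit :: "nat \<Rightarrow> real" where
  "deficit n = connection_rate n (d n) + 9 / hub_threshold n"

lemma deficit_tendsto: "deficit \<longlonglongrightarrow> 0"
proof -
  have "(\<lambda>n. connection_rate n (d n) + 9 / hub_threshold n) \<longlonglongrightarrow> 0 + 0"
    by (intro tendsto_add connection_rate_tendsto tendsto_divide_0[OF tendsto_const] filterlim_at_top_imp_at_infinity hub_threshold_at_top)
  then show ?thesis by (simp add: deficit_def[abs_def])
qed

definition mean_upper :: "nat \<Rightarrow> real" where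
  "mean_upper n = (\<Sum>t\<in>triples {1..n}. triangle_weight (switch_volume n (d n)) (d n) t) / hub_scale n ^ 3"

definition hub_mean_lower :: "nat \<Rightarrow> real" where
  "hub_mean_lower n = (1 - deficit n) ^ 3 *
     ((\<Sum>t\<in>triples (hubs n). triangle_weight (real (total_degree n (d n))) (d n) t) - 3 * real (card (hubs n)) ^ 2) / hub_scale n ^ 3"

definition hub_square_upper :: "nat \<Rightarrow> real" where
  "hub_square_upper n =
     ((\<Sum>t\<in>triples (hubs n). triangle_weight (switch_volume n (d n)) (d n) t)\<^sup>2 + 9 * real (card (hubs n)) ^ 5) / hub_scale n ^ 6"

lemma mean_upper_tendsto: "mean_upper \<longlonglongrightarrow> limit_count"
  unfolding mean_upper_def[abs_def] by (rule weight_sum_all_tendsto)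

lemma hub_mean_lower_tendsto: "hub_mean_lower \<longlonglongrightarrow> limit_count"
proof -
  have "(\<lambda>n. (1 - deficit n) ^ 3 * ((\<Sum>t\<in>triples (hubs n). triangle_weight (real (total_degree n (d n))) (d n) t) / hub_scale n ^ 3
      - 3 * (real (card (hubs n)) ^ 2 / hub_scale n ^ 3))) \<longlonglongrightarrow> (1 - 0) ^ 3 * (limit_count - 3 * 0)"
    by (intro tendsto_mult tendsto_power tendsto_diff tendsto_const deficit_tendsto
        weight_sum_hubs_tendsto total_degree_tendsto card_hubs_power_negligible) simp
  then show ?thesis by (simp add: hub_mean_lower_def[abs_def] flip: diff_divide_distrib)
qed

lemma hub_square_upper_tendsto: "hub_square_upper \<longlonglongrightarrow> limit_count\<^sup>2"
proof -
  have "(\<lambda>n. ((\<Sum>t\<in>triples (hubs n). triangle_weight (switch_volume n (d n)) (d n) t) / hub_scale n ^ 3)\<^sup>2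
      + 9 * (real (card (hubs n)) ^ 5 / hub_scale n ^ 6)) \<longlonglongrightarrow> limit_count\<^sup>2 + 9 * 0"
    by (intro tendsto_mult tendsto_power tendsto_add tendsto_const
        weight_sum_hubs_tendsto switch_volume_tendsto card_hubs_power_negligible) simp
  then show ?thesis
    by (simp add: hub_square_upper_def[abs_def] add_divide_distrib power_divide power_mult[symmetric])
qed

text \<open>Here \<open>X\<close> is the scaled number of all ordered triangles and \<open>Y\<close> that of the ordered triangles spanned by hubs.\<close>

lemma deviation_fraction_le:
  assumes \<delta>: "0 < \<delta>" and n: "2 \<le> n" and pos: "0 < switch_volume n (d n)"
    and thr: "1 \<le> hub_threshold n" and def: "deficit n \<le> 1"
  shows "real (card {G \<in> graphs_with_degrees n (d n).
      2 * \<delta> < \<bar>6 * real (card (triangles G)) / hub_scale n ^ 3 - limit_count\<bar>}) / real (card (graphs_with_degrees n (d n)))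
    \<le> (mean_upper n - hub_mean_lower n) / \<delta> +
      (hub_square_upper n - 2 * limit_count * hub_mean_lower n + limit_count\<^sup>2) / \<delta>\<^sup>2"
proof -
  let ?\<Omega> = "graphs_with_degrees n (d n)"
  let ?T = "real (card ?\<Omega>)"
  let ?X = "\<lambda>G. real (card (ordered_triangles {1..n} G)) / hub_scale n ^ 3"
  let ?Y = "\<lambda>G. real (card (ordered_triangles (hubs n) G)) / hub_scale n ^ 3"
  have fin: "finite ?\<Omega>" "?\<Omega> \<noteq> {}" using finite_graphs_with_degrees graphs_nonempty[OF n] by auto
  have T: "0 < ?T" using fin by (simp add: card_gt_0_iff)
  have N: "0 < hub_scale n" using n by (intro hub_scale_pos) simp
  have hubs: "hubs n \<subseteq> {1..n}" by (auto simp: hubs_def)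
  have YX: "?Y G \<le> ?X G" for G
  proof -
    have "ordered_triangles (hubs n) G \<subseteq> ordered_triangles {1..n} G"
      using hubs by (auto simp: ordered_triangles_def triples_def)
    moreover have "finite (ordered_triangles {1..n} G)" by (simp add: ordered_triangles_def)
    ultimately have "card (ordered_triangles (hubs n) G) \<le> card (ordered_triangles {1..n} G)" by (intro card_mono)
    then show ?thesis using N by (intro divide_right_mono) auto
  qed
  have X: "(\<Sum>G\<in>?\<Omega>. ?X G) / ?T \<le> mean_upper n"
  proof -
    have "(\<Sum>G\<in>?\<Omega>. ?X G) / ?T = (\<Sum>G\<in>?\<Omega>. real (card (ordered_triangles {1..n} G))) / ?T / hub_scale n ^ 3"
      by (simp add: sum_divide_distrib mult.commute)
    also have "\<dots> \<le> mean_upper n" unfolding mean_upper_def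
      using first_moment_upper[OF pos] T N by (intro divide_right_mono) (simp_all add: pos_divide_le_eq)
    finally show ?thesis .
  qed
  have Y: "hub_mean_lower n \<le> (\<Sum>G\<in>?\<Omega>. ?Y G) / ?T"
  proof -
    have thr_le: "hub_threshold n \<le> real (d n i)" if "i \<in> hubs n" for i using that by (simp add: hubs_def)
    have "hub_mean_lower n \<le> (\<Sum>G\<in>?\<Omega>. real (card (ordered_triangles (hubs n) G))) / ?T / hub_scale n ^ 3"
      unfolding hub_mean_lower_def
      using first_moment_lower[OF hubs pos thr thr_le] def T N
      by (intro divide_right_mono) (simp_all add: pos_le_divide_eq deficit_def)
    also have "\<dots> = (\<Sum>G\<in>?\<Omega>. ?Y G) / ?T" by (simp add: sum_divide_distrib mult.commute)
    finally show ?thesis .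
  qed
  have Y2: "(\<Sum>G\<in>?\<Omega>. (?Y G)\<^sup>2) / ?T \<le> hub_square_upper n"
  proof -
    have "(\<Sum>G\<in>?\<Omega>. (?Y G)\<^sup>2) / ?T = (\<Sum>G\<in>?\<Omega>. (real (card (ordered_triangles (hubs n) G)))\<^sup>2) / ?T / hub_scale n ^ 6"
      by (simp add: sum_divide_distrib power_divide power_mult[symmetric] mult.commute)
    also have "\<dots> \<le> hub_square_upper n" unfolding hub_square_upper_def
      using second_moment_upper[OF hubs pos] T N by (intro divide_right_mono) (simp_all add: pos_divide_le_eq)
    finally show ?thesis .
  qed
  have L: "0 \<le> limit_count" using hub_const_pos tau_gt by (simp add: limit_count_def)
  have "{G \<in> ?\<Omega>. 2 * \<delta> < \<bar>6 * real (card (triangles G)) / hub_scale n ^ 3 - limit_count\<bar>} =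
      {G \<in> ?\<Omega>. 2 * \<delta> < \<bar>?X G - limit_count\<bar>}"
    by (auto simp: card_ordered_triangles[unfolded One_nat_def])
  then have "real (card {G \<in> ?\<Omega>. 2 * \<delta> < \<bar>6 * real (card (triangles G)) / hub_scale n ^ 3 - limit_count\<bar>}) / ?T
      \<le> ((\<Sum>G\<in>?\<Omega>. ?X G) / ?T - (\<Sum>G\<in>?\<Omega>. ?Y G) / ?T) / \<delta> +
      ((\<Sum>G\<in>?\<Omega>. (?Y G)\<^sup>2) / ?T - 2 * limit_count * ((\<Sum>G\<in>?\<Omega>. ?Y G) / ?T) + limit_count\<^sup>2) / \<delta>\<^sup>2"
    using truncated_chebyshev[OF fin YX \<delta>, where c = limit_count] by simp
  also have "\<dots> \<le> (mean_upper n - hub_mean_lower n) / \<delta> +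
      (hub_square_upper n - 2 * limit_count * hub_mean_lower n + limit_count\<^sup>2) / \<delta>\<^sup>2"
    using X Y Y2 L \<delta>
    by (intro add_mono divide_right_mono diff_mono mult_left_mono order_refl) auto
  finally show ?thesis .
qed

lemma deviation_probability_tendsto:
  assumes \<epsilon>: "0 < \<epsilon>"
  shows "(\<lambda>n. measure_pmf.prob (pmf_of_set (graphs_with_degrees n (d n)))
      {G. \<epsilon> < \<bar>real (card (triangles G)) / real n powr (3 / 2 * (3 - \<tau>)) - limit_count / 6\<bar>}) \<longlonglongrightarrow> 0"
proof -
  \<comment> \<open>There are six orderings of a triangle, and \<open>truncated_chebyshev\<close> deals with deviations of \<open>2 * \<delta>\<close>.\<close>
  define \<delta> where "\<delta> = 3 * \<epsilon>"
  have \<delta>: "0 < \<delta>" using \<epsilon> by (simp add: \<delta>_def)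
  let ?b = "\<lambda>n. (mean_upper n - hub_mean_lower n) / \<delta> +
      (hub_square_upper n - 2 * limit_count * hub_mean_lower n + limit_count\<^sup>2) / \<delta>\<^sup>2"
  have "?b \<longlonglongrightarrow> (limit_count - limit_count) / \<delta> + (limit_count\<^sup>2 - 2 * limit_count * limit_count + limit_count\<^sup>2) / \<delta>\<^sup>2"
    using \<delta> by (intro tendsto_intros mean_upper_tendsto hub_mean_lower_tendsto hub_square_upper_tendsto) auto
  then have lim: "?b \<longlonglongrightarrow> 0" by (simp add: power2_eq_square)
  have thr: "\<forall>\<^sub>F n in sequentially. 1 \<le> hub_threshold n"
    using hub_threshold_at_top by (simp add: filterlim_at_top)
  have def: "\<forall>\<^sub>F n in sequentially. deficit n < 1" by (rule order_tendstoD(2)[OF deficit_tendsto]) simp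
  show ?thesis
  proof (rule Lim_null_comparison[OF _ lim])
    show "\<forall>\<^sub>F n in sequentially. norm (measure_pmf.prob (pmf_of_set (graphs_with_degrees n (d n)))
      {G. \<epsilon> < \<bar>real (card (triangles G)) / real n powr (3 / 2 * (3 - \<tau>)) - limit_count / 6\<bar>}) \<le> ?b n"
      using eventually_ge_at_top[of 2] eventually_switch_volume_pos thr def
    proof eventually_elim
      case (elim n)
      let ?\<Omega> = "graphs_with_degrees n (d n)"
      have scale: "real n powr (3 / 2 * (3 - \<tau>)) = hub_scale n ^ 3"
      proof -
        have "hub_scale n ^ 3 = real n powr (real 3 * ((3 - \<tau>) / 2))"
          unfolding hub_scale_def using elim by (intro powr_power) simp
        also have "real 3 * ((3 - \<tau>) / 2) = 3 / 2 * (3 - \<tau>)" by simp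
        finally show ?thesis by simp
      qed
      have "\<epsilon> < \<bar>r - limit_count / 6\<bar> \<longleftrightarrow> 2 * \<delta> < \<bar>6 * r - limit_count\<bar>" for r
        unfolding \<delta>_def by linarith
      then have "\<epsilon> < \<bar>x / hub_scale n ^ 3 - limit_count / 6\<bar> \<longleftrightarrow> 2 * \<delta> < \<bar>6 * x / hub_scale n ^ 3 - limit_count\<bar>" for x
        by (metis times_divide_eq_right)
      then have "?\<Omega> \<inter> {G. \<epsilon> < \<bar>real (card (triangles G)) / real n powr (3 / 2 * (3 - \<tau>)) - limit_count / 6\<bar>} =
          {G \<in> ?\<Omega>. 2 * \<delta> < \<bar>6 * real (card (triangles G)) / hub_scale n ^ 3 - limit_count\<bar>}"
        unfolding scale by auto
      then show ?case
        using deviation_fraction_le[OF \<delta> elim(1-3)] elim(4) graphs_nonempty[OF elim(1)]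
        by (simp add: measure_pmf_of_set finite_graphs_with_degrees)
    qed
  qed
qed

lemma limit_count_eq:
  "limit_count / 6 = 1 / 6 * (C * (\<tau> - 1)) ^ 3 * \<mu> powr (- (3 / 2) * (\<tau> - 1)) * enn2real (triangle_integral \<tau>)"
proof -
  have "(\<mu> powr ((1 - \<tau>) / 2)) ^ 3 = \<mu> powr (- (3 / 2) * (\<tau> - 1))"
  proof -
    have "(\<mu> powr ((1 - \<tau>) / 2)) ^ 3 = \<mu> powr (real 3 * ((1 - \<tau>) / 2))"
      using mean_ge_1 by (intro powr_power) simp
    also have "real 3 * ((1 - \<tau>) / 2) = - (3 / 2) * (\<tau> - 1)" by (simp add: field_simps)
    finally show ?thesis .
  qed
  then show ?thesis by (simp add: limit_count_def hub_const_def power_mult_distrib mult_ac)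
qed

end

theorem theorem1:
  fixes \<tau> C \<mu> :: real and d :: "nat \<Rightarrow> nat \<Rightarrow> nat" and D :: "nat pmf"
  assumes "2 < \<tau>" and "\<tau> < 3" and "0 < C"
    and "degree_sequences d"
    and "power_law_tail_bound \<tau> d"
    and "power_law_tail_asymp \<tau> C d"
    and "power_law \<tau> C D"
    and "\<mu> = measure_pmf.expectation D real"
  shows "triangle_integral \<tau> < \<infinity> \<and>
    tendsto_in_prob (\<lambda>n. measure_pmf (pmf_of_set (graphs_with_degrees n (d n))))
      (\<lambda>n G. real (card (triangles G)) / real n powr (3 / 2 * (3 - \<tau>)))
      (1 / 6 * (C * (\<tau> - 1)) ^ 3 * \<mu> powr (- (3 / 2) * (\<tau> - 1)) * enn2real (triangle_integral \<tau>))"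
proof -
  obtain K where "0 < K" "\<And>n j. 2 \<le> n \<Longrightarrow> j \<in> {1..max_degree n (d n)} \<Longrightarrow>
      1 - degree_cdf n (d n) j \<le> K * real j powr (1 - \<tau>)"
    using assms(5) unfolding power_law_tail_bound_def by blast
  then interpret power_law_degrees \<tau> C \<mu> K d D
    using assms by unfold_locales
  show ?thesis
    unfolding tendsto_in_prob_def limit_count_eq[symmetric]
    using triangle_integral_finite[OF assms(1,2)] deviation_probability_tendsto by simp
qed

end
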